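(* The following decision problem (called SHP) is NP-complete. Instance: an integer $n\ge 2$ and a vector $\boldsymbol{w}=(w_1,\dots,w_n)$ of positive integers (encoded in binary) such that $w_i$ is even for each $i\in\{1,\dots,n-1\}$ and $w_n=1$. Question: letting $W=\sum_{i=1}^n w_i$ and letting $(N,v)$ be the bankruptcy game $\mathrm{BG}[\lfloor W/2\rfloor;\boldsymbol{w}]$, does the Shapley value $\phi_n$ of player $n$ in $(N,v)$ satisfy $\phi_n<\tfrac12$?
   Context: Let $N=\{1,\dots,n\}$. For a vector $\boldsymbol{w}=(w_1,\dots,w_n)$ of positive rationals and a rational $E$ with $0<E<W:=\sum_{i\in N}w_i$, the bankruptcy game $\mathrm{BG}[E;\boldsymbol{w}]$ is the cooperative game $(N,v)$ with characteristic function $v(S)=\max\{0,\,E-\sum_{i\in N\setminus S}w_i\}$ for all $S\subseteq N$. A permutation of $N$ is a bijection $\pi:\{1,\dots,n\}\to N$, where $\pi(j)$ is the player at position $j$; $\Pi_N$ is the set of all permutations of $N$; $\mathrm{Prc}(\pi,i)$ is the set of players preceding $i$ in $\pi$. The marginal contribution is $\delta_v(\pi,i)=v(\mathrm{Prc}(\pi,i)\cup\{i\})-v(\mathrm{Prc}(\pi,i))$, and the Shapley value of $(N,v)$ is $\phi=(\phi_1,\dots,\phi_n)$ with $\phi_i=\frac{1}{n!}\sum_{\pi\in\Pi_N}\delta_v(\pi,i)$. *)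

theory Defs
  imports Complex_Main "HOL-Combinatorics.Permutations"
    "HOL-Computational_Algebra.Polynomial"
begin

section \<open>Bankruptcy games and the Shapley value\<close>

text \<open>The player set is \<open>N = {1..n}\<close>; a characteristic function is a map on coalitions.\<close>

definition bankruptcy_game :: "nat \<Rightarrow> rat \<Rightarrow> (nat \<Rightarrow> rat) \<Rightarrow> nat set \<Rightarrow> rat" where
  "bankruptcy_game n E w S = max 0 (E - (\<Sum>i\<in>{1..n} - S. w i))"

text \<open>\<open>\<pi> j\<close> is the player at position \<open>j\<close>, so \<open>inv \<pi> i\<close> is the position of player \<open>i\<close>.\<close>

definition Prc :: "(nat \<Rightarrow> nat) \<Rightarrow> nat \<Rightarrow> nat set" where
  "Prc \<pi> i = \<pi> ` {1..<inv \<pi> i}"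

definition marginal :: "(nat set \<Rightarrow> rat) \<Rightarrow> (nat \<Rightarrow> nat) \<Rightarrow> nat \<Rightarrow> rat" where
  "marginal v \<pi> i = v (Prc \<pi> i \<union> {i}) - v (Prc \<pi> i)"

definition shapley :: "nat \<Rightarrow> (nat set \<Rightarrow> rat) \<Rightarrow> nat \<Rightarrow> rat" where
  "shapley n v i = 1 / fact n * (\<Sum>\<pi> | \<pi> permutes {1..n}. marginal v \<pi> i)"


section \<open>Multi-tape Turing machines\<close>

text \<open>
  The states of a machine \<open>M\<close> are \<open>0, \<dots>, states M\<close>, where \<open>0\<close> is the start state and
  \<open>states M\<close> is the unique halting state. The tape alphabet is \<open>{..<symbols M}\<close>, where
  \<open>0\<close> is the blank and \<open>1\<close>, \<open>2\<close> represent the bits \<open>False\<close>, \<open>True\<close>. The transition function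
  maps a non-halting state and the scanned symbols to the next state and, for each tape, the
  symbol to be written and the head movement. Tapes are infinite in both directions.
\<close>

datatype move = MoveLeft | Stay | MoveRight

record tm =
  tapes :: nat
  states :: nat
  symbols :: nat
  trans :: "nat \<Rightarrow> nat list \<Rightarrow> nat \<times> (nat \<times> move) list"

text \<open>Only the (finite) restriction of \<open>trans M\<close> to the arguments below is ever used.\<close>

definition valid_tm :: "tm \<Rightarrow> bool" where
  "valid_tm M \<longleftrightarrow> 3 \<le> symbols M \<and>
    (\<forall>q < states M. \<forall>ss. length ss = tapes M \<and> set ss \<subseteq> {..<symbols M} \<longrightarrow>
      (case trans M q ss of (q', as) \<Rightarrow>
        q' \<le> states M \<and> length as = tapes M \<and> (\<forall>(s, m) \<in> set as. s < symbols M)))"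

text \<open>A tape consists of its contents and the position of its head.\<close>

type_synonym tape = "(int \<Rightarrow> nat) \<times> int"
type_synonym config = "nat \<times> tape list"

fun scan :: "tape \<Rightarrow> nat" where
  "scan (c, h) = c h"

fun shift :: "move \<Rightarrow> int \<Rightarrow> int" where
  "shift MoveLeft h = h - 1"
| "shift Stay h = h"
| "shift MoveRight h = h + 1"

fun act :: "nat \<times> move \<Rightarrow> tape \<Rightarrow> tape" where
  "act (s, m) (c, h) = (c(h := s), shift m h)"

fun step :: "tm \<Rightarrow> config \<Rightarrow> config" where
  "step M (q, ts) =
    (if q = states M then (q, ts)
     else (case trans M q (map scan ts) of (q', as) \<Rightarrow> (q', map2 act as ts)))"

type_synonym word = "bool list"

definition word_tape :: "word \<Rightarrow> int \<Rightarrow> nat" where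
  "word_tape x i = (if 0 \<le> i \<and> i < int (length x) then (if x ! nat i then 2 else 1) else 0)"

text \<open>
  Tape \<open>0\<close> is the output tape, the input words are given on the tapes \<open>1, \<dots>, length xs\<close>,
  and all other tapes are initially blank. All heads start at cell \<open>0\<close>.
\<close>

definition init :: "tm \<Rightarrow> word list \<Rightarrow> config" where
  "init M xs =
    (0, map (\<lambda>x. (word_tape x, 0)) ([] # xs @ replicate (tapes M - Suc (length xs)) []))"

text \<open>Halting configurations are fixed by \<open>step M\<close>, so \<open>t\<close> is an upper bound for the running time.\<close>

definition outputs_within :: "tm \<Rightarrow> word list \<Rightarrow> word \<Rightarrow> nat \<Rightarrow> bool" where
  "outputs_within M xs y t \<longleftrightarrow>
    (case (step M ^^ t) (init M xs) of (q, ts) \<Rightarrow> q = states M \<and> fst (hd ts) = word_tape y)"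


section \<open>NP-completeness\<close>

text \<open>Polynomial-time computability of functions of \<open>k\<close> words.\<close>

definition polytime :: "nat \<Rightarrow> (word list \<Rightarrow> word) \<Rightarrow> bool" where
  "polytime k f \<longleftrightarrow> (\<exists>M (p :: nat poly). valid_tm M \<and> k < tapes M \<and>
    (\<forall>xs. length xs = k \<longrightarrow> outputs_within M xs (f xs) (poly p (\<Sum>x\<leftarrow>xs. length x))))"

type_synonym language = "word set"

text \<open>The certificate \<open>u\<close> is passed to the deterministic verifier \<open>V\<close> on a tape of its own.\<close>

definition NP :: "language set" where
  "NP = {L. \<exists>(V :: word \<Rightarrow> word \<Rightarrow> bool) (p :: nat poly).
    polytime 2 (\<lambda>xs. [V (xs ! 0) (xs ! 1)]) \<and>
    (\<forall>x. x \<in> L \<longleftrightarrow> (\<exists>u. length u \<le> poly p (length x) \<and> V x u))}"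

definition poly_reducible :: "language \<Rightarrow> language \<Rightarrow> bool" where
  "poly_reducible L L' \<longleftrightarrow>
    (\<exists>f :: word \<Rightarrow> word. polytime 1 (\<lambda>xs. f (xs ! 0)) \<and> (\<forall>x. x \<in> L \<longleftrightarrow> f x \<in> L'))"

definition NP_hard :: "language \<Rightarrow> bool" where
  "NP_hard L \<longleftrightarrow> (\<forall>L' \<in> NP. poly_reducible L' L)"

definition NP_complete :: "language \<Rightarrow> bool" where
  "NP_complete L \<longleftrightarrow> L \<in> NP \<and> NP_hard L"


section \<open>The decision problem SHP\<close>

text \<open>Binary digits, least significant digit first and without superfluous zeros.\<close>

fun binary :: "nat \<Rightarrow> bool list" where
  "binary m = (if m = 0 then [] else odd m # binary (m div 2))"

declare binary.simps [simp del]

text \<open>In a word, each binary digit \<open>b\<close> is written \<open>[True, b]\<close> and \<open>[False]\<close> ends a number.\<close>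

definition encode_nat :: "nat \<Rightarrow> word" where
  "encode_nat m = concat (map (\<lambda>b. [True, b]) (binary m)) @ [False]"

definition encode :: "nat list \<Rightarrow> word" where
  "encode ws = concat (map encode_nat ws)"

lemma horner_sum_binary: "horner_sum of_bool 2 (binary m) = m"
proof (induction m rule: binary.induct)
  case (1 m)
  show ?case
  proof (cases "m = 0")
    case True
    then show ?thesis by (simp add: binary.simps[of 0])
  next
    case False
    then have "horner_sum of_bool 2 (binary (m div 2)) = m div 2" by (rule 1)
    moreover have "binary m = odd m # binary (m div 2)"
      using False by (subst binary.simps) simp
    ultimately have "horner_sum of_bool 2 (binary m) = of_bool (odd m) + 2 * (m div 2)"
      by (simp only: horner_sum_simps)
    also have "\<dots> = m" by (simp only: odd_iff_mod_2_eq_one of_bool_def) presburger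
    finally show ?thesis .
  qed
qed

lemma encode_nat_prefix_free:
  assumes "encode_nat a @ x = encode_nat b @ y"
  shows "a = b \<and> x = y"
proof -
  have "bs = cs \<and> x = y"
    if "concat (map (\<lambda>b. [True, b]) bs) @ False # x = concat (map (\<lambda>b. [True, b]) cs) @ False # y"
    for bs cs
    using that
  proof (induction bs arbitrary: cs)
    case Nil
    then show ?case by (cases cs) simp_all
  next
    case (Cons c bs)
    from Cons.prems obtain cs' where cs: "cs = c # cs'"
      and eq: "concat (map (\<lambda>b. [True, b]) bs) @ False # x =
               concat (map (\<lambda>b. [True, b]) cs') @ False # y"
      by (cases cs) simp_all
    show ?case using Cons.IH[OF eq] unfolding cs by blast
  qed
  from this[of "binary a" "binary b"] assms have "binary a = binary b \<and> x = y"
    unfolding encode_nat_def append_assoc append_Cons append_Nil by blast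
  then show ?thesis by (metis horner_sum_binary)
qed

lemma inj_encode: "inj encode"
proof (rule injI)
  have ne: "encode_nat a \<noteq> []" for a
    unfolding encode_nat_def by simp
  fix us ws
  assume "encode us = encode ws"
  then show "us = ws"
  proof (induction us arbitrary: ws)
    case Nil
    then show ?case using ne by (cases ws) (simp_all add: encode_def)
  next
    case (Cons u us)
    show ?case
    proof (cases ws)
      case Nil
      then show ?thesis using Cons.prems ne by (simp add: encode_def)
    next
      case (Cons w ws')
      then have "encode_nat u @ encode us = encode_nat w @ encode ws'"
        using Cons.prems unfolding encode_def by simp
      then have "u = w" "encode us = encode ws'"
        using encode_nat_prefix_free by blast+
      then show ?thesis using Cons Cons.IH by simp
    qed
  qed
qed

text \<open>The vector \<open>(w\<^sub>1, \<dots>, w\<^sub>n)\<close> is given by a list \<open>ws\<close> of length \<open>n\<close>, where \<open>w\<^sub>i = ws ! (i - 1)\<close>.\<close>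

definition SHP_instance :: "nat list \<Rightarrow> bool" where
  "SHP_instance ws \<longleftrightarrow> (let n = length ws; w = (\<lambda>i. ws ! (i - 1)) in
    n \<ge> 2 \<and> (\<forall>i\<in>{1..n}. w i > 0) \<and> (\<forall>i\<in>{1..n - 1}. even (w i)) \<and> w n = 1)"

definition SHP_question :: "nat list \<Rightarrow> bool" where
  "SHP_question ws \<longleftrightarrow>
    (let n = length ws;
         w = (\<lambda>i. rat_of_nat (ws ! (i - 1)));
         W = (\<Sum>i\<in>{1..n}. w i);
         v = bankruptcy_game n (of_int \<lfloor>W / 2\<rfloor>) w
     in shapley n v n < 1 / 2)"

definition SHP :: language where
  "SHP = {encode ws |ws. SHP_instance ws \<and> SHP_question ws}"

end

theory Submission
  imports Defs "HOL-Library.Countable"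
begin

text \<open>
  With \<open>A = (w\<^sub>1 + \<dots> + w\<^sub>n\<^sub>-\<^sub>1) / 2\<close>, the marginal contribution of player \<open>n\<close> is \<open>1\<close> if the weight following it is
  less than \<open>A\<close>, and \<open>0\<close> otherwise. Reversing the order exchanges the weights below and above \<open>A\<close>, so that the Shapley
  value is less than \<open>1/2\<close> iff some order attains \<open>A\<close> exactly, that is, iff the even weights can be partitioned into two
  halves.

  Membership in \<open>NP\<close>: a certificate selects one of the halves, and both sums are compared bit by bit, with carries that are
  bounded by the number of weights. Hardness: the runs of a verifier on \<open>x\<close> are the satisfying assignments of a
  formula of polynomial size, in which a few clause templates are repeated along a line of positions. It is encoded by numbers
  whose digits belong to the variables and the placed clauses; the base is so large that no carries occur. Both the
  verifier and the reduction are programs whose only memory is a fixed number of counters of polynomial size; a counter is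
  the position of a head.
\<close>

section \<open>The Shapley value and partitions\<close>

text \<open>The odd total \<open>W = 2 * A + 1\<close> makes \<open>\<lfloor>W / 2\<rfloor>\<close>
  equal to \<open>A\<close>, so the single unit of player \<open>n\<close> separates weights below
  \<open>A\<close> from all others, and only ties with \<open>A\<close> keep the value below
  \<open>1/2\<close>. Partition is symmetric under complement while satisfiability is not. A single
  item \<open>Falsum\<close>, shared by all clauses, breaks the symmetry: the half that lacks it is
  read as the assignment. The reduction can neither store nor add large numbers, since its counters
  have polynomial size. Hence everything is made uniform: a fixed machine has finitely many
  templates, and every item with index \<open>r\<close> is, up to a shift by \<open>r\<close> and
  the width of one gap, a member of a fixed finite list, so that it is written as zeros around
  constants; only \<open>Falsum\<close> is different. Viewing the tapes relative to the head serves
  the same end: transitions occur in a fixed column of the tableau and the head position is never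
  encoded. Likewise the verifier forms no sums; it keeps only the carries and the number of ones in
  the current binary column.\<close>

definition halves :: "nat list \<Rightarrow> nat set \<Rightarrow> bool" where
  "halves ws I \<longleftrightarrow> I \<subseteq> {1..<length ws} \<and>
    2 * (\<Sum>i\<in>I. ws ! (i - 1)) = (\<Sum>i\<in>{1..<length ws}. ws ! (i - 1))"

text \<open>The game subtracts from \<open>E\<close> the weights outside a coalition, so what player
  \<open>n\<close> gains is decided by the players after it, not directly by those before
  it.\<close>

definition followers :: "nat \<Rightarrow> (nat \<Rightarrow> nat) \<Rightarrow> nat set" where
  "followers n \<pi> = \<pi> ` {inv \<pi> n<..n}"

lemma followers_props:
  assumes "\<pi> permutes {1..n}" "1 \<le> n"
  shows "followers n \<pi> \<subseteq> {1..<n}" "Prc \<pi> n = {1..<n} - followers n \<pi>"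
proof -
  let ?k = "inv \<pi> n"
  have k: "?k \<in> {1..n}" "\<pi> ?k = n"
    using permutes_in_image[OF permutes_inv[OF assms(1)], of n] assms permutes_inverses by fastforce+
  have inj: "inj \<pi>" using assms(1) by (rule permutes_inj)
  have im: "\<pi> ` {1..n} = {1..n}" using assms(1) by (rule permutes_image)
  have "{1..n} - {?k} = {1..<?k} \<union> {?k<..n}" using k(1) by auto
  then have "\<pi> ` {1..<?k} \<union> followers n \<pi> = {1..n} - {n}"
    unfolding followers_def image_Un[symmetric] using image_set_diff[OF inj, of "{1..n}" "{?k}"] im k by simp
  also have "{1..n} - {n} = {1..<n}" by auto
  finally have un: "Prc \<pi> n \<union> followers n \<pi> = {1..<n}" unfolding Prc_def .
  moreover have "Prc \<pi> n \<inter> followers n \<pi> = {}"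
    unfolding Prc_def followers_def image_Int[OF inj, symmetric] by auto
  ultimately show "followers n \<pi> \<subseteq> {1..<n}" "Prc \<pi> n = {1..<n} - followers n \<pi>" by auto
qed

text \<open>Reversing an order turns the followers of player \<open>n\<close> into its predecessors.\<close>

lemma followers_reverse:
  assumes "1 \<le> n"
  obtains rev where "bij_betw rev {\<pi>. \<pi> permutes {1..n}} {\<pi>. \<pi> permutes {1..n}}"
    "\<And>\<pi>. \<pi> permutes {1..n} \<Longrightarrow> followers n (rev \<pi>) = {1..<n} - followers n \<pi>"
proof
  define \<rho> where "\<rho> j = (if j \<in> {1..n} then Suc n - j else j)" for j
  have invol: "\<rho> (\<rho> j) = j" for j by (auto simp: \<rho>_def)
  have perm: "\<rho> permutes {1..n}"
    by (rule bij_imp_permutes) (auto simp: \<rho>_def intro!: bij_betw_byWitness[where f' = \<rho>])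
  show "bij_betw (\<lambda>\<pi>. \<pi> \<circ> \<rho>) {\<pi>. \<pi> permutes {1..n}} {\<pi>. \<pi> permutes {1..n}}"
    by (rule bij_betw_byWitness[where f' = "\<lambda>\<pi>. \<pi> \<circ> \<rho>"])
      (auto simp: comp_def invol simp del: One_nat_def intro: permutes_compose[OF perm, unfolded comp_def])
  fix \<pi> assume p: "\<pi> permutes {1..n}"
  let ?k = "inv \<pi> n"
  have k: "?k \<in> {1..n}"
    using permutes_in_image[OF permutes_inv[OF p], of n] assms by simp
  have "inv (\<pi> \<circ> \<rho>) n = \<rho> ?k"
    using permutes_inj[OF permutes_compose[OF perm p]] by (rule inv_f_eq) (simp add: invol permutes_inverses[OF p])
  moreover have "\<rho> ` {\<rho> ?k<..n} = {1..<?k}"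
  proof
    show "{1..<?k} \<subseteq> \<rho> ` {\<rho> ?k<..n}"
    proof
      fix j assume "j \<in> {1..<?k}"
      then have "\<rho> j \<in> {\<rho> ?k<..n}" using k by (auto simp: \<rho>_def)
      then show "j \<in> \<rho> ` {\<rho> ?k<..n}" using invol[of j] by (metis image_eqI)
    qed
  qed (use k in \<open>auto simp: \<rho>_def\<close>)
  ultimately have "followers n (\<pi> \<circ> \<rho>) = Prc \<pi> n"
    unfolding followers_def Prc_def by (simp only: image_comp[symmetric])
  then show "followers n (\<pi> \<circ> \<rho>) = {1..<n} - followers n \<pi>"
    using followers_props[OF p assms] by simp
qed

lemma ex_followers:
  assumes "R \<subseteq> {1..<n}" "1 \<le> n"
  obtains \<pi> where "\<pi> permutes {1..n}" "followers n \<pi> = R"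
proof -
  let ?m = "n - 1 - card R"
  \<comment> \<open>The order lists the players outside \<open>R\<close>, then \<open>n\<close>,
    then \<open>R\<close>; as \<open>?m\<close> players precede \<open>n\<close>, its position is
    \<open>Suc ?m\<close>.\<close>
  let ?xs = "sorted_list_of_set ({1..<n} - R) @ n # sorted_list_of_set R"
  have fin: "finite R" using assms finite_subset by blast
  have card: "card ({1..<n} - R) = ?m" "card R \<le> n - 1"
    using card_Diff_subset[OF fin assms(1)] card_mono[OF _ assms(1)] by auto
  have len: "length ?xs = n" using card assms(2) by simp
  have dist: "distinct ?xs" using fin assms(1) by auto
  have set: "set ?xs = {1..n}" using fin assms by auto
  define \<pi> where "\<pi> j = (if j \<in> {1..n} then ?xs ! (j - 1) else j)" for j
  have "bij_betw (\<lambda>j. ?xs ! (j - 1)) {1..n} {1..n}"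
  proof -
    have "bij_betw (\<lambda>j. j - 1) {1..n} {..<n}"
      by (rule bij_betw_byWitness[where f' = Suc]) auto
    moreover have "bij_betw ((!) ?xs) {..<n} {1..n}"
      by (rule bij_betw_nth) (use dist len set in auto)
    ultimately show ?thesis by (auto dest: bij_betw_trans simp: comp_def)
  qed
  moreover have "bij_betw \<pi> {1..n} {1..n} \<longleftrightarrow> bij_betw (\<lambda>j. ?xs ! (j - 1)) {1..n} {1..n}"
    by (rule bij_betw_cong) (simp add: \<pi>_def)
  ultimately have p: "\<pi> permutes {1..n}"
    by (intro bij_imp_permutes) (auto simp: \<pi>_def)
  have "\<pi> (Suc ?m) = n" using card(2) assms(2) len by (auto simp: \<pi>_def nth_append card(1))
  then have inv: "inv \<pi> n = Suc ?m" using inv_f_eq[OF permutes_inj[OF p]] by blast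
  have "followers n \<pi> = (\<lambda>j. ?xs ! (j - 1)) ` {Suc ?m<..n}"
    unfolding followers_def inv by (auto simp: \<pi>_def)
  also have "{Suc ?m<..n} = (\<lambda>i. Suc (Suc ?m) + i) ` {..<card R}"
  proof (intro set_eqI iffI)
    fix j assume "j \<in> {Suc ?m<..n}"
    then have "j = Suc (Suc ?m) + (j - Suc (Suc ?m))" "j - Suc (Suc ?m) < card R"
      using card(2) assms(2) by auto
    then show "j \<in> (\<lambda>i. Suc (Suc ?m) + i) ` {..<card R}" by blast
  qed (use card(2) assms(2) in auto)
  also have "(\<lambda>j. ?xs ! (j - 1)) ` \<dots> = (!) (sorted_list_of_set R) ` {..<card R}"
    unfolding image_image by (rule image_cong) (use card(1) in \<open>auto simp: nth_append\<close>)
  also have "\<dots> = R" using fin by (metis length_sorted_list_of_set nth_image order_refl set_sorted_list_of_set take_all lessThan_atLeast0)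
  finally show ?thesis using that p by blast
qed

lemma SHP_question_iff:
  assumes "SHP_instance ws"
  shows "SHP_question ws \<longleftrightarrow> (\<exists>I. halves ws I)"
proof -
  define n where "n = length ws"
  define w where "w i = ws ! (i - 1)" for i
  have inst: "2 \<le> n" "\<And>i. i \<in> {1..n - 1} \<Longrightarrow> even (w i)" "w n = 1"
    using assms unfolding SHP_instance_def n_def w_def Let_def by auto
  have split: "{1..n} = insert n {1..<n}" using inst(1) by auto
  have ev: "even (sum w S)" if "S \<subseteq> {1..<n}" for S
    using that inst(2) by (intro dvd_sum) (fastforce)
  define A where "A = sum w {1..<n} div 2"
  have A: "sum w {1..<n} = 2 * A" using ev[of "{1..<n}"] by (simp add: A_def)
  define P where "P = {\<pi>. \<pi> permutes {1..n}}"
  define r where "r \<pi> = sum w (followers n \<pi>)" for \<pi>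
  have fP: "finite P" unfolding P_def by (simp add: finite_permutations)
  have cP: "card P = fact n" unfolding P_def by (simp add: card_permutations)
  let ?w = "\<lambda>i. rat_of_nat (w i)"
  let ?v = "bankruptcy_game n (of_int \<lfloor>(\<Sum>i\<in>{1..n}. ?w i) / 2\<rfloor>) ?w"
  have W: "(\<Sum>i\<in>{1..n}. ?w i) = of_nat (2 * A + 1)"
    using A unfolding split by (simp add: inst(3) flip: of_nat_sum)
  have E: "\<lfloor>(\<Sum>i\<in>{1..n}. ?w i) / 2\<rfloor> = int A"
    unfolding W by (simp add: floor_unique)
  have marg: "marginal ?v \<pi> n = of_bool (r \<pi> < A)" if "\<pi> \<in> P" for \<pi>
  proof -
    have p: "\<pi> permutes {1..n}" using that by (simp add: P_def)
    note f = followers_props[OF p, OF order_trans[OF one_le_numeral inst(1)]]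
    have "{1..n} - (Prc \<pi> n \<union> {n}) = followers n \<pi>" "{1..n} - Prc \<pi> n = insert n (followers n \<pi>)"
      using f split by auto
    moreover have "n \<notin> followers n \<pi>" "finite (followers n \<pi>)" using f finite_subset by fastforce+
    ultimately have "marginal ?v \<pi> n = max 0 (of_nat A - of_nat (r \<pi>)) - max 0 (of_nat A - (1 + of_nat (r \<pi>)))"
      unfolding marginal_def bankruptcy_game_def E r_def by (simp add: inst(3))
    \<comment> \<open>Both \<open>r \<pi>\<close> and \<open>A\<close> are natural numbers: if
      \<open>r \<pi> < A\<close>, at least one full unit is left for player \<open>n\<close>, and
      otherwise nothing is.\<close>
    also have "\<dots> = of_bool (r \<pi> < A)"
    proof (cases "r \<pi> < A")
      case True
      then have "rat_of_nat (Suc (r \<pi>)) \<le> of_nat A" by (simp only: of_nat_le_iff)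
      then show ?thesis using True by (simp add: max_def)
    next
      case False
      then have "rat_of_nat A \<le> of_nat (r \<pi>)" by (simp only: of_nat_le_iff)
      then show ?thesis using False by (simp add: max_def)
    qed
    finally show ?thesis .
  qed
  define lt where "lt = {\<pi> \<in> P. r \<pi> < A}"
  define gt where "gt = {\<pi> \<in> P. r \<pi> > A}"
  define eq where "eq = {\<pi> \<in> P. r \<pi> = A}"
  have "shapley n ?v n = 1 / fact n * (\<Sum>\<pi>\<in>P. of_bool (r \<pi> < A))"
    unfolding shapley_def P_def[symmetric] by (simp only: marg cong: sum.cong)
  also have "(\<Sum>\<pi>\<in>P. of_bool (r \<pi> < A)) = rat_of_nat (card lt)"
    using fP by (simp add: lt_def of_bool_def sum.If_cases Int_def)
  finally have sh: "shapley n ?v n = of_nat (card lt) / fact n" by simp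
  have gt: "card gt = card lt"
  proof -
    obtain rev where rev: "bij_betw rev P P" "\<And>\<pi>. \<pi> \<in> P \<Longrightarrow> followers n (rev \<pi>) = {1..<n} - followers n \<pi>"
      using followers_reverse[of n] inst(1) unfolding P_def by auto
    have r: "r (rev \<pi>) = 2 * A - r \<pi>" "r \<pi> \<le> 2 * A" if "\<pi> \<in> P" for \<pi>
    proof -
      have "followers n \<pi> \<subseteq> {1..<n}"
        using followers_props that inst(1) by (simp add: P_def)
      from sum_diff_nat[OF _ this, of w] sum.subset_diff[OF this, of w] rev(2)[OF that]
      show "r (rev \<pi>) = 2 * A - r \<pi>" "r \<pi> \<le> 2 * A"
        using A finite_subset[OF \<open>followers n \<pi> \<subseteq> {1..<n}\<close>] by (simp_all add: r_def)
    qed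
    have "bij_betw rev gt lt"
      unfolding bij_betw_def
    proof
      show "inj_on rev gt" using rev(1) by (auto simp: bij_betw_def gt_def intro: inj_on_subset)
      show "rev ` gt = lt"
      proof
        show "rev ` gt \<subseteq> lt"
          using r rev(1) by (force simp: gt_def lt_def bij_betw_def)
        show "lt \<subseteq> rev ` gt"
        proof
          fix \<pi> assume "\<pi> \<in> lt"
          then obtain \<sigma> where "\<sigma> \<in> P" "\<pi> = rev \<sigma>" using rev(1) by (auto simp: lt_def bij_betw_def)
          with \<open>\<pi> \<in> lt\<close> r[of \<sigma>] have "\<sigma> \<in> gt" by (auto simp: gt_def lt_def)
          then show "\<pi> \<in> rev ` gt" using \<open>\<pi> = rev \<sigma>\<close> by blast
        qed
      qed
    qed
    then show ?thesis by (rule bij_betw_same_card)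
  qed
  have "P = lt \<union> (gt \<union> eq)" by (auto simp: lt_def gt_def eq_def)
  then have "card P = card (lt \<union> (gt \<union> eq))" by simp
  also have "\<dots> = card lt + (card gt + card eq)"
    using fP by (subst card_Un_disjoint; (subst card_Un_disjoint)?) (auto simp: lt_def gt_def eq_def)
  finally have "card P = card lt + (card gt + card eq)" .
  \<comment> \<open>This identity turns the comparison of \<open>card lt / n!\<close> with
    \<open>1/2\<close> into the existence of a tie.\<close>
  then have "fact n = 2 * card lt + card eq" using gt cP by simp
  then have f: "(fact n :: rat) = 2 * of_nat (card lt) + of_nat (card eq)"
    by (metis of_nat_add of_nat_fact of_nat_mult of_nat_numeral)
  have "SHP_question ws \<longleftrightarrow> shapley n ?v n < 1 / 2"
    unfolding SHP_question_def Let_def n_def w_def ..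
  also have "\<dots> \<longleftrightarrow> of_nat (card lt) * 2 < (fact n :: rat)"
    unfolding sh by (simp add: divide_simps)
  also have "\<dots> \<longleftrightarrow> card eq \<noteq> 0" unfolding f by auto
  also have "\<dots> \<longleftrightarrow> (\<exists>\<pi>. \<pi> permutes {1..n} \<and> r \<pi> = A)" using fP by (auto simp: eq_def P_def)
  also have "\<dots> \<longleftrightarrow> (\<exists>I. halves ws I)"
  proof
    assume "\<exists>\<pi>. \<pi> permutes {1..n} \<and> r \<pi> = A"
    then show "\<exists>I. halves ws I"
      using followers_props[of _ n] inst(1) A unfolding halves_def r_def w_def n_def
      by (metis (no_types, lifting) Suc_1 Suc_leD)
  next
    assume "\<exists>I. halves ws I"
    then obtain I where "I \<subseteq> {1..<n}" "2 * sum w I = 2 * A"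
      using A unfolding halves_def w_def n_def by auto
    moreover obtain \<pi> where "\<pi> permutes {1..n}" "followers n \<pi> = I"
      using ex_followers[OF calculation(1)] inst(1) by (metis One_nat_def Suc_1 Suc_leD)
    ultimately show "\<exists>\<pi>. \<pi> permutes {1..n} \<and> r \<pi> = A"
      unfolding r_def by (metis mult_left_cancel zero_neq_numeral)
  qed
  finally show ?thesis .
qed

section \<open>Counter programs\<close>

text \<open>
  Counter \<open>k > 0\<close> is the head position on tape \<open>k\<close>, shifted by one. Cell \<open>-1\<close> contains the marker \<open>3\<close>, which provides the test
  for zero; the counter value \<open>i + 1\<close> gives access to letter \<open>i\<close> of the input word \<open>X k\<close>.
\<close>

datatype com =
    Skip
  | Inc nat
  | Dec nat
  | Emit bool
  | Seq com com (infixr ";;" 60)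
  | Branch nat "nat set" com com
  | While nat "nat set" com

type_synonym state = "(nat \<Rightarrow> nat) \<times> word"

definition symb :: "(nat \<Rightarrow> word) \<Rightarrow> (nat \<Rightarrow> nat) \<Rightarrow> nat \<Rightarrow> nat" where
  "symb X e k = (if e k = 0 then 3 else word_tape (X k) (int (e k) - 1))"

text \<open>The counts are the exact numbers of machine steps: a test is one jump, and a taken
  branch or a loop body pays for a second jump, over the alternative or back to the test.\<close>

inductive exec :: "(nat \<Rightarrow> word) \<Rightarrow> com \<Rightarrow> state \<Rightarrow> nat \<Rightarrow> state \<Rightarrow> bool" for X where
  Skip: "exec X Skip s 0 s"
| Inc: "0 < k \<Longrightarrow> exec X (Inc k) (e, y) 1 (e(k := Suc (e k)), y)"
| Dec: "0 < k \<Longrightarrow> 0 < e k \<Longrightarrow> exec X (Dec k) (e, y) 1 (e(k := e k - 1), y)"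
| Emit: "exec X (Emit b) (e, y) 1 (e, y @ [b])"
| Seq: "exec X c s t s' \<Longrightarrow> exec X d s' t' s'' \<Longrightarrow> exec X (c ;; d) s (t + t') s''"
| BranchTrue: "0 < k \<Longrightarrow> symb X e k \<in> A \<Longrightarrow> exec X c (e, y) t s \<Longrightarrow>
    exec X (Branch k A c d) (e, y) (t + 2) s"
| BranchFalse: "0 < k \<Longrightarrow> symb X e k \<notin> A \<Longrightarrow> exec X d (e, y) t s \<Longrightarrow>
    exec X (Branch k A c d) (e, y) (t + 1) s"
| WhileFalse: "0 < k \<Longrightarrow> symb X e k \<notin> A \<Longrightarrow> exec X (While k A c) (e, y) 1 (e, y)"
| WhileTrue: "0 < k \<Longrightarrow> symb X e k \<in> A \<Longrightarrow> exec X c (e, y) t s \<Longrightarrow>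
    exec X (While k A c) s t' s' \<Longrightarrow> exec X (While k A c) (e, y) (t + t' + 2) s'"

section \<open>Compilation of counter programs to Turing machines\<close>

datatype instr = Left | Mark | Move nat move | Out bool | Jump nat "nat set" nat nat

fun csize :: "com \<Rightarrow> nat" where
  "csize Skip = 0"
| "csize (c ;; d) = csize c + csize d"
| "csize (Branch k A c d) = csize c + csize d + 2"
| "csize (While k A c) = csize c + 2"
| "csize _ = 1"

text \<open>\<open>a\<close> is the absolute address of the first instruction. A \<open>Jump\<close>
  with two equal targets is unconditional. \<open>Left\<close> and \<open>Mark\<close> never occur
  here; they are kept for the two set-up steps that put the marker into cell
  \<open>-1\<close>.\<close>

fun compile :: "com \<Rightarrow> nat \<Rightarrow> instr list" where
  "compile Skip a = []"
| "compile (Inc k) a = [Move k MoveRight]"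
| "compile (Dec k) a = [Move k MoveLeft]"
| "compile (Emit b) a = [Out b]"
| "compile (c ;; d) a = compile c a @ compile d (a + csize c)"
| "compile (Branch k A c d) a =
    (let l = a + csize c + 2; z = l + csize d in
     Jump k A (Suc a) l # compile c (Suc a) @ Jump k A z z # compile d l)"
| "compile (While k A c) a =
    Jump k A (Suc a) (a + csize c + 2) # compile c (Suc a) @ [Jump k A a a]"

lemma length_compile [simp]: "length (compile c a) = csize c"
  by (induction c arbitrary: a) (simp_all add: Let_def)

text \<open>The state is the program counter, and the end of the program is the halting state.
  Clipping jump targets with \<open>min (length p)\<close> makes the machine valid for every
  instruction list, well formed or not.\<close>

definition machine :: "instr list \<Rightarrow> nat \<Rightarrow> tm" where
  "machine p K = \<lparr>tapes = K, states = length p, symbols = 4, trans = (\<lambda>q ss.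
    case p ! q of
      Left \<Rightarrow> (Suc q, map (\<lambda>j. (ss ! j, if j = 0 then Stay else MoveLeft)) [0..<K])
    | Mark \<Rightarrow> (Suc q, map (\<lambda>j. (if j = 0 then ss ! j else 3, Stay)) [0..<K])
    | Move k m \<Rightarrow> (Suc q, map (\<lambda>j. (ss ! j, if j = k then m else Stay)) [0..<K])
    | Out b \<Rightarrow> (Suc q, map (\<lambda>j. if j = 0 then (if b then 2 else 1, MoveRight) else (ss ! j, Stay)) [0..<K])
    | Jump k A l l' \<Rightarrow>
        (min (length p) (if ss ! k \<in> A then l else l'), map (\<lambda>j. (ss ! j, Stay)) [0..<K]))\<rparr>"

lemma valid_machine: "valid_tm (machine p K)"
proof -
  have "ss ! j < 4" if "length ss = K" "set ss \<subseteq> {..<4}" "j < K" for ss :: "nat list" and j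
    using that nth_mem by fastforce
  then show ?thesis
    unfolding valid_tm_def machine_def by (auto split: instr.split)
qed

definition tape_of :: "(nat \<Rightarrow> word) \<Rightarrow> state \<Rightarrow> nat \<Rightarrow> tape" where
  "tape_of X s k = (if k = 0 then (word_tape (snd s), int (length (snd s)))
    else ((word_tape (X k))(-1 := 3), int (fst s k) - 1))"

definition conf :: "(nat \<Rightarrow> word) \<Rightarrow> nat \<Rightarrow> nat \<Rightarrow> state \<Rightarrow> config" where
  "conf X K q s = (q, map (tape_of X s) [0..<K])"

lemma scan_tape_of: "0 < k \<Longrightarrow> scan (tape_of X s k) = symb X (fst s) k"
  by (simp add: tape_of_def symb_def)

lemma act_scan: "act (scan T, m) T = (fst T, shift m (snd T))"
  by (cases T) simp

lemma tape_of_upd: "0 < k \<Longrightarrow> tape_of X (e(k := v), y) =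
    (tape_of X (e, y))(k := (fst (tape_of X (e, y) k), int v - 1))"
  by (auto simp: tape_of_def)

lemma snd_tape_of: "0 < k \<Longrightarrow> snd (tape_of X (e, y) k) = int (e k) - 1"
  by (simp add: tape_of_def)

lemma act_same: "act (scan T, Stay) T = T"
  by (cases T) simp

lemma map2_map: "length ys = n \<Longrightarrow> map2 f (map g [0..<n]) ys = map (\<lambda>j. f (g j) (ys ! j)) [0..<n]"
  by (rule nth_equalityI) simp_all

lemma step_machine:
  assumes "q < length p"
  shows "step (machine p K) (q, ts) = (case trans (machine p K) q (map scan ts) of
    (q', as) \<Rightarrow> (q', map2 act as ts))"
  using assms by (simp add: machine_def)

lemma step_Move:
  assumes "q < length p" "p ! q = Move k m" "tape_of X s' = (tape_of X s)(k := act (scan (tape_of X s k), m) (tape_of X s k))"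
  shows "step (machine p K) (conf X K q s) = conf X K (Suc q) s'"
  using assms unfolding conf_def
  by (subst step_machine) (auto simp: machine_def map2_map act_same)

lemma step_Out:
  assumes "q < length p" "p ! q = Out b"
  shows "step (machine p K) (conf X K q (e, y)) = conf X K (Suc q) (e, y @ [b])"
proof -
  have "(word_tape y)(int (length y) := if b then 2 else 1) = word_tape (y @ [b])"
    by (rule ext) (auto simp: word_tape_def nth_append)
  then show ?thesis
    using assms unfolding conf_def
    by (subst step_machine) (auto simp: machine_def map2_map act_same tape_of_def)
qed

lemma step_Jump:
  assumes "q < length p" "p ! q = Jump k A l l'" "0 < k" "k < K" "l \<le> length p" "l' \<le> length p"
  shows "step (machine p K) (conf X K q s) = conf X K (if symb X (fst s) k \<in> A then l else l') s"
  using assms unfolding conf_def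
  by (subst step_machine) (auto simp: machine_def map2_map act_same scan_tape_of)

fun tps :: "com \<Rightarrow> nat set" where
  "tps (Inc k) = {k}"
| "tps (Dec k) = {k}"
| "tps (c ;; d) = tps c \<union> tps d"
| "tps (Branch k A c d) = insert k (tps c \<union> tps d)"
| "tps (While k A c) = insert k (tps c)"
| "tps _ = {}"

lemma finite_tps: "finite (tps c)"
  by (induction c) auto

definition seg :: "instr list \<Rightarrow> nat \<Rightarrow> instr list \<Rightarrow> bool" where
  "seg p a is \<longleftrightarrow> (\<exists>xs ys. p = xs @ is @ ys \<and> length xs = a)"

lemma seg_append: "seg p a (is @ js) \<Longrightarrow> seg p a is \<and> seg p (a + length is) js"
  unfolding seg_def by (metis append.assoc length_append)

lemma seg_Cons: "seg p a (i # is) \<Longrightarrow> p ! a = i \<and> a < length p \<and> seg p (Suc a) is"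
  unfolding seg_def
  by (metis append.assoc append_Cons append_Nil length_append_singleton nth_append_length
        length_append less_add_same_cancel1 list.size(3) zero_less_Suc length_Cons add_Suc_right)

lemma seg_bound: "seg p a is \<Longrightarrow> a + length is \<le> length p"
  unfolding seg_def by auto

text \<open>The code may lie anywhere inside a larger program \<open>p\<close>, so that the
  induction hypotheses apply to the parts of a command in place.\<close>

lemma exec_compile:
  assumes "exec X c s t s'" "seg p a (compile c a)" "tps c \<subseteq> {..<K}"
  shows "(step (machine p K) ^^ t) (conf X K a s) = conf X K (a + csize c) s'"
  using assms
proof (induction arbitrary: a rule: exec.induct)
  case (Skip s)
  then show ?case by simp
next
  case (Inc k e y)
  then have "p ! a = Move k MoveRight" "a < length p" using seg_Cons by fastforce+
  moreover have "tape_of X (e(k := Suc (e k)), y) = (tape_of X (e, y))(k := act (scan (tape_of X (e, y) k), MoveRight) (tape_of X (e, y) k))"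
    using Inc by (simp add: tape_of_upd act_scan snd_tape_of)
  ultimately show ?case by (simp add: step_Move)
next
  case (Dec k e y)
  then have "p ! a = Move k MoveLeft" "a < length p" using seg_Cons by fastforce+
  moreover have "tape_of X (e(k := e k - 1), y) = (tape_of X (e, y))(k := act (scan (tape_of X (e, y) k), MoveLeft) (tape_of X (e, y) k))"
    using Dec by (simp add: tape_of_upd act_scan snd_tape_of)
  ultimately show ?case by (simp add: step_Move)
next
  case (Emit b e y)
  then have "p ! a = Out b" "a < length p" using seg_Cons by fastforce+
  then show ?case by (simp add: step_Out)
next
  case (Seq c s t s' d t' s'')
  then have "seg p a (compile c a)" "seg p (a + csize c) (compile d (a + csize c))"
    using seg_append by fastforce+
  with Seq show ?case by (simp add: funpow_add add.commute[of t] add.assoc)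
next
  case (BranchTrue k e A c y t s d)
  let ?l = "a + csize c + 2" let ?z = "?l + csize d"
  have atp: "seg p a (Jump k A (Suc a) ?l # compile c (Suc a) @ Jump k A ?z ?z # compile d ?l)"
    using BranchTrue.prems by (simp add: Let_def)
  have 1: "p ! a = Jump k A (Suc a) ?l" "a < length p" "seg p (Suc a) (compile c (Suc a) @ Jump k A ?z ?z # compile d ?l)"
    using seg_Cons[OF atp] by blast+
  have 2: "seg p (Suc a) (compile c (Suc a))" "seg p (Suc a + csize c) (Jump k A ?z ?z # compile d ?l)"
    using seg_append[OF 1(3)] by simp_all
  have 3: "p ! (Suc a + csize c) = Jump k A ?z ?z" "Suc a + csize c < length p"
    using seg_Cons[OF 2(2)] by blast+
  have 4: "?z \<le> length p" using seg_bound[OF atp] by simp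
  have "(step (machine p K) ^^ (t + 2)) (conf X K a (e, y)) =
      step (machine p K) ((step (machine p K) ^^ t) (step (machine p K) (conf X K a (e, y))))"
    by (simp add: funpow_swap1)
  also have "step (machine p K) (conf X K a (e, y)) = conf X K (Suc a) (e, y)"
    using 1(2) 4 BranchTrue.hyps BranchTrue.prems by (subst step_Jump[OF 1(2,1)]) auto
  also have "(step (machine p K) ^^ t) \<dots> = conf X K (Suc a + csize c) s"
    using BranchTrue.IH 2 BranchTrue.prems by simp
  also have "step (machine p K) \<dots> = conf X K ?z s"
    using 3(2) 4 BranchTrue.hyps BranchTrue.prems by (subst step_Jump[OF 3(2,1)]) auto
  finally show ?case by (simp add: add.commute add.left_commute)
next
  case (BranchFalse k e A d y t s c)
  let ?l = "a + csize c + 2" let ?z = "?l + csize d"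
  have atp: "seg p a (Jump k A (Suc a) ?l # compile c (Suc a) @ Jump k A ?z ?z # compile d ?l)"
    using BranchFalse.prems by (simp add: Let_def)
  have 1: "p ! a = Jump k A (Suc a) ?l" "a < length p" "seg p (Suc a) (compile c (Suc a) @ Jump k A ?z ?z # compile d ?l)"
    using seg_Cons[OF atp] by blast+
  have 2: "seg p (Suc a + csize c) (Jump k A ?z ?z # compile d ?l)"
    using seg_append[OF 1(3)] by simp
  have 3: "seg p ?l (compile d ?l)"
    using seg_Cons[OF 2] by simp
  have 4: "?z \<le> length p" using seg_bound[OF atp] by simp
  have "(step (machine p K) ^^ (t + 1)) (conf X K a (e, y)) =
      (step (machine p K) ^^ t) (step (machine p K) (conf X K a (e, y)))"
    by (simp add: funpow_swap1)
  also have "step (machine p K) (conf X K a (e, y)) = conf X K ?l (e, y)"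
    using 1(2) 4 BranchFalse.hyps BranchFalse.prems by (subst step_Jump[OF 1(2,1)]) auto
  also have "(step (machine p K) ^^ t) \<dots> = conf X K ?z s"
    using BranchFalse.IH 3 BranchFalse.prems by simp
  finally show ?case by (simp add: add.commute add.left_commute)
next
  case (WhileFalse k e A c y)
  have atp: "seg p a (Jump k A (Suc a) (a + csize c + 2) # compile c (Suc a) @ [Jump k A a a])"
    using WhileFalse.prems by simp
  have 1: "p ! a = Jump k A (Suc a) (a + csize c + 2)" "a < length p"
    using seg_Cons[OF atp] by blast+
  show ?case
    using 1(2) seg_bound[OF atp] WhileFalse by (simp, subst step_Jump[OF 1(2,1)]) auto
next
  case (WhileTrue k e A c y t s t' s')
  have atp: "seg p a (Jump k A (Suc a) (a + csize c + 2) # compile c (Suc a) @ [Jump k A a a])"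
    using WhileTrue.prems by simp
  have 1: "p ! a = Jump k A (Suc a) (a + csize c + 2)" "a < length p" "seg p (Suc a) (compile c (Suc a) @ [Jump k A a a])"
    using seg_Cons[OF atp] by blast+
  have 2: "seg p (Suc a) (compile c (Suc a))" "seg p (Suc a + csize c) [Jump k A a a]"
    using seg_append[OF 1(3)] by simp_all
  have 3: "p ! (Suc a + csize c) = Jump k A a a" "Suc a + csize c < length p"
    using seg_Cons[OF 2(2)] by blast+
  have "(step (machine p K) ^^ (t + t' + 2)) (conf X K a (e, y)) =
      (step (machine p K) ^^ t') (step (machine p K) ((step (machine p K) ^^ t) (step (machine p K) (conf X K a (e, y)))))"
    by (simp add: funpow_swap1 funpow_add add.commute[of t])
  also have "step (machine p K) (conf X K a (e, y)) = conf X K (Suc a) (e, y)"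
    using 1(2) seg_bound[OF atp] WhileTrue.hyps WhileTrue.prems by (subst step_Jump[OF 1(2,1)]) auto
  also have "(step (machine p K) ^^ t) \<dots> = conf X K (Suc a + csize c) s"
    using WhileTrue.IH(1) 2 WhileTrue.prems by simp
  also have "step (machine p K) \<dots> = conf X K a s"
    using 1(2) WhileTrue.hyps WhileTrue.prems by (subst step_Jump[OF 3(2,1)]) auto
  also have "(step (machine p K) ^^ t') \<dots> = conf X K (a + csize (While k A c)) s'"
    using WhileTrue.IH(2) WhileTrue.prems by simp
  finally show ?case by simp
qed

text \<open>Exact step counts depend on the data that is read; with upper bounds, branches of
  different cost get one common time.\<close>

definition runs :: "(nat \<Rightarrow> word) \<Rightarrow> com \<Rightarrow> state \<Rightarrow> nat \<Rightarrow> state \<Rightarrow> bool" where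
  "runs X c s t s' \<longleftrightarrow> (\<exists>t' \<le> t. exec X c s t' s')"

definition pb :: "(nat \<Rightarrow> nat) \<Rightarrow> bool" where
  "pb f \<longleftrightarrow> (\<exists>p :: nat poly. \<forall>n. f n \<le> poly p n)"

definition inputs :: "word list \<Rightarrow> nat \<Rightarrow> word" where
  "inputs xs k = (if 0 < k \<and> k \<le> length xs then xs ! (k - 1) else [])"

lemma step_halt: "(step M ^^ t) (states M, ts) = (states M, ts)"
  by (induction t) simp_all

text \<open>Two set-up steps move all heads but that of the output to cell \<open>-1\<close> and
  write the marker there, which makes every counter zero. As halting configurations are fixed, the
  run extends to the full polynomial bound.\<close>

theorem polytimeI:
  assumes "pb T"
    and runs: "\<And>xs. length xs = m \<Longrightarrow> \<exists>e. runs (inputs xs) c (\<lambda>_. 0, []) (T (\<Sum>x\<leftarrow>xs. length x)) (e, f xs)"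
  shows "polytime m f"
proof -
  obtain p :: "nat poly" where p: "\<And>n. T n \<le> poly p n" using \<open>pb T\<close> unfolding pb_def by blast
  define K where "K = Suc (Max (insert m (tps c)))"
  define code where "code = Left # Mark # compile c 2"
  let ?M = "machine code K"
  have K: "m < K" "tps c \<subseteq> {..<K}"
    unfolding K_def using finite_tps[of c] by (auto simp: less_Suc_eq_le)
  have "outputs_within ?M xs (f xs) (poly (p + 2) (\<Sum>x\<leftarrow>xs. length x))" if xs: "length xs = m" for xs
  proof -
    let ?n = "\<Sum>x\<leftarrow>xs. length x" let ?X = "inputs xs"
    obtain e t where t: "t \<le> T ?n" "exec ?X c (\<lambda>_. 0, []) t (e, f xs)"
      using runs[OF xs] unfolding runs_def by blast
    have start: "init ?M xs = (0, map (\<lambda>k. (word_tape (?X k), 0)) [0..<K])"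
      unfolding init_def machine_def inputs_def using K xs
      by (auto intro!: nth_equalityI simp: nth_append nth_Cons split: nat.split)
    have "step ?M (init ?M xs) = (1, map (\<lambda>k. (word_tape (?X k), if k = 0 then 0 else -1)) [0..<K])"
      unfolding start by (subst step_machine) (auto simp: machine_def code_def map2_map)
    moreover have "step ?M \<dots> = conf ?X K 2 (\<lambda>_. 0, [])"
      by (subst step_machine)
        (auto simp: machine_def code_def map2_map conf_def tape_of_def inputs_def fun_upd_idem)
    ultimately have 2: "(step ?M ^^ 2) (init ?M xs) = conf ?X K 2 (\<lambda>_. 0, [])"
      by (simp add: numeral_2_eq_2)
    have "seg code 2 (compile c 2)"
      unfolding seg_def code_def by (rule exI[of _ "[Left, Mark]"]) simp
    from exec_compile[OF t(2) this K(2)]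
    have 3: "(step ?M ^^ (t + 2)) (init ?M xs) = conf ?X K (states ?M) (e, f xs)"
      unfolding funpow_add comp_def 2 by (simp add: machine_def code_def)
    have "poly (p + 2) ?n = poly p ?n + 2"
      by (simp add: numeral_poly)
    then obtain d where d: "poly (p + 2) ?n = d + (t + 2)"
      using t(1) p[of ?n] by (metis add.commute add_le_mono1 le_trans nat_le_iff_add)
    have "(step ?M ^^ poly (p + 2) ?n) (init ?M xs) = conf ?X K (states ?M) (e, f xs)"
      unfolding d funpow_add[of d "t + 2"] comp_def 3 unfolding conf_def step_halt ..
    then show ?thesis
      unfolding outputs_within_def conf_def using K(1) by (simp add: hd_map tape_of_def)
  qed
  then show ?thesis
    unfolding polytime_def using valid_machine[of code K] K(1)
    by (intro exI[of _ ?M] exI[of _ "p + 2"]) (simp add: machine_def)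
qed

section \<open>Polynomial bounds and rules for running counter programs\<close>

lemma pb_const: "pb (\<lambda>n. c)"
  unfolding pb_def by (rule exI[of _ "[:c:]"]) simp

lemma pb_id: "pb (\<lambda>n. n)"
  unfolding pb_def by (rule exI[of _ "[:0, 1:]"]) simp

lemma pb_add: "pb f \<Longrightarrow> pb g \<Longrightarrow> pb (\<lambda>n. f n + g n)"
  unfolding pb_def by (metis add_mono poly_add)

lemma pb_mult: "pb f \<Longrightarrow> pb g \<Longrightarrow> pb (\<lambda>n. f n * g n)"
  unfolding pb_def by (metis mult_le_mono poly_mult)

lemma pb_poly: "pb (poly p)"
  unfolding pb_def by auto

lemma runs_mono: "runs X c s t s' \<Longrightarrow> t \<le> t' \<Longrightarrow> runs X c s t' s'"
  unfolding runs_def using le_trans by blast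

lemma runs_conv: "runs X c s t s' \<Longrightarrow> s' = s'' \<Longrightarrow> t \<le> t' \<Longrightarrow> runs X c s t' s''"
  using runs_mono by blast

lemma runs_Skip: "runs X Skip s 0 s"
  unfolding runs_def using exec.Skip by blast

lemma runs_Inc: "0 < k \<Longrightarrow> runs X (Inc k) (e, y) 1 (e(k := Suc (e k)), y)"
  unfolding runs_def using exec.Inc by blast

lemma runs_Dec: "0 < k \<Longrightarrow> 0 < e k \<Longrightarrow> runs X (Dec k) (e, y) 1 (e(k := e k - 1), y)"
  unfolding runs_def using exec.Dec by blast

lemma runs_Emit: "runs X (Emit b) (e, y) 1 (e, y @ [b])"
  unfolding runs_def using exec.Emit by blast

lemma runs_Seq: "runs X c s t s' \<Longrightarrow> runs X d s' t' s'' \<Longrightarrow> runs X (c ;; d) s (t + t') s''"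
  unfolding runs_def by (meson add_mono exec.Seq)

lemma runs_BranchTrue: "0 < k \<Longrightarrow> symb X e k \<in> A \<Longrightarrow> runs X c (e, y) t s \<Longrightarrow>
    runs X (Branch k A c d) (e, y) (t + 2) s"
  unfolding runs_def by (meson add_le_mono1 exec.BranchTrue)

lemma runs_BranchFalse: "0 < k \<Longrightarrow> symb X e k \<notin> A \<Longrightarrow> runs X d (e, y) t s \<Longrightarrow>
    runs X (Branch k A c d) (e, y) (t + 2) s"
  unfolding runs_def by (metis add_le_mono exec.BranchFalse one_le_numeral)

lemma runs_Branch: "0 < k \<Longrightarrow> runs X (if symb X e k \<in> A then c else d) (e, y) t s \<Longrightarrow>
    runs X (Branch k A c d) (e, y) (t + 2) s"
  using runs_BranchTrue runs_BranchFalse by (cases "symb X e k \<in> A") (simp_all only: if_True if_False)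

lemma runs_WhileFalse: "0 < k \<Longrightarrow> symb X e k \<notin> A \<Longrightarrow> runs X (While k A c) (e, y) 1 (e, y)"
  unfolding runs_def using exec.WhileFalse by blast

lemma runs_WhileTrue: "0 < k \<Longrightarrow> symb X e k \<in> A \<Longrightarrow> runs X c (e, y) t s \<Longrightarrow>
    runs X (While k A c) s t' s' \<Longrightarrow> runs X (While k A c) (e, y) (t + t' + 2) s'"
  unfolding runs_def by (meson add_le_mono add_le_mono1 exec.WhileTrue)

text \<open>Instead of an invariant the rule takes the whole trajectory: \<open>f i\<close> and
  \<open>g i\<close> are the counters and the output after \<open>i\<close> rounds. The induction
  goes down from \<open>n\<close>, since a loop unfolds at its front.\<close>

lemma runs_While:
  assumes "0 < k" "\<And>i. i < n \<Longrightarrow> symb X (f i) k \<in> A"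
    and "\<And>i. i < n \<Longrightarrow> runs X c (f i, g i) t (f (Suc i), g (Suc i))" "symb X (f n) k \<notin> A"
  shows "runs X (While k A c) (f 0, g 0) (n * (t + 2) + 1) (f n, g n)"
proof -
  have "runs X (While k A c) (f i, g i) ((n - i) * (t + 2) + 1) (f n, g n)" if "i \<le> n" for i
    using that
  proof (induction rule: inc_induct)
    case base
    then show ?case using runs_WhileFalse assms by simp
  next
    case (step i)
    have "n - i = Suc (n - Suc i)"
      using step.hyps by simp
    then show ?case
      using runs_WhileTrue[OF assms(1) assms(2,3)[OF step.hyps(2)] step.IH]
      by (simp add: algebra_simps)
  qed
  from this[of 0] show ?thesis by simp
qed

lemma symb_eq_3 [simp]: "symb X e k = 3 \<longleftrightarrow> e k = 0"
  by (simp add: symb_def word_tape_def)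

lemma symb_nonzero: "symb X e k \<in> {0, 1, 2} \<longleftrightarrow> e k \<noteq> 0"
  by (auto simp: symb_def word_tape_def)

text \<open>Only the marker \<open>3\<close> stands for the value zero, so the symbol set
  \<open>{0, 1, 2}\<close> is the test for a nonzero counter, whatever the input word
  contains.\<close>

definition Loop :: "nat \<Rightarrow> com \<Rightarrow> com" where
  "Loop k c = While k {0, 1, 2} (Dec k ;; c)"

lemma runs_Loop:
  assumes "0 < k" "f 0 k = n"
    and "\<And>i. i < n \<Longrightarrow> f i k = n - i \<Longrightarrow> runs X c ((f i)(k := n - Suc i), g i) t (f (Suc i), g (Suc i))"
    and "\<And>i. i < n \<Longrightarrow> f (Suc i) k = n - Suc i"
  shows "runs X (Loop k c) (f 0, g 0) (n * (t + 3) + 1) (f n, g n)"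
proof -
  have k: "f i k = n - i" if "i \<le> n" for i
    using that assms(2,4) by (cases i) auto
  have "runs X (Loop k c) (f 0, g 0) (n * ((1 + t) + 2) + 1) (f n, g n)"
    unfolding Loop_def
  proof (rule runs_While[OF \<open>0 < k\<close>, where f = f and g = g])
    fix i assume "i < n"
    then have 1: "0 < f i k" "f i k - 1 = n - Suc i" "f i k = n - i" using k[of i] by simp_all
    show "symb X (f i) k \<in> {0, 1, 2}" unfolding symb_nonzero using 1 by simp
    show "runs X (Dec k ;; c) (f i, g i) (1 + t) (f (Suc i), g (Suc i))"
      by (rule runs_Seq[OF runs_Dec]) (use 1 assms(1) assms(3)[OF \<open>i < n\<close>] in simp_all)
  next
    show "symb X (f n) k \<notin> {0, 1, 2}" unfolding symb_nonzero using k[of n] by simp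
  qed
  then show ?thesis by (rule runs_conv) (simp_all add: algebra_simps)
qed

text \<open>Unlike \<open>Loop\<close>, \<open>For k k'\<close> preserves the counter \<open>k\<close>, provided that \<open>k'\<close> is zero initially.\<close>

definition For :: "nat \<Rightarrow> nat \<Rightarrow> com \<Rightarrow> com" where
  "For k k' c = Loop k (Inc k' ;; c) ;; Loop k' (Inc k)"

text \<open>The trajectory \<open>e i\<close> describes the counters as if \<open>k\<close> and
  \<open>k'\<close> were untouched; the body sees these two overwritten by the number of rounds
  still to come and of rounds begun. The second loop moves the count back to
  \<open>k\<close>.\<close>

lemma runs_For:
  assumes "0 < k" "0 < k'" "k \<noteq> k'" "e 0 k = n" "e 0 k' = 0"
    and body: "\<And>i. i < n \<Longrightarrow>
      runs X c ((e i)(k := n - Suc i, k' := Suc i), g i) t ((e (Suc i))(k := n - Suc i, k' := Suc i), g (Suc i))"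
    and "e n k = n" "e n k' = 0"
  shows "runs X (For k k' c) (e 0, g 0) (n * (t + 9) + 2) (e n, g n)"
proof -
  let ?f = "\<lambda>i. (e i)(k := n - i, k' := i)"
  have 1: "runs X (Loop k (Inc k' ;; c)) (?f 0, g 0) (n * ((1 + t) + 3) + 1) (?f n, g n)"
  proof (rule runs_Loop[where f = ?f and g = g])
    fix i assume "i < n"
    show "runs X (Inc k' ;; c) ((?f i)(k := n - Suc i), g i) (1 + t) (?f (Suc i), g (Suc i))"
      by (rule runs_Seq[OF runs_Inc[OF assms(2)]])
        (use body[OF \<open>i < n\<close>] assms(3) in \<open>simp add: fun_upd_twist\<close>)
  qed (use assms in auto)
  have 2: "runs X (Loop k' (Inc k)) (?f n, g n) (n * (1 + 3) + 1)
      ((e n)(k := n, k' := 0), g n)"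
  proof -
    have "runs X (Loop k' (Inc k)) ((e n)(k := 0, k' := n - 0), g n) (n * (1 + 3) + 1)
      ((e n)(k := n, k' := n - n), g n)"
    proof (rule runs_Loop[where f = "\<lambda>i. (e n)(k := i, k' := n - i)" and g = "\<lambda>i. g n"])
      fix i assume "i < n"
      show "runs X (Inc k) (((e n)(k := i, k' := n - i))(k' := n - Suc i), g n) 1 ((e n)(k := Suc i, k' := n - Suc i), g n)"
        by (rule runs_conv[OF runs_Inc[OF assms(1)]]) (use assms(3) in \<open>simp_all add: fun_upd_twist\<close>)
    qed (use assms in auto)
    then show ?thesis by simp
  qed
  have 3: "?f 0 = e 0" "(e n)(k := n, k' := 0) = e n"
    using assms by auto
  show ?thesis
    unfolding For_def by (rule runs_conv[OF runs_Seq[OF 1 2, unfolded 3]]) (simp_all add: algebra_simps)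
qed

fun emits :: "word \<Rightarrow> com" where
  "emits [] = Skip"
| "emits (b # bs) = Emit b ;; emits bs"

lemma runs_emits: "runs X (emits bs) (e, y) (length bs) (e, y @ bs)"
proof (induction bs arbitrary: y)
  case Nil
  then show ?case using runs_Skip by simp
next
  case (Cons b bs)
  from runs_Seq[OF runs_Emit Cons[of "y @ [b]"]] show ?case by simp
qed

definition incs :: "nat \<Rightarrow> nat \<Rightarrow> com" where
  "incs k n = ((;;) (Inc k) ^^ n) Skip"

lemma runs_incs: "0 < k \<Longrightarrow> runs X (incs k n) (e, y) n (e(k := e k + n), y)"
proof (induction n arbitrary: e)
  case 0
  then show ?case using runs_Skip by (simp add: incs_def)
next
  case (Suc n)
  show ?case
    unfolding incs_def funpow.simps comp_apply
    by (rule runs_conv[OF runs_Seq[OF runs_Inc Suc.IH[unfolded incs_def]]]) (use Suc.prems in \<open>simp_all add: fun_eq_iff\<close>)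
qed

lemma runs_For_emits:
  assumes "0 < k" "0 < k'" "k \<noteq> k'" "e k' = 0"
  shows "runs X (For k k' (emits bs)) (e, y) (e k * (length bs + 9) + 2) (e, y @ concat (replicate (e k) bs))"
proof -
  have "runs X (For k k' (emits bs)) ((\<lambda>i. e) 0, y @ concat (replicate 0 bs)) (e k * (length bs + 9) + 2)
    ((\<lambda>i. e) (e k), y @ concat (replicate (e k) bs))"
  proof (rule runs_For[where g = "\<lambda>i. y @ concat (replicate i bs)"])
    fix i
    show "runs X (emits bs) (e(k := e k - Suc i, k' := Suc i), y @ concat (replicate i bs)) (length bs)
        (e(k := e k - Suc i, k' := Suc i), y @ concat (replicate (Suc i) bs))"
      by (rule runs_conv[OF runs_emits]) (simp_all flip: replicate_append_same)
  qed (use assms in auto)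
  then show ?thesis by simp
qed

text \<open>Horner's scheme at the value of counter \<open>2\<close>: the value reached so far is
  moved to counter \<open>3\<close>, and for each of its units counter \<open>2\<close> is added to
  \<open>a\<close>; counter \<open>4\<close> is the scratch counter of \<open>For\<close>.\<close>

fun horner :: "nat list \<Rightarrow> nat \<Rightarrow> com" where
  "horner [] a = Skip"
| "horner (c # cs) a = horner cs a ;; Loop a (Inc 3) ;; Loop 3 (For 2 4 (Inc a)) ;; incs a c"

text \<open>The time is a function of the argument alone, uniform in the tapes and the other
  counters; hence it is quantified first.\<close>

lemma runs_horner:
  "\<exists>t. pb t \<and> (\<forall>X e y. 4 < a \<and> e a = 0 \<and> e 3 = 0 \<and> e 4 = 0 \<longrightarrow>
    runs X (horner cs a) (e, y) (t (e 2)) (e(a := poly (Poly cs) (e 2)), y))"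
proof (induction cs)
  case Nil
  then show ?case
    by (intro exI[of _ "\<lambda>n. 0"]) (auto intro!: pb_const runs_conv[OF runs_Skip])
next
  case (Cons c cs)
  then obtain t where "pb t" and t: "\<And>X e y. 4 < a \<and> e a = 0 \<and> e 3 = 0 \<and> e 4 = 0 \<Longrightarrow>
    runs X (horner cs a) (e, y) (t (e 2)) (e(a := poly (Poly cs) (e 2)), y)"
    by blast
  let ?q = "poly (Poly cs)"
  let ?t = "\<lambda>n. t n + ((?q n * (1 + 3) + 1) + ((?q n * ((n * (1 + 9) + 2) + 3) + 1) + c))"
  have "runs X (horner (c # cs) a) (e, y) (?t (e 2)) (e(a := poly (Poly (c # cs)) (e 2)), y)"
    if a: "4 < a \<and> e a = 0 \<and> e 3 = 0 \<and> e 4 = 0" for X e y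
  proof -
    let ?n = "e 2" let ?v = "?q ?n"
    have 2: "runs X (Loop a (Inc 3)) (e(a := ?v), y) (?v * (1 + 3) + 1) (e(3 := ?v), y)"
    proof -
      have "runs X (Loop a (Inc 3)) (e(a := ?v - 0, 3 := 0), y) (?v * (1 + 3) + 1) (e(a := ?v - ?v, 3 := ?v), y)"
      proof (rule runs_Loop[where f = "\<lambda>i. e(a := ?v - i, 3 := i)" and g = "\<lambda>i. y"])
        fix i
        show "runs X (Inc 3) ((e(a := ?v - i, 3 := i))(a := ?v - Suc i), y) 1 (e(a := ?v - Suc i, 3 := Suc i), y)"
          by (rule runs_conv[OF runs_Inc]) (use a in \<open>auto simp: fun_eq_iff\<close>)
      qed (use a in auto)
      moreover have "e(a := ?v - 0, 3 := 0) = e(a := ?v)" "e(a := ?v - ?v, 3 := ?v) = e(3 := ?v)"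
        using a by (auto simp: fun_eq_iff)
      ultimately show ?thesis by simp
    qed
    have 3: "runs X (Loop 3 (For 2 4 (Inc a))) (e(3 := ?v), y) (?v * ((?n * (1 + 9) + 2) + 3) + 1) (e(a := ?v * ?n), y)"
    proof -
      let ?f = "\<lambda>i. e(3 := ?v - i, a := i * ?n)"
      have "runs X (Loop 3 (For 2 4 (Inc a))) (?f 0, y) (?v * ((?n * (1 + 9) + 2) + 3) + 1) (?f ?v, y)"
      proof (rule runs_Loop[where f = ?f and g = "\<lambda>i. y"])
        fix i
        let ?g = "\<lambda>j. e(3 := ?v - Suc i, a := i * ?n + j)"
        have "runs X (For 2 4 (Inc a)) (?g 0, y) (?n * (1 + 9) + 2) (?g ?n, y)"
        proof (rule runs_For[where e = ?g and g = "\<lambda>i. y"])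
          fix j
          show "runs X (Inc a) ((?g j)(2 := ?n - Suc j, 4 := Suc j), y) 1 ((?g (Suc j))(2 := ?n - Suc j, 4 := Suc j), y)"
            by (rule runs_conv[OF runs_Inc]) (use a in \<open>auto simp: fun_eq_iff\<close>)
        qed (use a in auto)
        moreover have "?g 0 = (?f i)(3 := ?v - Suc i)" "?g ?n = ?f (Suc i)"
          using a by (auto simp: fun_eq_iff)
        ultimately show "runs X (For 2 4 (Inc a)) ((?f i)(3 := ?v - Suc i), y) (?n * (1 + 9) + 2) (?f (Suc i), y)"
          by simp
      qed (use a in auto)
      moreover have "?f 0 = e(3 := ?v)" "?f ?v = e(a := ?v * ?n)"
        using a by (auto simp: fun_eq_iff)
      ultimately show ?thesis by simp
    qed
    show ?thesis
      using runs_Seq[OF t[OF a, of X y] runs_Seq[OF 2 runs_Seq[OF 3 runs_incs[of a X c]]]] a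
      by (simp add: algebra_simps)
  qed
  moreover have "pb ?t" using \<open>pb t\<close> by (intro pb_add pb_mult pb_const pb_id pb_poly)
  ultimately show ?case by blast
qed

section \<open>Clauses on a line as a partition problem\<close>

lemma digits_unique:
  fixes B :: nat
  assumes "(\<Sum>p<N. x p * B ^ p) = (\<Sum>p<N. y p * B ^ p)" "\<And>p. x p < B" "\<And>p. y p < B" "p < N"
  shows "x p = y p"
  using assms
proof (induction N arbitrary: x y p)
  case (Suc N)
  have split: "(\<Sum>p<Suc N. z p * B ^ p) = z 0 + B * (\<Sum>p<N. z (Suc p) * B ^ p)" for z
    by (simp add: sum.lessThan_Suc_shift sum_distrib_left algebra_simps del: sum.lessThan_Suc)
  have eq: "x 0 + B * (\<Sum>p<N. x (Suc p) * B ^ p) = y 0 + B * (\<Sum>p<N. y (Suc p) * B ^ p)"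
    using Suc.prems(1) unfolding split .
  from arg_cong[OF eq, of "\<lambda>n. n mod B"] have 0: "x 0 = y 0"
    using Suc.prems(2,3) by simp
  with eq Suc.prems(2)[of 0] have "(\<Sum>p<N. x (Suc p) * B ^ p) = (\<Sum>p<N. y (Suc p) * B ^ p)" by simp
  from Suc.IH[OF this Suc.prems(2,3)] 0 Suc.prems(4) show ?case by (cases p) auto
qed simp

text \<open>No carries occur, so a subset has half of the total weight iff it takes half of each digit.\<close>

lemma half_weight_iff:
  fixes B :: nat and pos :: "'a \<Rightarrow> nat set"
  assumes "finite S" "U \<subseteq> S" "\<And>i. i \<in> S \<Longrightarrow> finite (pos i)"
    and B: "\<And>p. card {i \<in> S. p \<in> pos i} < B"
  shows "2 * (\<Sum>i\<in>U. \<Sum>p\<in>pos i. B ^ p) = (\<Sum>i\<in>S. \<Sum>p\<in>pos i. B ^ p) \<longleftrightarrow>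
    (\<forall>p. 2 * card {i \<in> U. p \<in> pos i} = card {i \<in> S. p \<in> pos i})"
proof -
  have "finite (\<Union>i\<in>S. pos i)" using assms by auto
  then obtain N where N: "(\<Union>i\<in>S. pos i) \<subseteq> {..<N}" using finite_nat_iff_bounded by blast
  have swap: "(\<Sum>i\<in>V. \<Sum>p\<in>pos i. B ^ p) = (\<Sum>p<N. card {i \<in> V. p \<in> pos i} * B ^ p)" if "V \<subseteq> S" for V
  proof -
    have fV: "finite V" using that \<open>finite S\<close> finite_subset by blast
    have "(\<Sum>i\<in>V. \<Sum>p\<in>pos i. B ^ p) = (\<Sum>i\<in>V. \<Sum>p<N. if p \<in> pos i then B ^ p else 0)"
    proof (rule sum.cong[OF refl])
      fix i assume "i \<in> V"
      then have "pos i = {p \<in> {..<N}. p \<in> pos i}" using N that by auto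
      then show "(\<Sum>p\<in>pos i. B ^ p) = (\<Sum>p<N. if p \<in> pos i then B ^ p else 0)"
        using sum.inter_filter[of "{..<N}" "\<lambda>p. B ^ p" "\<lambda>p. p \<in> pos i"] by simp
    qed
    also have "\<dots> = (\<Sum>p<N. \<Sum>i\<in>V. if p \<in> pos i then B ^ p else 0)" by (rule sum.swap)
    also have "\<dots> = (\<Sum>p<N. card {i \<in> V. p \<in> pos i} * B ^ p)"
      using sum.inter_filter[OF fV, of "\<lambda>i. B ^ _"] by simp
    finally show ?thesis .
  qed
  have S: "card {i \<in> S. p \<in> pos i} = card {i \<in> U. p \<in> pos i} + card {i \<in> S - U. p \<in> pos i}" for p
  proof -
    have eq: "{i \<in> S. p \<in> pos i} = {i \<in> U. p \<in> pos i} \<union> {i \<in> S - U. p \<in> pos i}" using \<open>U \<subseteq> S\<close> by auto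
    have "finite U" using \<open>finite S\<close> \<open>U \<subseteq> S\<close> finite_subset by blast
    then show ?thesis unfolding eq by (intro card_Un_disjoint) (use \<open>finite S\<close> in auto)
  qed
  have "(\<Sum>i\<in>S. \<Sum>p\<in>pos i. B ^ p) = (\<Sum>i\<in>U. \<Sum>p\<in>pos i. B ^ p) + (\<Sum>i\<in>S - U. \<Sum>p\<in>pos i. B ^ p)"
    using sum.subset_diff[OF \<open>U \<subseteq> S\<close> \<open>finite S\<close>] by (simp add: add.commute)
  then have "2 * (\<Sum>i\<in>U. \<Sum>p\<in>pos i. B ^ p) = (\<Sum>i\<in>S. \<Sum>p\<in>pos i. B ^ p) \<longleftrightarrow>
      (\<Sum>p<N. card {i \<in> U. p \<in> pos i} * B ^ p) = (\<Sum>p<N. card {i \<in> S - U. p \<in> pos i} * B ^ p)"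
    using swap[OF \<open>U \<subseteq> S\<close>] swap[of "S - U"] by auto
  also have "\<dots> \<longleftrightarrow> (\<forall>p. card {i \<in> U. p \<in> pos i} = card {i \<in> S - U. p \<in> pos i})"
  proof
    assume eq: "(\<Sum>p<N. card {i \<in> U. p \<in> pos i} * B ^ p) = (\<Sum>p<N. card {i \<in> S - U. p \<in> pos i} * B ^ p)"
    show "\<forall>p. card {i \<in> U. p \<in> pos i} = card {i \<in> S - U. p \<in> pos i}"
    proof
      fix p
      show "card {i \<in> U. p \<in> pos i} = card {i \<in> S - U. p \<in> pos i}"
      proof (cases "p < N")
        case True
        have "card {i \<in> U. p \<in> pos i} < B" "card {i \<in> S - U. p \<in> pos i} < B" for p
          using B[of p] unfolding S by simp_all
        from digits_unique[OF eq this True] show ?thesis .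
      next
        case False
        then have "{i \<in> U. p \<in> pos i} = {}" "{i \<in> S - U. p \<in> pos i} = {}" using N \<open>U \<subseteq> S\<close> by auto
        then show ?thesis by (simp only: card.empty)
      qed
    qed
  qed simp
  also have "\<dots> \<longleftrightarrow> (\<forall>p. 2 * card {i \<in> U. p \<in> pos i} = card {i \<in> S. p \<in> pos i})"
    by (simp only: S mult_2 add_left_cancel)
  finally show ?thesis .
qed

text \<open>
  Clauses over the variables \<open>(r, a)\<close> with \<open>r < R\<close> and \<open>a < na\<close>: the literal \<open>(d, a, s)\<close> of a clause
  template stands, when the template is placed at \<open>r\<close>, for \<open>(r + offset d, a)\<close> having the value \<open>s\<close>.
\<close>

datatype item = Lit nat nat bool | Slack nat nat nat | Extra nat nat | Falsum

text \<open>\<open>P\<close> is the length of a row. The codes \<open>0, ..., 4\<close> of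
  \<open>offset\<close> stand for the distances \<open>0\<close>, \<open>1\<close>,
  \<open>P - 1\<close>, \<open>P\<close>, \<open>P + 1\<close>, which the bound on \<open>P\<close>
  keeps distinct. By \<open>hd0\<close> every template begins with a literal at its own position;
  the slack item of this literal is withdrawn where the template is active. A clause column holds at
  most \<open>2 * (length + 1)\<close> items and a variable column two, whence the bounds on the
  base.\<close>

locale line_clauses =
  fixes P R na :: nat and Cs :: "(nat \<times> nat \<times> bool) list list" and act :: "nat \<Rightarrow> nat \<Rightarrow> bool"
    and B :: nat
  assumes P: "4 \<le> P"
    and lits: "c < length Cs \<Longrightarrow> (d, a, s) \<in> set (Cs ! c) \<Longrightarrow> d < 5 \<and> a < na"
    and dist: "c < length Cs \<Longrightarrow> distinct (Cs ! c)"
    and hd0: "c < length Cs \<Longrightarrow> Cs ! c \<noteq> [] \<and> fst (Cs ! c ! 0) = 0"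
    and act_less: "act r c \<Longrightarrow> c < length Cs \<Longrightarrow> r < R"
    and B: "2 < B" "c < length Cs \<Longrightarrow> 2 * (length (Cs ! c) + 1) < B"
begin

definition offset :: "nat \<Rightarrow> nat" where
  "offset d = (if d < 2 then d else P + d - 3)"

lemma offset_inj: "offset d = offset d' \<Longrightarrow> d = d'"
  using P by (auto simp: offset_def split: if_splits)

lemma offset_le: "d < 5 \<Longrightarrow> offset d \<le> P + 1"
  by (auto simp: offset_def)

abbreviation "nc \<equiv> length Cs"
abbreviation "K \<equiv> nc + na"

text \<open>An item has the index of the variable that it concerns, not of the clause:
  \<open>Slack r c k\<close> lies in the column of the placement at \<open>r\<close> minus the
  offset of literal \<open>k\<close>. So the columns of all items but \<open>Falsum\<close> depend
  on \<open>r\<close> only by a shift. The slack that an active placement at \<open>r\<close>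
  withdraws still has index \<open>r\<close>, because literal \<open>0\<close> has offset
  \<open>0\<close>.\<close>

definition items :: "item set" where
  "items = {Lit r a s |r a s. r < R \<and> a < na} \<union>
    {Slack r c k |r c k. r < R \<and> c < nc \<and> k < length (Cs ! c) \<and> \<not> (k = 0 \<and> act r c)} \<union>
    {Extra r c |r c. r < R \<and> c < nc \<and> \<not> act r c} \<union> {Falsum}"

text \<open>
  Each variable and each placed template has a column, which is a digit of the numbers.
  The clause columns of an inactive placement contain a slack item per literal, including \<open>Falsum\<close>, and impose no
  condition. In an active placement two of them are missing, so that the literals cannot be all false.
\<close>

fun cols :: "item \<Rightarrow> (nat \<times> nat) set" where
  "cols (Lit r a s) = insert (r + P + 1, nc + a)
    {(r + P + 1 - offset d, c) |d c. c < nc \<and> (d, a, s) \<in> set (Cs ! c)}"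
| "cols (Slack r c k) = {(r + P + 1 - offset (fst (Cs ! c ! k)), c)}"
| "cols (Extra r c) = {(r + P + 1, c)}"
| "cols Falsum = {(r + P + 1, c) |r c. r < R \<and> c < nc}"

definition pos :: "item \<Rightarrow> nat set" where
  "pos i = (\<lambda>(b, j). b * K + j) ` cols i"

definition weight :: "item \<Rightarrow> nat" where
  "weight i = (\<Sum>p\<in>pos i. B ^ p)"

definition satisfies :: "(nat \<Rightarrow> nat \<Rightarrow> bool) \<Rightarrow> bool" where
  "satisfies \<alpha> \<longleftrightarrow> (\<forall>r c. c < nc \<longrightarrow> act r c \<longrightarrow>
    (\<exists>(d, a, s) \<in> set (Cs ! c). r + offset d < R \<and> \<alpha> (r + offset d) a = s))"

definition column :: "nat \<times> nat \<Rightarrow> item set" where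
  "column x = {i \<in> items. x \<in> cols i}"

fun is_slack :: "item \<Rightarrow> bool" where
  "is_slack (Slack r c k) = True"
| "is_slack (Extra r c) = True"
| "is_slack _ = False"

text \<open>The matching behind the counts of columns: a slack item goes with the literal that it
  stands in for, and \<open>Extra\<close> with \<open>Falsum\<close>.\<close>

fun partner :: "item \<Rightarrow> item" where
  "partner (Slack r c k) = (case Cs ! c ! k of (d, a, s) \<Rightarrow> Lit r a s)"
| "partner (Extra r c) = Falsum"
| "partner i = i"

text \<open>Column \<open>b\<close> belongs to the placement at \<open>b - (P + 1)\<close>; the
  shift keeps \<open>r + P + 1 - offset d\<close> free of truncation. Columns with
  \<open>b < P + 1\<close> collect the literals of placements left of the line and are never
  active.\<close>

definition active :: "nat \<times> nat \<Rightarrow> bool" where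
  "active x \<longleftrightarrow> (case x of (b, c) \<Rightarrow> P + 1 \<le> b \<and> act (b - (P + 1)) c)"

text \<open>The items of an active column that lose their partner.\<close>

definition missing :: "nat \<times> nat \<Rightarrow> item set" where
  "missing x = (case x of (b, c) \<Rightarrow> if active (b, c)
    then {case Cs ! c ! 0 of (d, a, s) \<Rightarrow> Lit (b - (P + 1)) a s, Falsum} else {})"

section \<open>Counting items column by column\<close>

lemma finite_items: "finite items"
proof -
  have "items \<subseteq> (\<lambda>(r, a, s). Lit r a s) ` ({..<R} \<times> {..<na} \<times> UNIV) \<union>
    (\<Union>c<nc. (\<lambda>(r, k). Slack r c k) ` ({..<R} \<times> {..<length (Cs ! c)})) \<union>
    (\<lambda>(r, c). Extra r c) ` ({..<R} \<times> {..<nc}) \<union> {Falsum}"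
    unfolding items_def by (auto simp: image_iff)
  then show ?thesis by (rule finite_subset) auto
qed

lemma finite_cols: "finite (cols i)"
proof (cases i)
  case (Lit r a s)
  have "{(r + P + 1 - offset d, c) |d c. c < nc \<and> (d, a, s) \<in> set (Cs ! c)} \<subseteq>
    (\<Union>c<nc. (\<lambda>(d, a, s). (r + P + 1 - offset d, c)) ` set (Cs ! c))" by force
  from finite_subset[OF this] show ?thesis using Lit by simp
next
  case Falsum
  have "{(r + P + 1, c) |r c. r < R \<and> c < nc} = (\<lambda>(r, c). (r + P + 1, c)) ` ({..<R} \<times> {..<nc})" by auto
  then show ?thesis using Falsum by auto
qed auto

lemma cols_less: "i \<in> items \<Longrightarrow> (b, j) \<in> cols i \<Longrightarrow> j < K"
  by (cases i) (auto simp: items_def)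

lemma pos_iff: "i \<in> items \<Longrightarrow> j < K \<Longrightarrow> b * K + j \<in> pos i \<longleftrightarrow> (b, j) \<in> cols i"
proof
  assume i: "i \<in> items" and j: "j < K" and "b * K + j \<in> pos i"
  then obtain b' j' where x: "(b', j') \<in> cols i" "b * K + j = b' * K + j'" unfolding pos_def by auto
  have "j' < K" using cols_less[OF i x(1)] .
  moreover have "(x * k + y) div k = x \<and> (x * k + y) mod k = y" if "y < k" for x y k :: nat
    using that by simp
  ultimately have "b = b'" "j = j'" using x(2) j by metis+
  then show "(b, j) \<in> cols i" using x(1) by simp
qed (force simp: pos_def)

text \<open>As no column reaches \<open>B\<close>, equality of numbers is equality of digits, and
  digits are columns. \<open>K = 0\<close> is separate, because \<open>div\<close> and
  \<open>mod\<close> by \<open>K\<close> then do not recover a column; in this case all weights are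
  zero.\<close>

lemma balanced_iff:
  assumes "\<And>x. card (column x) < B" "U \<subseteq> items"
  shows "2 * (\<Sum>i\<in>U. weight i) = (\<Sum>i\<in>items. weight i) \<longleftrightarrow>
    (\<forall>b j. j < K \<longrightarrow> 2 * card (U \<inter> column (b, j)) = card (column (b, j)))"
proof (cases "K = 0")
  case True
  then have "cols i = {}" if "i \<in> items" for i
    using cols_less[OF that] by (metis equals0I less_nat_zero_code surj_pair)
  then have 0: "weight i = 0" if "i \<in> items" for i using that by (simp add: weight_def pos_def)
  have "(\<Sum>i\<in>U. weight i) = 0" "(\<Sum>i\<in>items. weight i) = 0"
    using 0 assms(2) by (auto intro!: sum.neutral)
  then show ?thesis using True by (simp only: not_less0) simp
next
  case False
  have col: "{i \<in> V. b * K + j \<in> pos i} = V \<inter> column (b, j)" if "V \<subseteq> items" "j < K" for V b j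
    using that pos_iff by (auto simp: column_def)
  have col': "items \<inter> column x = column x" for x unfolding column_def by auto
  have dec: "(p div K) * K + p mod K = p" "p mod K < K" for p
    using False mod_less_divisor[of K p] by (intro div_mult_mod_eq, linarith)
  have "2 * (\<Sum>i\<in>U. weight i) = (\<Sum>i\<in>items. weight i) \<longleftrightarrow>
    (\<forall>p. 2 * card {i \<in> U. p \<in> pos i} = card {i \<in> items. p \<in> pos i})"
    unfolding weight_def
  proof (rule half_weight_iff[OF finite_items assms(2)])
    show "finite (pos i)" for i unfolding pos_def using finite_cols by simp
    fix p
    have "{i \<in> items. p \<in> pos i} = column (p div K, p mod K)"
      using col[OF order_refl dec(2), of "p div K" p] unfolding dec(1) col' .
    then show "card {i \<in> items. p \<in> pos i} < B" using assms(1) by metis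
  qed
  also have "\<dots> \<longleftrightarrow> (\<forall>b j. j < K \<longrightarrow> 2 * card (U \<inter> column (b, j)) = card (column (b, j)))"
  proof (intro iffI allI impI)
    fix b j
    assume "\<forall>p. 2 * card {i \<in> U. p \<in> pos i} = card {i \<in> items. p \<in> pos i}" "j < K"
    then show "2 * card (U \<inter> column (b, j)) = card (column (b, j))"
      using col[OF assms(2) \<open>j < K\<close>, of b] col[OF order_refl \<open>j < K\<close>, of b] col'[of "(b, j)"] by metis
  next
    fix p
    assume *: "\<forall>b j. j < K \<longrightarrow> 2 * card (U \<inter> column (b, j)) = card (column (b, j))"
    then have "2 * card (U \<inter> column (p div K, p mod K)) = card (items \<inter> column (p div K, p mod K))"
      unfolding col' using dec(2)[of p] by blast
    then show "2 * card {i \<in> U. p \<in> pos i} = card {i \<in> items. p \<in> pos i}"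
      using col[OF assms(2) dec(2), of "p div K" p] col[OF order_refl dec(2), of "p div K" p]
      unfolding dec(1) by (simp only:)
  qed
  finally show ?thesis .
qed

lemma cols_var: "i \<in> items \<Longrightarrow> nc \<le> j \<Longrightarrow> (b, j) \<in> cols i \<longleftrightarrow> (\<exists>r s. i = Lit r (j - nc) s \<and> b = r + P + 1)"
  by (cases i) (auto simp: items_def)

text \<open>Balance of this column means that exactly one of the two values of a variable is
  chosen.\<close>

lemma column_var:
  assumes "r < R" "a < na"
  shows "column (r + P + 1, nc + a) = {Lit r a True, Lit r a False}"
proof (intro set_eqI iffI)
  fix i assume "i \<in> column (r + P + 1, nc + a)"
  then have "i \<in> items" "(r + P + 1, nc + a) \<in> cols i" by (simp_all add: column_def)
  then obtain r' s where "i = Lit r' a s" "r + P + 1 = r' + P + 1" using cols_var[of i "nc + a"] by auto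
  then show "i \<in> {Lit r a True, Lit r a False}" by (cases s) simp_all
next
  fix i assume "i \<in> {Lit r a True, Lit r a False}"
  then obtain s where s: "i = Lit r a s" by blast
  then have "i \<in> items" using assms by (simp add: items_def)
  then show "i \<in> column (r + P + 1, nc + a)" using s by (simp add: column_def)
qed

lemma column_empty: "nc \<le> j \<Longrightarrow> j < K \<Longrightarrow> (\<And>r. r < R \<Longrightarrow> b \<noteq> r + P + 1) \<Longrightarrow> column (b, j) = {}"
proof (rule equals0I)
  fix i assume *: "nc \<le> j" "\<And>r. r < R \<Longrightarrow> b \<noteq> r + P + 1" "i \<in> column (b, j)"
  then have "i \<in> items" "(b, j) \<in> cols i" by (simp_all add: column_def)
  then obtain r s where "i = Lit r (j - nc) s" "b = r + P + 1" using cols_var *(1) by blast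
  then show False using *(2)[of r] \<open>i \<in> items\<close> by (simp add: items_def)
qed

lemma pos_offset:
  assumes "d < 5" "d' < 5" "r + P + 1 - offset d = r + P + 1 - offset d'"
  shows "d = d'"
proof (rule offset_inj)
  show "offset d = offset d'"
    using offset_le[OF assms(1)] offset_le[OF assms(2)] assms(3) by linarith
qed

lemma missing_subset: "c < nc \<Longrightarrow> missing (b, c) \<subseteq> {i \<in> column (b, c). \<not> is_slack i}"
proof -
  assume c: "c < nc"
  obtain d a s where 0: "Cs ! c ! 0 = (d, a, s)" by (cases "Cs ! c ! 0")
  then have mem: "(d, a, s) \<in> set (Cs ! c)" and "d = 0"
    using hd0[OF c] nth_mem[of 0 "Cs ! c"] by auto
  then have 1: "(0, a, s) \<in> set (Cs ! c)" by simp
  have a: "a < na" using lits[OF c mem] by simp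
  show ?thesis
  proof (cases "active (b, c)")
    case True
    define r where "r = b - (P + 1)"
    have r: "b = r + P + 1" "r < R" using True act_less[of r c] c by (auto simp: active_def r_def)
    have "(b, c) \<in> cols (Lit r a s)"
      unfolding cols.simps
    proof (intro insertI2 CollectI exI conjI)
      show "(b, c) = (r + P + 1 - offset 0, c)" using r by (simp add: offset_def)
    qed (use c 1 in simp_all)
    moreover have "(b, c) \<in> cols Falsum" unfolding cols.simps using r c by blast
    ultimately have "Lit r a s \<in> column (b, c)" "Falsum \<in> column (b, c)"
      using r a by (simp_all add: column_def items_def)
    then show ?thesis using True 0 by (simp add: missing_def r_def)
  qed (simp add: missing_def)
qed

lemma card_missing: "c < nc \<Longrightarrow> card (missing (b, c)) = (if active (b, c) then 2 else 0)"
  by (cases "Cs ! c ! 0") (simp add: missing_def)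

lemma Lit_column: "c < nc \<Longrightarrow> Lit r a s \<in> column (b, c) \<longleftrightarrow>
    r < R \<and> a < na \<and> (\<exists>d. (d, a, s) \<in> set (Cs ! c) \<and> b = r + P + 1 - offset d)"
  by (simp add: column_def items_def) blast

lemma Slack_column: "c < nc \<Longrightarrow> Slack r c' k \<in> column (b, c) \<longleftrightarrow> c' = c \<and> r < R \<and>
    k < length (Cs ! c) \<and> \<not> (k = 0 \<and> act r c) \<and> b = r + P + 1 - offset (fst (Cs ! c ! k))"
  by (simp add: column_def items_def) blast

lemma Extra_column: "c < nc \<Longrightarrow> Extra r c' \<in> column (b, c) \<longleftrightarrow> c' = c \<and> r < R \<and> \<not> act r c \<and> b = r + P + 1"
  by (simp add: column_def items_def) blast

lemma Falsum_column: "c < nc \<Longrightarrow> Falsum \<in> column (b, c) \<longleftrightarrow> (\<exists>r<R. b = r + P + 1)"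
  by (simp add: column_def items_def) blast

lemma missing_active: "act r c \<Longrightarrow> Cs ! c ! 0 = (d, a, s) \<Longrightarrow> missing (r + P + 1, c) = {Lit r a s, Falsum}"
  by (simp add: missing_def active_def)

lemma missing_inactive: "\<not> act r c \<Longrightarrow> missing (r + P + 1, c) = {}"
  by (simp add: missing_def active_def)

lemma missing_cases:
  assumes "i \<in> missing (b, c)"
  obtains r d a s where "b = r + P + 1" "act r c" "Cs ! c ! 0 = (d, a, s)" "i = Lit r a s \<or> i = Falsum"
proof -
  obtain d a s where 0: "Cs ! c ! 0 = (d, a, s)" by (cases "Cs ! c ! 0")
  have "active (b, c)" using assms by (intro ccontr[of "active (b, c)"]) (simp add: missing_def)
  then have 1: "b = (b - (P + 1)) + P + 1" "act (b - (P + 1)) c" by (simp_all add: active_def)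
  then have "i = Lit (b - (P + 1)) a s \<or> i = Falsum"
    using assms missing_active[OF 1(2) 0] by simp
  then show ?thesis using that 0 1 by blast
qed

text \<open>Within a column the index of a literal determines its offset, and templates have no
  repeated literals; so a literal item of the column comes from exactly one \<open>k\<close>.
  Withdrawing slack \<open>0\<close> and \<open>Extra\<close> leaves the first literal and
  \<open>Falsum\<close> without partners.\<close>

lemma partner_bij:
  assumes c: "c < nc"
  shows "bij_betw partner {i \<in> column (b, c). is_slack i} ({i \<in> column (b, c). \<not> is_slack i} - missing (b, c))"
    (is "bij_betw _ ?T ?L")
proof -
  have nth: "k = k'" if "Cs ! c ! k = x" "Cs ! c ! k' = x" "k < length (Cs ! c)" "k' < length (Cs ! c)" for k k' x
    using that dist[OF c] nth_eq_iff_index_eq by metis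
  have T: thesis if i: "i \<in> ?T"
    and 1: "\<And>r k d a s. i = Slack r c k \<Longrightarrow> r < R \<Longrightarrow> k < length (Cs ! c) \<Longrightarrow> \<not> (k = 0 \<and> act r c) \<Longrightarrow>
      Cs ! c ! k = (d, a, s) \<Longrightarrow> d < 5 \<Longrightarrow> a < na \<Longrightarrow> b = r + P + 1 - offset d \<Longrightarrow> thesis"
    and 2: "\<And>r. i = Extra r c \<Longrightarrow> r < R \<Longrightarrow> \<not> act r c \<Longrightarrow> b = r + P + 1 \<Longrightarrow> thesis" for i thesis
  proof (cases i)
    case (Slack r c' k)
    obtain d a s where k: "Cs ! c ! k = (d, a, s)" by (cases "Cs ! c ! k")
    have *: "c' = c" "r < R" "k < length (Cs ! c)" "\<not> (k = 0 \<and> act r c)" "b = r + P + 1 - offset d"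
      using i k unfolding Slack mem_Collect_eq Slack_column[OF c] by auto
    moreover have "d < 5" "a < na" using lits[OF c] nth_mem[OF *(3)] unfolding k by auto
    ultimately show ?thesis using 1 Slack k by blast
  next
    case (Extra r c')
    then show ?thesis using i 2 unfolding Extra mem_Collect_eq Extra_column[OF c] by blast
  next
    case (Lit r a s)
    then have False using i by simp
    then show ?thesis ..
  next
    case Falsum
    then have False using i by simp
    then show ?thesis ..
  qed
  show ?thesis
    unfolding bij_betw_def
  proof
    show "inj_on partner ?T"
    proof (rule inj_onI)
      fix i j assume i: "i \<in> ?T" and j: "j \<in> ?T" and eq: "partner i = partner j"
      from i show "i = j"
      proof (rule T)
        fix r k d a s assume 1: "i = Slack r c k" "Cs ! c ! k = (d, a, s)" "k < length (Cs ! c)" "d < 5"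
          "b = r + P + 1 - offset d"
        from j show ?thesis
        proof (rule T)
          fix r' k' d' a' s' assume 2: "j = Slack r' c k'" "Cs ! c ! k' = (d', a', s')" "k' < length (Cs ! c)" "d' < 5"
            "b = r' + P + 1 - offset d'"
          then have "r = r'" "a = a'" "s = s'" using eq 1 by simp_all
          moreover have "d = d'" using pos_offset[of d d' r] 1 2 \<open>r = r'\<close> by simp
          ultimately show ?thesis using nth[OF 1(2) _ 1(3) 2(3)] 1(1) 2(1,2) by simp
        next
          fix r' assume "j = Extra r' c"
          then show ?thesis using eq 1(1,2) by simp
        qed
      next
        fix r assume 1: "i = Extra r c" "b = r + P + 1"
        from j show ?thesis
        proof (rule T)
          fix r' k' d' a' s' assume "j = Slack r' c k'" "Cs ! c ! k' = (d', a', s')"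
          then show ?thesis using eq 1(1) by simp
        next
          fix r' assume "j = Extra r' c" "b = r' + P + 1"
          then show ?thesis using 1 by simp
        qed
      qed
    qed
    show "partner ` ?T = ?L"
    proof
      show "partner ` ?T \<subseteq> ?L"
      proof
        fix j assume "j \<in> partner ` ?T"
        then obtain i where i: "i \<in> ?T" "j = partner i" by blast
        from i(1) show "j \<in> ?L"
        proof (rule T)
          fix r k d a s
          assume *: "i = Slack r c k" "r < R" "k < length (Cs ! c)" "\<not> (k = 0 \<and> act r c)"
            "Cs ! c ! k = (d, a, s)" "d < 5" "a < na" "b = r + P + 1 - offset d"
          have "(d, a, s) \<in> set (Cs ! c)" using nth_mem[OF *(3)] unfolding *(5) .
          then have "Lit r a s \<in> column (b, c)"
            unfolding Lit_column[OF c] using *(2,7,8) by (intro conjI exI[of _ d])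
          moreover have "Lit r a s \<notin> missing (b, c)"
          proof
            assume "Lit r a s \<in> missing (b, c)"
            then obtain d0 where d0: "Cs ! c ! 0 = (d0, a, s)" "act r c" "b = r + P + 1"
            proof (rule missing_cases)
              fix r' d' a' s'
              assume 1: "\<And>d0. Cs ! c ! 0 = (d0, a, s) \<Longrightarrow> act r c \<Longrightarrow> b = r + P + 1 \<Longrightarrow> thesis"
                and 2: "b = r' + P + 1" "act r' c" "Cs ! c ! 0 = (d', a', s')" "Lit r a s = Lit r' a' s' \<or> Lit r a s = Falsum"
              from 2(4) have eq: "r' = r" "a' = a" "s' = s" by simp_all
              show thesis by (rule 1[OF 2(3)[unfolded eq] 2(2,1)[unfolded eq]])
            qed
            have "d0 = 0" using d0 hd0[OF c] by simp
            have "d = 0" using pos_offset[of d 0 r] * d0(3) by (simp add: offset_def)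
            then have "k = 0" using nth[OF *(5) _ *(3), of 0] d0(1) \<open>d0 = 0\<close> hd0[OF c] by simp
            then show False using *(4) d0(2) by simp
          qed
          ultimately show ?thesis using i(2) * by simp
        next
          fix r assume *: "i = Extra r c" "r < R" "\<not> act r c" "b = r + P + 1"
          then have "Falsum \<in> column (b, c)" unfolding Falsum_column[OF c] by (intro exI[of _ r] conjI)
          then show ?thesis using i(2) * missing_inactive by simp
        qed
      qed
      show "?L \<subseteq> partner ` ?T"
      proof
        fix j assume j: "j \<in> ?L"
        show "j \<in> partner ` ?T"
        proof (cases j)
          case (Lit r a s)
          have "Lit r a s \<in> column (b, c)" using j Lit by simp
          then obtain d where d: "r < R" "a < na" "(d, a, s) \<in> set (Cs ! c)" "b = r + P + 1 - offset d"
            unfolding Lit_column[OF c] by blast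
          then obtain k where k: "k < length (Cs ! c)" "Cs ! c ! k = (d, a, s)" unfolding in_set_conv_nth by blast
          have "\<not> (k = 0 \<and> act r c)"
          proof
            assume k0: "k = 0 \<and> act r c"
            then have "offset d = 0" "Cs ! c ! 0 = (d, a, s)" using hd0[OF c] k by (simp_all add: offset_def)
            then show False using missing_active[of r c d a s] k0 j Lit d(4) by simp
          qed
          then have "Slack r c k \<in> column (b, c)" unfolding Slack_column[OF c] using d k by simp
          moreover have "partner (Slack r c k) = j" using k Lit by simp
          ultimately show ?thesis by (intro image_eqI[of _ _ "Slack r c k"]) simp_all
        next
          case Falsum
          then have "Falsum \<in> column (b, c)" using j by simp
          then obtain r where r: "r < R" "b = r + P + 1" unfolding Falsum_column[OF c] by blast
          have "\<not> act r c"
          proof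
            assume "act r c"
            moreover obtain d a s where "Cs ! c ! 0 = (d, a, s)" by (cases "Cs ! c ! 0")
            ultimately show False using missing_active[of r c d a s] j Falsum r by simp
          qed
          then have "Extra r c \<in> column (b, c)" unfolding Extra_column[OF c] using r by simp
          then show ?thesis using Falsum by (intro image_eqI[of _ _ "Extra r c"]) simp_all
        next
          case (Slack r c' k)
          then have False using j by simp
          then show ?thesis ..
        next
          case (Extra r c')
          then have False using j by simp
          then show ?thesis ..
        qed
      qed
    qed
  qed
qed

lemma finite_column: "finite (column x)"
  unfolding column_def using finite_items by simp

text \<open>With \<open>t\<close> slack items an inactive column has \<open>2 * t\<close> items and
  an active one \<open>2 * t + 2\<close>. Half of an active column is thus one more than its slack
  can supply.\<close>

lemma card_slack:
  assumes "c < nc"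
  shows "card {i \<in> column (b, c). is_slack i} + (if active (b, c) then 2 else 0) =
    card {i \<in> column (b, c). \<not> is_slack i}"
proof -
  let ?L = "{i \<in> column (b, c). \<not> is_slack i}"
  have fin: "finite ?L" using finite_column[of "(b, c)"] by simp
  note sub = missing_subset[OF assms, of b]
  have "card (?L - missing (b, c)) = card ?L - card (missing (b, c))"
    using finite_subset[OF sub fin] sub by (rule card_Diff_subset)
  moreover have "card (missing (b, c)) \<le> card ?L" using fin sub by (rule card_mono)
  ultimately show ?thesis
    using bij_betw_same_card[OF partner_bij[OF assms, of b]] card_missing[OF assms, of b] by linarith
qed

lemma card_column_split:
  "card (column x) = card {i \<in> column x. is_slack i} + card {i \<in> column x. \<not> is_slack i}"
  using card_Un_disjoint[of "{i \<in> column x. is_slack i}" "{i \<in> column x. \<not> is_slack i}"] finite_column[of x]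
  by (simp add: disjoint_iff flip: Collect_disj_eq) (simp flip: conj_disj_distribL)

text \<open>A clause column has at most one literal item per literal of the template, besides
  \<open>Falsum\<close>, and no more slack items than these. A column that belongs neither to a
  clause nor to a variable is empty.\<close>

lemma card_column: "card (column x) < B"
proof (cases x)
  case (Pair b j)
  show ?thesis
  proof (cases "j < nc")
    case True
    let ?f = "\<lambda>(d, a, s). Lit (b + offset d - (P + 1)) a s"
    have "{i \<in> column (b, j). \<not> is_slack i} \<subseteq> insert Falsum (?f ` set (Cs ! j))"
    proof
      fix i assume i: "i \<in> {i \<in> column (b, j). \<not> is_slack i}"
      show "i \<in> insert Falsum (?f ` set (Cs ! j))"
      proof (cases i)
        case (Lit r a s)
        have "Lit r a s \<in> column (b, j)" using i Lit by simp
        then obtain d where d: "(d, a, s) \<in> set (Cs ! j)" "b = r + P + 1 - offset d"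
          unfolding Lit_column[OF True] by blast
        have "offset d \<le> P + 1" using lits[OF True d(1)] offset_le by blast
        then have "i = ?f (d, a, s)" using d(2) Lit by simp
        then show ?thesis using d(1) by (intro insertI2) (rule image_eqI)
      next
        case (Slack r c k)
        then have False using i by simp
        then show ?thesis ..
      next
        case (Extra r c)
        then have False using i by simp
        then show ?thesis ..
      next
        case Falsum
        then show ?thesis by (simp only: insertI1)
      qed
    qed
    then have "card {i \<in> column (b, j). \<not> is_slack i} \<le> card (insert Falsum (?f ` set (Cs ! j)))"
      by (intro card_mono) auto
    also have "\<dots> \<le> Suc (card (set (Cs ! j)))"
      by (simp add: card_insert_if card_image_le le_SucI)
    also have "\<dots> \<le> length (Cs ! j) + 1" using card_length[of "Cs ! j"] by simp
    finally have "card {i \<in> column (b, j). \<not> is_slack i} \<le> length (Cs ! j) + 1" .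
    then show ?thesis
      using card_column_split[of "(b, j)"] card_slack[OF True, of b] B(2)[OF True] Pair by simp
  next
    case False
    show ?thesis
    proof (cases "\<exists>r<R. b = r + P + 1 \<and> j < K")
      case True
      then obtain r where "r < R" "b = r + P + 1" "j < K" by blast
      moreover define a where "a = j - nc"
      ultimately have "x = (r + P + 1, nc + a)" "a < na" using False Pair by auto
      then show ?thesis using column_var[OF \<open>r < R\<close>] B(1) by simp
    next
      case no: False
      have "column (b, j) = {}"
      proof (cases "j < K")
        case True
        then show ?thesis using no False by (intro column_empty) auto
      next
        case False
        then show ?thesis using cols_less[of _ b j] by (auto simp: column_def)
      qed
      then show ?thesis using B(1) Pair by simp
    qed
  qed
qed

lemma literal_column:
  assumes "c < nc" "Lit r' a s \<in> column (r + P + 1, c)"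
  obtains d where "(d, a, s) \<in> set (Cs ! c)" "r' = r + offset d" "r' < R" "a < na"
proof -
  obtain d where d: "(d, a, s) \<in> set (Cs ! c)" "r + P + 1 = r' + P + 1 - offset d" "r' < R" "a < na"
    using assms(2) unfolding Lit_column[OF assms(1)] by blast
  have "offset d \<le> P + 1" using lits[OF assms(1) d(1)] offset_le by blast
  then have "r' = r + offset d" using d(2) by linarith
  then show ?thesis using that d by blast
qed

lemma column_literal:
  assumes "c < nc" "(d, a, s) \<in> set (Cs ! c)" "r + offset d < R"
  shows "Lit (r + offset d) a s \<in> column (r + P + 1, c)"
  unfolding Lit_column[OF assms(1)] using assms(2,3) lits[OF assms(1,2)]
  by (intro conjI exI[of _ d]) simp_all

text \<open>The half without \<open>Falsum\<close> needs one item more than the slack of an active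
  column, so it contains one of its literals; the variable columns make the chosen literals
  consistent.\<close>

lemma satisfies_if_balanced:
  assumes U: "U \<subseteq> items" "Falsum \<notin> U"
    and bal: "\<And>b j. j < K \<Longrightarrow> 2 * card (U \<inter> column (b, j)) = card (column (b, j))"
  shows "satisfies (\<lambda>r a. Lit r a True \<in> U)"
proof -
  have val: "(Lit r a True \<in> U) = s" if "Lit r a s \<in> U" for r a s
  proof (cases s)
    case False
    have ra: "r < R" "a < na" using that U(1) by (auto simp: items_def)
    have "2 * card (U \<inter> {Lit r a True, Lit r a False}) = 2"
      using bal[of "nc + a" "r + P + 1"] column_var[OF ra] ra(2) by simp
    moreover have "Lit r a False \<in> U" using that False by simp
    ultimately have "Lit r a True \<notin> U" by auto
    then show ?thesis using False by simp
  qed (use that in simp)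
  show ?thesis
    unfolding satisfies_def
  proof (intro allI impI)
    fix r c assume c: "c < nc" "act r c"
    let ?x = "(r + P + 1, c)"
    let ?T = "{i \<in> column ?x. is_slack i}"
    have "active ?x" using c by (simp add: active_def)
    then have "card (column ?x) = 2 * card ?T + 2"
      using card_column_split[of ?x] card_slack[OF c(1), of "r + P + 1"] by simp
    moreover have "2 * card (U \<inter> column ?x) = card (column ?x)" using bal[of c] c(1) by simp
    ultimately have "card ?T < card (U \<inter> column ?x)" by linarith
    moreover have "card (U \<inter> column ?x) \<le> card ?T" if "U \<inter> column ?x \<subseteq> ?T"
      using that by (intro card_mono) (simp_all add: finite_column)
    ultimately have "\<not> U \<inter> column ?x \<subseteq> ?T" by linarith
    then obtain i where i: "i \<in> U" "i \<in> column ?x" "\<not> is_slack i" by blast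
    obtain r' a s where Lit: "i = Lit r' a s"
    proof (cases i)
      case Falsum
      then show ?thesis using i(1) U(2) by simp
    qed (use i(3) that in simp_all)
    obtain d where d: "(d, a, s) \<in> set (Cs ! c)" "r' = r + offset d" "r' < R"
      by (rule literal_column[OF c(1) i(2)[unfolded Lit]])
    have "(Lit r' a True \<in> U) = s" by (rule val[OF i(1)[unfolded Lit]])
    then show "\<exists>(d, a, s)\<in>set (Cs ! c). r + offset d < R \<and> (Lit (r + offset d) a True \<in> U) = s"
      using d(2,3) by (intro bexI[OF _ d(1)]) simp
  qed
qed

text \<open>In an active column at least one literal is true, and at least \<open>Falsum\<close> is
  not; so the slack suffices to fill up the half exactly. The fillings can be chosen separately for
  all columns, since a slack item lies in one column only.\<close>

lemma balanced_if_satisfies: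
  assumes sat: "satisfies \<alpha>"
  obtains U where "U \<subseteq> items" "\<And>b j. j < K \<Longrightarrow> 2 * card (U \<inter> column (b, j)) = card (column (b, j))"
proof -
  define true where "true i = (\<exists>r a. i = Lit r a (\<alpha> r a))" for i
  have not_true: "\<not> true i" if "is_slack i" for i using that by (auto simp: true_def)
  have ex: "\<exists>V \<subseteq> {i \<in> column (b, c). is_slack i}.
      2 * (card {i \<in> column (b, c). true i} + card V) = card (column (b, c))" if c: "c < nc" for b c
  proof -
    let ?T = "{i \<in> column (b, c). is_slack i}" and ?L = "{i \<in> column (b, c). \<not> is_slack i}"
      and ?M = "{i \<in> column (b, c). true i}"
    note fin = finite_column[of "(b, c)"]
    have sub: "?M \<subseteq> ?L" using not_true by auto
    have M: "card ?M \<le> card ?L" using fin sub by (intro card_mono) auto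
    have 1: "card (column (b, c)) = card ?T + card ?L" by (rule card_column_split)
    show ?thesis
    proof (cases "active (b, c)")
      case False
      then have "card ?T = card ?L" using card_slack[OF c, of b] by simp
      then obtain V where "V \<subseteq> ?T" "card V = card ?L - card ?M"
        using obtain_subset_with_card_n[of "card ?L - card ?M" ?T] by auto
      then show ?thesis using 1 M \<open>card ?T = card ?L\<close> by (intro exI[of _ V]) simp
    next
      case True
      define r where "r = b - (P + 1)"
      have r: "b = r + P + 1" "act r c" using True by (simp_all add: active_def r_def)
      then obtain d a s where d: "(d, a, s) \<in> set (Cs ! c)" "r + offset d < R" "\<alpha> (r + offset d) a = s"
        using sat c unfolding satisfies_def by blast
      have "Lit (r + offset d) a s \<in> ?M"
        using column_literal[OF c d(1,2)] d(3) r(1) by (auto simp: true_def)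
      then have "1 \<le> card ?M" using fin by (auto simp: Suc_le_eq card_gt_0_iff)
      have "Falsum \<in> ?L - ?M"
        using Falsum_column[OF c, of b] r act_less[OF r(2) c] by (auto simp: true_def)
      then have "card ?M < card ?L" using sub fin by (intro psubset_card_mono) auto
      have T: "card ?T + 2 = card ?L" using card_slack[OF c, of b] True by simp
      have "card ?L - 1 - card ?M \<le> card ?T" using T \<open>1 \<le> card ?M\<close> by linarith
      then obtain V where "V \<subseteq> ?T" "card V = card ?L - 1 - card ?M"
        by (rule obtain_subset_with_card_n)
      then show ?thesis using 1 T \<open>card ?M < card ?L\<close> by (intro exI[of _ V]) simp
    qed
  qed
  have "\<exists>V. \<forall>b c. c < nc \<longrightarrow> V (b, c) \<subseteq> {i \<in> column (b, c). is_slack i} \<and>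
      2 * (card {i \<in> column (b, c). true i} + card (V (b, c))) = card (column (b, c))"
    (is "\<exists>V. \<forall>b c. _ \<longrightarrow> ?P b c (V (b, c))")
  proof (intro exI allI impI)
    fix b c assume "c < nc"
    show "?P b c ((\<lambda>(b, c). SOME V. ?P b c V) (b, c))"
      unfolding prod.case by (rule someI_ex) (use ex[OF \<open>c < nc\<close>] in blast)
  qed
  then obtain V where V: "\<And>b c. c < nc \<Longrightarrow> V (b, c) \<subseteq> {i \<in> column (b, c). is_slack i}"
    "\<And>b c. c < nc \<Longrightarrow> 2 * (card {i \<in> column (b, c). true i} + card (V (b, c))) = card (column (b, c))"
    by blast
  define U where "U = {i \<in> items. true i \<or> (is_slack i \<and> (\<exists>x\<in>cols i. i \<in> V x))}"
  show ?thesis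
  proof (rule that)
    show "U \<subseteq> items" by (auto simp: U_def)
    fix b j assume j: "j < K"
    show "2 * card (U \<inter> column (b, j)) = card (column (b, j))"
    proof (cases "j < nc")
      case True
      have "U \<inter> column (b, j) = {i \<in> column (b, j). true i} \<union> V (b, j)"
      proof (intro set_eqI iffI)
        fix i assume i: "i \<in> U \<inter> column (b, j)"
        show "i \<in> {i \<in> column (b, j). true i} \<union> V (b, j)"
        proof (cases "true i")
          case False
          then obtain x where x: "is_slack i" "x \<in> cols i" "i \<in> V x" using i by (auto simp: U_def)
          moreover have "(b, j) \<in> cols i" using i by (simp add: column_def)
          ultimately have "x = (b, j)" by (cases i) simp_all
          then show ?thesis using x by simp
        qed (use i in simp)
      next
        fix i assume "i \<in> {i \<in> column (b, j). true i} \<union> V (b, j)"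
        then have "i \<in> column (b, j)" "true i \<or> is_slack i \<and> i \<in> V (b, j)" using V(1)[OF True] by blast+
        then show "i \<in> U \<inter> column (b, j)" by (auto simp: U_def column_def)
      qed
      moreover have "{i \<in> column (b, j). true i} \<inter> V (b, j) = {}" using V(1)[OF True] not_true by blast
      moreover have "finite (V (b, j))" using finite_subset[OF V(1)[OF True, of b]] finite_column[of "(b, j)"] by simp
      ultimately show ?thesis using V(2)[OF True, of b] finite_column[of "(b, j)"] by (simp add: card_Un_disjoint)
    next
      case False
      show ?thesis
      proof (cases "\<exists>r<R. b = r + P + 1")
        case True
        then obtain r where r: "r < R" "b = r + P + 1" by blast
        define a where "a = j - nc"
        have a: "a < na" "j = nc + a" using False j by (simp_all add: a_def)
        have "Lit r a (\<alpha> r a) \<in> U" using r a by (auto simp: U_def items_def true_def)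
        moreover have "Lit r a (\<not> \<alpha> r a) \<notin> U" by (auto simp: U_def true_def)
        ultimately have "U \<inter> {Lit r a True, Lit r a False} = {Lit r a (\<alpha> r a)}" by (cases "\<alpha> r a") auto
        then show ?thesis using column_var[OF r(1) a(1)] r(2) a(2) by simp
      next
        case no: False
        have "column (b, j) = {}" using False j no by (intro column_empty) auto
        then show ?thesis by simp
      qed
    qed
  qed
qed

theorem balanced_iff_satisfiable:
  "(\<exists>U \<subseteq> items. 2 * (\<Sum>i\<in>U. weight i) = (\<Sum>i\<in>items. weight i)) \<longleftrightarrow> (\<exists>\<alpha>. satisfies \<alpha>)"
proof
  assume "\<exists>U \<subseteq> items. 2 * (\<Sum>i\<in>U. weight i) = (\<Sum>i\<in>items. weight i)"
  then obtain U where U: "U \<subseteq> items" "2 * (\<Sum>i\<in>U. weight i) = (\<Sum>i\<in>items. weight i)" by blast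
  \<comment> \<open>The complement of a half is a half as well, so \<open>Falsum\<close> may be
    assumed to lie outside.\<close>
  have "\<exists>U' \<subseteq> items. Falsum \<notin> U' \<and> 2 * (\<Sum>i\<in>U'. weight i) = (\<Sum>i\<in>items. weight i)"
  proof (cases "Falsum \<in> U")
    case True
    moreover have "(\<Sum>i\<in>items. weight i) = (\<Sum>i\<in>items - U. weight i) + (\<Sum>i\<in>U. weight i)"
      by (rule sum.subset_diff[OF U(1) finite_items])
    ultimately show ?thesis using U by (intro exI[of _ "items - U"]) auto
  qed (use U in blast)
  then obtain U' where U': "U' \<subseteq> items" "Falsum \<notin> U'" "2 * (\<Sum>i\<in>U'. weight i) = (\<Sum>i\<in>items. weight i)"
    by blast
  from U'(3) have "\<forall>b j. j < K \<longrightarrow> 2 * card (U' \<inter> column (b, j)) = card (column (b, j))"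
    unfolding balanced_iff[OF card_column U'(1)] .
  then have "satisfies (\<lambda>r a. Lit r a True \<in> U')" using satisfies_if_balanced[OF U'(1,2)] by blast
  then show "\<exists>\<alpha>. satisfies \<alpha>" by blast
next
  assume "\<exists>\<alpha>. satisfies \<alpha>"
  then show "\<exists>U \<subseteq> items. 2 * (\<Sum>i\<in>U. weight i) = (\<Sum>i\<in>items. weight i)"
  proof
    fix \<alpha> assume "satisfies \<alpha>"
    then obtain U where U: "U \<subseteq> items" "\<And>b j. j < K \<Longrightarrow> 2 * card (U \<inter> column (b, j)) = card (column (b, j))"
      by (rule balanced_if_satisfies) blast
    then show ?thesis by (intro exI[of _ U] conjI) (auto simp: balanced_iff[OF card_column U(1)])
  qed
qed

end

section \<open>Runs of Turing machines as satisfying assignments\<close>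

text \<open>Halting is turned into an idle transition, so that every row of the tableau up to the
  time bound follows from the previous one by the same clauses.\<close>

definition delta :: "tm \<Rightarrow> nat \<Rightarrow> nat list \<Rightarrow> nat \<times> (nat \<times> move) list" where
  "delta M q ss = (if q = states M then (q, map (\<lambda>s. (s, Stay)) ss) else trans M q ss)"

fun disp :: "move \<Rightarrow> int" where
  "disp MoveLeft = -1"
| "disp Stay = 0"
| "disp MoveRight = 1"

lemma shift_disp: "shift m h = h + disp m"
  by (cases m) simp_all

locale run =
  fixes M :: tm and xs :: "word list"
  assumes valid: "valid_tm M" and len_xs: "length xs < tapes M"
begin

definition conf_at :: "nat \<Rightarrow> config" where
  "conf_at t = (step M ^^ t) (init M xs)"

definition st :: "nat \<Rightarrow> nat" where
  "st t = fst (conf_at t)"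

definition content :: "nat \<Rightarrow> nat \<Rightarrow> int \<Rightarrow> nat" where
  "content t j = fst (snd (conf_at t) ! j)"

definition head :: "nat \<Rightarrow> nat \<Rightarrow> int" where
  "head t j = snd (snd (conf_at t) ! j)"

definition scanned :: "nat \<Rightarrow> nat list" where
  "scanned t = map (\<lambda>j. content t j (head t j)) [0..<tapes M]"

definition written :: "nat \<Rightarrow> nat \<Rightarrow> nat" where
  "written t j = fst (snd (delta M (st t) (scanned t)) ! j)"

definition moved :: "nat \<Rightarrow> nat \<Rightarrow> move" where
  "moved t j = snd (snd (delta M (st t) (scanned t)) ! j)"

lemma delta_valid:
  assumes "q \<le> states M" "length ss = tapes M" "set ss \<subseteq> {..<symbols M}"
  shows "fst (delta M q ss) \<le> states M" "length (snd (delta M q ss)) = tapes M"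
    "j < tapes M \<Longrightarrow> fst (snd (delta M q ss) ! j) < symbols M"
proof -
  have "fst (delta M q ss) \<le> states M \<and> length (snd (delta M q ss)) = tapes M \<and>
    (\<forall>a \<in> set (snd (delta M q ss)). fst a < symbols M)"
  proof (cases "q = states M")
    case True
    then show ?thesis using assms by (auto simp: delta_def)
  next
    case False
    then have "case trans M q ss of (q', as) \<Rightarrow>
        q' \<le> states M \<and> length as = tapes M \<and> (\<forall>(s, m) \<in> set as. s < symbols M)"
      using valid assms unfolding valid_tm_def by simp
    then show ?thesis using False by (fastforce simp: delta_def split: prod.splits)
  qed
  then show "fst (delta M q ss) \<le> states M" "length (snd (delta M q ss)) = tapes M"
    "j < tapes M \<Longrightarrow> fst (snd (delta M q ss) ! j) < symbols M"
    using nth_mem[of j "snd (delta M q ss)"] by auto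
qed

lemma step_delta:
  "step M (q, ts) = (fst (delta M q (map scan ts)), map2 act (snd (delta M q (map scan ts))) ts)"
proof (cases "q = states M")
  case True
  have "map2 act (map (\<lambda>s. (s, Stay)) (map scan ts)) ts = ts"
    by (rule nth_equalityI) (auto simp: split: prod.splits, metis act.simps fun_upd_triv prod.exhaust scan.simps shift.simps(2))
  then show ?thesis using True by (simp add: delta_def)
qed (simp add: delta_def split: prod.splits)

lemma wf_conf: "length (snd (conf_at t)) = tapes M \<and> st t \<le> states M \<and> (\<forall>j<tapes M. \<forall>i. content t j i < symbols M)"
proof (induction t)
  case 0
  have "3 \<le> symbols M" using valid by (simp add: valid_tm_def)
  then have "word_tape y i < symbols M" for y i by (simp add: word_tape_def)
  then show ?case using len_xs
    by (auto simp: conf_at_def init_def st_def content_def nth_Cons nth_append split: nat.split)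
next
  case (Suc t)
  obtain q ts where c: "conf_at t = (q, ts)" by (cases "conf_at t")
  let ?d = "delta M q (map scan ts)"
  have ts: "length ts = tapes M" "q \<le> states M" "\<And>j i. j < tapes M \<Longrightarrow> fst (ts ! j) i < symbols M"
    using Suc by (simp_all add: c st_def content_def)
  have "scan T = fst T (snd T)" for T by (cases T) simp
  then have "set (map scan ts) \<subseteq> {..<symbols M}" using ts by (auto simp: in_set_conv_nth) (metis fst_conv)
  note v = delta_valid[OF ts(2) _ this, unfolded length_map, OF ts(1)]
  have s: "conf_at (Suc t) = (fst ?d, map2 act (snd ?d) ts)"
    using c step_delta by (simp add: conf_at_def)
  have "fst (act (snd ?d ! j) (ts ! j)) i < symbols M" if "j < tapes M" for j i
    using v(3)[OF that] ts(3)[OF that] by (cases "snd ?d ! j"; cases "ts ! j") (auto simp: fun_upd_def)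
  then show ?case using v ts by (simp add: s st_def content_def)
qed

lemma scan_conf: "map scan (snd (conf_at t)) = scanned t"
  using wf_conf[of t] by (auto simp: scanned_def content_def head_def intro!: nth_equalityI)
    (metis prod.collapse scan.simps)

lemma scanned: "length (scanned t) = tapes M" "set (scanned t) \<subseteq> {..<symbols M}"
  "j < tapes M \<Longrightarrow> scanned t ! j = content t j (head t j)"
  using wf_conf[of t] by (auto simp: scanned_def)

lemma st_Suc: "st (Suc t) = fst (delta M (st t) (scanned t))"
  using step_delta[of "st t" "snd (conf_at t)"] scan_conf[of t] by (simp add: st_def conf_at_def)

lemma tape_Suc:
  assumes "j < tapes M"
  shows "content (Suc t) j = (content t j)(head t j := written t j)"
    "head (Suc t) j = head t j + disp (moved t j)"
proof -
  have "snd (conf_at (Suc t)) = map2 act (snd (delta M (st t) (scanned t))) (snd (conf_at t))"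
    using step_delta[of "st t" "snd (conf_at t)"] scan_conf[of t] by (simp add: st_def conf_at_def)
  moreover have "length (snd (delta M (st t) (scanned t))) = tapes M" "length (snd (conf_at t)) = tapes M"
    using delta_valid[of "st t" "scanned t"] wf_conf[of t] scanned by auto
  ultimately have "snd (conf_at (Suc t)) ! j = act (written t j, moved t j) (content t j, head t j)"
    using assms by (simp add: written_def moved_def content_def head_def)
  then show "content (Suc t) j = (content t j)(head t j := written t j)"
    "head (Suc t) j = head t j + disp (moved t j)"
    by (cases "snd (conf_at t) ! j"; simp add: content_def head_def shift_disp)+
qed

lemma written_less: "j < tapes M \<Longrightarrow> written t j < symbols M"
  using delta_valid(3)[of "st t" "scanned t" j] wf_conf[of t] scanned by (simp add: written_def)

lemma head_bound: "j < tapes M \<Longrightarrow> \<bar>head t j\<bar> \<le> int t"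
proof (induction t)
  case 0
  then show ?case using len_xs
    by (auto simp: conf_at_def init_def head_def nth_Cons nth_append split: nat.split)
next
  case (Suc t)
  then show ?case using tape_Suc(2)[of j t] by (cases "moved t j") auto
qed

text \<open>Tape contents are viewed relative to the head.\<close>

definition rel :: "nat \<Rightarrow> nat \<Rightarrow> int \<Rightarrow> nat" where
  "rel t j d = content t j (head t j + d)"

definition relw :: "nat \<Rightarrow> nat \<Rightarrow> int \<Rightarrow> nat" where
  "relw t j d = (if d = 0 then written t j else rel t j d)"

text \<open>After a move the whole tape is seen shifted in the opposite direction. A cell of the new
  row thus depends on the old row only near the same displacement, which local clauses can
  express.\<close>

lemma rel_Suc: "j < tapes M \<Longrightarrow> rel (Suc t) j (d - disp (moved t j)) = relw t j d"
  by (simp add: rel_def relw_def tape_Suc)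

lemma rel_less: "j < tapes M \<Longrightarrow> rel t j d < symbols M" "j < tapes M \<Longrightarrow> relw t j d < symbols M"
  using wf_conf[of t] written_less by (simp_all add: rel_def relw_def)

lemma rel_0: "j < tapes M \<Longrightarrow> rel 0 j d = word_tape (if 0 < j \<and> j \<le> length xs then xs ! (j - 1) else []) d"
  using len_xs by (auto simp: rel_def content_def head_def conf_at_def init_def nth_Cons nth_append split: nat.split)

lemma st_0: "st 0 = 0"
  by (simp add: st_def conf_at_def init_def)

lemma scanned_rel: "j < tapes M \<Longrightarrow> scanned t ! j = rel t j 0"
  by (simp add: scanned rel_def)

lemma outputs_content: "outputs_within M xs y t \<Longrightarrow> content t 0 = word_tape y"
  using wf_conf[of t] len_xs
  by (auto simp: outputs_within_def content_def conf_at_def split: prod.splits) (metis hd_conv_nth list.size(3) not_less_zero)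

end

text \<open>
  Row \<open>t\<close> of the tableau describes the configuration at time \<open>t\<close>; the column with displacement \<open>d\<close> describes, for
  each tape, the cell at distance \<open>d\<close> from the head. \<open>Wr\<close> is the symbol after the write of step \<open>t\<close>, and the
  movement \<open>Mv\<close> is broadcast along the row, so that all clauses are local.
\<close>

datatype attr = St nat | Sy nat nat | Wr nat nat | Mv nat move

instance move :: countable by countable_datatype
instance attr :: countable by countable_datatype

text \<open>A category says at which cells of the tableau a template is active.
  \<open>Initial\<close> is refined by tape and symbol: the input enters only through the choice of
  active categories, never through the templates.\<close>

datatype cat = Transition | Keep | General | Initial nat nat | Start | Guess | Final

type_synonym template = "cat \<times> (nat \<times> attr \<times> bool) list"

text \<open>The negated premise of the implication that in state \<open>q\<close>, with scanned
  symbols \<open>ss\<close>, an effect takes place.\<close>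

definition scan_lits :: "nat \<Rightarrow> nat list \<Rightarrow> (nat \<times> attr \<times> bool) list" where
  "scan_lits q ss = (0, St q, False) # map (\<lambda>j. (0, Sy j (ss ! j), False)) [0..<length ss]"

definition effects :: "nat \<times> (nat \<times> move) list \<Rightarrow> (nat \<times> attr \<times> bool) list" where
  "effects z = (3, St (fst z), True) #
    map (\<lambda>j. (0, Wr j (fst (snd z ! j)), True)) [0..<length (snd z)] @
    map (\<lambda>j. (0, Mv j (snd (snd z ! j)), True)) [0..<length (snd z)]"

text \<open>The literal \<open>(d, a, s)\<close> refers to the current column (\<open>d = 0\<close>), the next one (\<open>d = 1\<close>), or the columns with
  displacements \<open>-1\<close>, \<open>0\<close>, \<open>1\<close> of the next row (\<open>d = 2, 3, 4\<close>).\<close>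

fun target :: "move \<Rightarrow> nat" where
  "target MoveLeft = 4"
| "target Stay = 3"
| "target MoveRight = 2"

definition moves :: "move list" where
  "moves = [MoveLeft, Stay, MoveRight]"

text \<open>No clause says that a cell has only one symbol or a row only one state. The clauses
  force all that is true of the run, and \<open>Final\<close> forbids a rejecting output; attributes
  that hold in excess do no harm. \<open>Guess\<close> admits a certificate of any length up to the
  bound: a cell is a bit or blank, and blanks continue to the right. \<open>Final\<close> is
  demanded in all cells of its row, as the position of output cell \<open>0\<close> relative to the
  head is not known in advance.\<close>

definition templates :: "tm \<Rightarrow> template list" where
  "templates M =
    [(Transition, scan_lits q ss @ [l]). q \<leftarrow> [0..<Suc (states M)],
      ss \<leftarrow> List.n_lists (tapes M) [0..<symbols M], l \<leftarrow> effects (delta M q ss)] @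
    [(Keep, [(0, Sy j s, False), (0, Wr j s, True)]). j \<leftarrow> [0..<tapes M], s \<leftarrow> [0..<symbols M]] @
    [(General, [(0, Mv j m, \<not> b), (1, Mv j m, b)]). j \<leftarrow> [0..<tapes M], m \<leftarrow> moves, b \<leftarrow> [False, True]] @
    [(General, [(0, Mv j m, False), (0, Wr j s, False), (target m, Sy j s, True)]).
      j \<leftarrow> [0..<tapes M], m \<leftarrow> moves, s \<leftarrow> [0..<symbols M]] @
    [(Initial j s, [(0, Sy j s, True)]). j \<leftarrow> [0..<tapes M], s \<leftarrow> [0..<symbols M]] @
    [(Start, [(0, St 0, True)]),
     (Guess, [(0, Sy 2 0, True), (0, Sy 2 1, True), (0, Sy 2 2, True)]),
     (Guess, [(0, Sy 2 0, False), (1, Sy 2 0, True)]),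
     (Final, [(0, Sy 0 1, False)])]"

lemma set_moves: "set moves = UNIV"
  unfolding moves_def using move.exhaust by auto

lemma set_templates: "set (templates M) =
    {(Transition, scan_lits q ss @ [l]) |q ss l. q \<le> states M \<and> length ss = tapes M \<and>
      set ss \<subseteq> {..<symbols M} \<and> l \<in> set (effects (delta M q ss))} \<union>
    {(Keep, [(0, Sy j s, False), (0, Wr j s, True)]) |j s. j < tapes M \<and> s < symbols M} \<union>
    {(General, [(0, Mv j m, \<not> b), (1, Mv j m, b)]) |j m b. j < tapes M} \<union>
    {(General, [(0, Mv j m, False), (0, Wr j s, False), (target m, Sy j s, True)]) |j m s.
      j < tapes M \<and> s < symbols M} \<union>
    {(Initial j s, [(0, Sy j s, True)]) |j s. j < tapes M \<and> s < symbols M} \<union>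
    {(Start, [(0, St 0, True)]),
     (Guess, [(0, Sy 2 0, True), (0, Sy 2 1, True), (0, Sy 2 2, True)]),
     (Guess, [(0, Sy 2 0, False), (1, Sy 2 0, True)]),
     (Final, [(0, Sy 0 1, False)])}"
proof -
  have 1: "set [(Transition, scan_lits q ss @ [l]). q \<leftarrow> [0..<Suc (states M)],
      ss \<leftarrow> List.n_lists (tapes M) [0..<symbols M], l \<leftarrow> effects (delta M q ss)] =
    {(Transition, scan_lits q ss @ [l]) |q ss l. q \<le> states M \<and> length ss = tapes M \<and>
      set ss \<subseteq> {..<symbols M} \<and> l \<in> set (effects (delta M q ss))}"
    unfolding set_concat set_map image_image set_n_lists set_upt atLeast0LessThan lessThan_Suc_atMost
    by (auto simp del: lessThan_iff) blast
  have 2: "set [(Keep, [(0, Sy j s, False), (0, Wr j s, True)]). j \<leftarrow> [0..<tapes M], s \<leftarrow> [0..<symbols M]] =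
    {(Keep, [(0, Sy j s, False), (0, Wr j s, True)]) |j s. j < tapes M \<and> s < symbols M}"
    by auto
  have 3: "set [(General, [(0, Mv j m, \<not> b), (1, Mv j m, b)]). j \<leftarrow> [0..<tapes M], m \<leftarrow> moves, b \<leftarrow> [False, True]] =
    {(General, [(0, Mv j m, \<not> b), (1, Mv j m, b)]) |j m b. j < tapes M}"
    by (auto simp: set_moves ex_disj_distrib bex_disj_distrib)
  have 4: "set [(General, [(0, Mv j m, False), (0, Wr j s, False), (target m, Sy j s, True)]).
      j \<leftarrow> [0..<tapes M], m \<leftarrow> moves, s \<leftarrow> [0..<symbols M]] =
    {(General, [(0, Mv j m, False), (0, Wr j s, False), (target m, Sy j s, True)]) |j m s.
      j < tapes M \<and> s < symbols M}"
    apply (auto simp: set_moves)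
    subgoal for j m s by (rule bexI[of _ j], rule exI[of _ m], rule image_eqI[of _ _ s]) simp_all
    done
  have 5: "set [(Initial j s, [(0, Sy j s, True)]). j \<leftarrow> [0..<tapes M], s \<leftarrow> [0..<symbols M]] =
    {(Initial j s, [(0, Sy j s, True)]) |j s. j < tapes M \<and> s < symbols M}"
    by auto
  show ?thesis
    unfolding templates_def set_append 1 2 3 4 5 by (simp only: list.set Un_assoc)
qed

text \<open>The last row has no row below it, so \<open>Final\<close> must not refer to the next
  one; hence the last claim.\<close>

lemma templates_wf:
  assumes "(ct, ls) \<in> set (templates M)"
  shows "distinct ls" "ls \<noteq> []" "fst (ls ! 0) = 0" "(d, l) \<in> set ls \<Longrightarrow> d < 5"
    "ct = Final \<Longrightarrow> (d, l) \<in> set ls \<Longrightarrow> d = 0"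
proof -
  have target: "target m < 5" for m by (cases m) simp_all
  have "distinct ls \<and> ls \<noteq> [] \<and> fst (ls ! 0) = 0 \<and> (\<forall>(d, l) \<in> set ls. d < 5 \<and> (ct = Final \<longrightarrow> d = 0))"
  proof -
    have "distinct (scan_lits q ss @ [l])" if "l \<in> set (effects z)" for q ss l z
      using that unfolding scan_lits_def effects_def by (auto simp: distinct_map inj_on_def)
    moreover have "\<forall>(d, l) \<in> set (scan_lits q ss @ [l]). d < 5" if "l \<in> set (effects z)" for q ss l z
      using that unfolding scan_lits_def effects_def by auto
    moreover have "scan_lits q ss @ [l] \<noteq> [] \<and> fst ((scan_lits q ss @ [l]) ! 0) = 0" for q ss l
      by (simp add: scan_lits_def)
    ultimately have trans: "distinct (scan_lits q ss @ [l]) \<and> scan_lits q ss @ [l] \<noteq> [] \<and>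
        fst ((scan_lits q ss @ [l]) ! 0) = 0 \<and> (\<forall>(d, l) \<in> set (scan_lits q ss @ [l]). d < 5)"
      if "l \<in> set (effects z)" for q ss l z
      using that by blast
    from assms show ?thesis
      unfolding set_templates
    proof (elim UnE)
      assume "(ct, ls) \<in> {(Transition, scan_lits q ss @ [l]) |q ss l. q \<le> states M \<and> length ss = tapes M \<and>
        set ss \<subseteq> {..<symbols M} \<and> l \<in> set (effects (delta M q ss))}"
      then obtain q ss l where "ct = Transition" "ls = scan_lits q ss @ [l]" "l \<in> set (effects (delta M q ss))"
        by blast
      then show ?thesis using trans[of l "delta M q ss" q ss] by force
    next
      assume "(ct, ls) \<in> {(General, [(0, Mv j m, False), (0, Wr j s, False), (target m, Sy j s, True)]) |j m s.
        j < tapes M \<and> s < symbols M}"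
      then show ?thesis using target by auto
    qed auto
  qed
  then show "distinct ls" "ls \<noteq> []" "fst (ls ! 0) = 0" "(d, l) \<in> set ls \<Longrightarrow> d < 5"
    "ct = Final \<Longrightarrow> (d, l) \<in> set ls \<Longrightarrow> d = 0" by auto
qed

text \<open>Tape \<open>1\<close> carries the input and tape \<open>2\<close> the certificate;
  within the first \<open>p\<close> cells of the latter only \<open>Guess\<close> constrains the
  symbol.\<close>

definition initial_cats :: "word \<Rightarrow> nat \<Rightarrow> int \<Rightarrow> cat set" where
  "initial_cats x p d = {Initial j 0 |j. j \<noteq> 1 \<and> j \<noteq> 2} \<union> {Initial 1 (word_tape x d)} \<union>
    (if 0 \<le> d \<and> d < int p then {Guess} else {Initial 2 0}) \<union> (if d = 0 then {Start} else {})"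

text \<open>The displacements \<open>-D - 1\<close> and \<open>D + 1\<close> are border cells
  without clauses of their own. They receive literals of their neighbours, which therefore never
  leave the row.\<close>

definition cats :: "word \<Rightarrow> nat \<Rightarrow> nat \<Rightarrow> nat \<Rightarrow> nat \<Rightarrow> int \<Rightarrow> cat set" where
  "cats x p T D t d =
    (if \<bar>d\<bar> > int D then {} else if t = T then {Final}
     else {General} \<union> (if d = 0 then {Transition} else {Keep}) \<union> (if t = 0 then initial_cats x p d else {}))"

text \<open>One margin of \<open>T\<close> is lost because undetermined border cells move inwards by
  one cell per step, another because the head can be \<open>T\<close> cells away from output cell
  \<open>0\<close>; hence \<open>2 * T \<le> D\<close>. The certificate fits into the row by
  \<open>p \<le> D\<close>.\<close>

locale tableau =
  fixes M :: tm and x :: word and p T D P :: nat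
  assumes valid: "valid_tm M" and tapes: "2 < tapes M"
    and T: "0 < T" and D: "2 * T \<le> D" "p \<le> D" and P_def: "P = 2 * D + 3"
begin

definition ix :: "nat \<Rightarrow> int \<Rightarrow> nat" where
  "ix t d = t * P + nat (d + int D + 1)"

definition off :: "nat \<Rightarrow> nat" where
  "off d = (if d < 2 then d else P + d - 3)"

definition solves :: "(nat \<Rightarrow> attr \<Rightarrow> bool) \<Rightarrow> bool" where
  "solves \<alpha> \<longleftrightarrow> (\<forall>t d ct ls. t \<le> T \<longrightarrow> \<bar>d\<bar> \<le> int D \<longrightarrow> (ct, ls) \<in> set (templates M) \<longrightarrow> ct \<in> cats x p T D t d \<longrightarrow>
    (\<exists>(e, a, s) \<in> set ls. \<alpha> (ix t d + off e) a = s))"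

lemma ix_off:
  assumes "\<bar>d\<bar> \<le> int D"
  shows "ix t d + off 0 = ix t d" "ix t d + off 1 = ix t (d + 1)"
    "ix t d + off (target m) = ix (Suc t) (d - disp m)" "ix t d + off 3 = ix (Suc t) d"
proof -
  define n where "n = nat (d + int D + 1)"
  have n: "1 \<le> n" "nat (d + 1 + int D + 1) = n + 1" "nat (d - 1 + int D + 1) = n - 1" "nat (d + int D + 1) = n"
    using assms unfolding n_def by linarith+
  have "3 \<le> P" by (simp add: P_def)
  then show "ix t d + off 0 = ix t d" "ix t d + off 1 = ix t (d + 1)"
    "ix t d + off (target m) = ix (Suc t) (d - disp m)" "ix t d + off 3 = ix (Suc t) d"
    using n unfolding ix_def off_def by (cases m; simp)+
qed

sublocale xu: run M "[x, u]" for u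
  by unfold_locales (use valid tapes in auto)

fun holds :: "word \<Rightarrow> nat \<Rightarrow> int \<Rightarrow> attr \<Rightarrow> bool" where
  "holds u t d (St q) = (xu.st u t = q)"
| "holds u t d (Sy j s) = (xu.rel u t j d = s)"
| "holds u t d (Wr j s) = (xu.relw u t j d = s)"
| "holds u t d (Mv j m) = (xu.moved u t j = m)"

definition assignment :: "word \<Rightarrow> nat \<Rightarrow> attr \<Rightarrow> bool" where
  "assignment u r = holds u (r div P) (int (r mod P) - int D - 1)"

lemma assignment_ix: "\<bar>d\<bar> \<le> int D + 1 \<Longrightarrow> assignment u (ix t d) = holds u t d"
proof -
  assume d: "\<bar>d\<bar> \<le> int D + 1"
  then have "nat (d + int D + 1) < P" using P_def by simp
  then have "ix t d div P = t" "ix t d mod P = nat (d + int D + 1)" by (simp_all add: ix_def)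
  moreover have "int (nat (d + int D + 1)) = d + int D + 1" using d by linarith
  ultimately show ?thesis unfolding assignment_def by simp
qed

lemma scan_lits_hold:
  assumes "length ss = tapes M" "\<forall>(e, a, s) \<in> set (scan_lits q ss). holds u t 0 a \<noteq> s"
  shows "q = xu.st u t" "ss = xu.scanned u t"
proof -
  have 1: "(0, St q, False) \<in> set (scan_lits q ss)" by (simp add: scan_lits_def)
  show "q = xu.st u t" using bspec[OF assms(2) 1] by simp
  show "ss = xu.scanned u t"
  proof (rule nth_equalityI)
    fix j assume j: "j < length ss"
    then have "(0, Sy j (ss ! j), False) \<in> set (scan_lits q ss)" by (auto simp: scan_lits_def)
    from bspec[OF assms(2) this] show "ss ! j = xu.scanned u t ! j"
      using j assms(1) by (simp add: xu.scanned_rel)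
  qed (use assms(1) xu.scanned in simp)
qed

lemma solves_assignment:
  assumes u: "length u \<le> p" and acc: "xu.content u T 0 = word_tape [True]"
  shows "solves (assignment u)"
  unfolding solves_def
proof (intro allI impI)
  fix t d ct ls
  assume t: "t \<le> T" and d: "\<bar>d\<bar> \<le> int D" and tmpl: "(ct, ls) \<in> set (templates M)" and ct: "ct \<in> cats x p T D t d"
  have val0: "assignment u (ix t d + off 0) a = holds u t d a" for a
    unfolding ix_off(1)[OF d] by (subst assignment_ix) (use d in simp_all)
  have val1: "assignment u (ix t d + off 1) a = holds u t (d + 1) a" for a
    unfolding ix_off(2)[OF d] by (subst assignment_ix) (use d in linarith, rule refl)
  have valm: "assignment u (ix t d + off (target m)) a = holds u (Suc t) (d - disp m) a" for m a
  proof -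
    have "\<bar>d - disp m\<bar> \<le> int D + 1" using d by (cases m; simp)
    then show ?thesis unfolding ix_off(3)[OF d] by (subst assignment_ix) simp_all
  qed
  have val3: "assignment u (ix t d + off 3) a = holds u (Suc t) d a" for a
    unfolding ix_off(4)[OF d] by (subst assignment_ix) (use d in simp_all)
  have witness: "\<exists>(e, a, s)\<in>set ls. assignment u (ix t d + off e) a = s"
    if "(e, a, s) \<in> set ls" "assignment u (ix t d + off e) a = s" for e a s
    using that by blast
  show "\<exists>(e, a, s)\<in>set ls. assignment u (ix t d + off e) a = s"
    using tmpl unfolding set_templates
  proof (elim UnE)
    assume "(ct, ls) \<in> {(Transition, scan_lits q ss @ [l]) |q ss l. q \<le> states M \<and> length ss = tapes M \<and>
      set ss \<subseteq> {..<symbols M} \<and> l \<in> set (effects (delta M q ss))}"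
    then obtain q ss l where *: "ct = Transition" "ls = scan_lits q ss @ [l]" "length ss = tapes M"
      "l \<in> set (effects (delta M q ss))" by blast
    have "d = 0" using ct *(1) by (auto simp: cats_def initial_cats_def split: if_splits)
    show ?thesis
    proof (rule ccontr)
      assume neg: "\<not> (\<exists>(e, a, s)\<in>set ls. assignment u (ix t d + off e) a = s)"
      have "holds u t 0 a \<noteq> s" if "(e, a, s) \<in> set (scan_lits q ss)" for e a s
      proof -
        have "e = 0" using that by (auto simp: scan_lits_def)
        moreover have "(e, a, s) \<in> set ls" using that *(2) by simp
        ultimately have "assignment u (ix t d + off 0) a \<noteq> s" using neg by blast
        then show ?thesis using val0[of a] \<open>d = 0\<close> by simp
      qed
      then have "\<forall>(e, a, s) \<in> set (scan_lits q ss). holds u t 0 a \<noteq> s" by blast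
      from scan_lits_hold[OF *(3) this] have l: "l \<in> set (effects (delta M (xu.st u t) (xu.scanned u t)))"
        using *(4) by simp
      have "l \<in> set ls" using *(2) by simp
      from l consider "l = (3, St (xu.st u (Suc t)), True)"
        | j where "l = (0, Wr j (xu.written u t j), True)" | j where "l = (0, Mv j (xu.moved u t j), True)"
        unfolding effects_def xu.st_Suc xu.written_def xu.moved_def by auto
      then have "\<exists>(e, a, s)\<in>set ls. assignment u (ix t d + off e) a = s"
      proof cases
        case 1
        then show ?thesis using witness \<open>l \<in> set ls\<close> val3 by simp
      next
        case 2
        have "holds u t d (Wr j (xu.written u t j))" using \<open>d = 0\<close> by (simp add: xu.relw_def)
        then show ?thesis using witness \<open>l \<in> set ls\<close> val0 2 by simp
      next
        case 3
        then show ?thesis using witness \<open>l \<in> set ls\<close> val0 by simp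
      qed
      then show False using neg by contradiction
    qed
  next
    assume "(ct, ls) \<in> {(Keep, [(0, Sy j s, False), (0, Wr j s, True)]) |j s. j < tapes M \<and> s < symbols M}"
    then obtain j s where *: "ct = Keep" "ls = [(0, Sy j s, False), (0, Wr j s, True)]" by blast
    have "d \<noteq> 0" using ct *(1) by (auto simp: cats_def initial_cats_def split: if_splits)
    then show ?thesis unfolding *(2) using val0 by (simp add: xu.relw_def)
  next
    assume "(ct, ls) \<in> {(General, [(0, Mv j m, \<not> b), (1, Mv j m, b)]) |j m b. j < tapes M}"
    then obtain j m b where *: "ls = [(0, Mv j m, \<not> b), (1, Mv j m, b)]" by blast
    show ?thesis unfolding * using val0 val1 by (cases b) auto
  next
    assume "(ct, ls) \<in> {(General, [(0, Mv j m, False), (0, Wr j s, False), (target m, Sy j s, True)]) |j m s.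
      j < tapes M \<and> s < symbols M}"
    then obtain j m s where *: "ls = [(0, Mv j m, False), (0, Wr j s, False), (target m, Sy j s, True)]" "j < tapes M"
      by blast
    have "xu.rel u (Suc t) j (d - disp m) = xu.relw u t j d" if "xu.moved u t j = m"
      using xu.rel_Suc[OF *(2)] that by blast
    then show ?thesis unfolding *(1) using val0 valm[of m] by auto
  next
    assume "(ct, ls) \<in> {(Initial j s, [(0, Sy j s, True)]) |j s. j < tapes M \<and> s < symbols M}"
    then obtain j s where *: "ct = Initial j s" "ls = [(0, Sy j s, True)]" "j < tapes M" by blast
    then have "t = 0" using ct by (auto simp: cats_def split: if_splits)
    have "xu.rel u 0 j d = s"
      using ct * u unfolding xu.rel_0[OF *(3)]
      by (auto simp: cats_def initial_cats_def word_tape_def numeral_2_eq_2 split: if_splits)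
    then show ?thesis unfolding *(2) using val0 \<open>t = 0\<close> by simp
  next
    assume "(ct, ls) \<in> {(Start, [(0, St 0, True)]),
     (Guess, [(0, Sy 2 0, True), (0, Sy 2 1, True), (0, Sy 2 2, True)]),
     (Guess, [(0, Sy 2 0, False), (1, Sy 2 0, True)]),
     (Final, [(0, Sy 0 1, False)])}"
    then consider "ct = Start" "ls = [(0, St 0, True)]"
      | "ct = Guess" "ls = [(0, Sy 2 0, True), (0, Sy 2 1, True), (0, Sy 2 2, True)]"
      | "ct = Guess" "ls = [(0, Sy 2 0, False), (1, Sy 2 0, True)]"
      | "ct = Final" "ls = [(0, Sy 0 1, False)]" by blast
    then show ?thesis
    proof cases
      case 1
      then have "t = 0" using ct by (auto simp: cats_def split: if_splits)
      then show ?thesis unfolding 1 using val0 xu.st_0 by simp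
    next
      case 2
      then have "t = 0" using ct by (auto simp: cats_def split: if_splits)
      then show ?thesis unfolding 2 using val0 xu.rel_0[of 2] tapes by (simp add: word_tape_def)
    next
      case 3
      then have "t = 0" "0 \<le> d" using ct by (auto simp: cats_def initial_cats_def split: if_splits)
      then show ?thesis unfolding 3 using val0 val1 xu.rel_0[of 2] tapes by (simp add: word_tape_def)
    next
      case 4
      then have "t = T" using ct by (auto simp: cats_def initial_cats_def split: if_splits)
      \<comment> \<open>The output tape holds one \<open>2\<close> and otherwise blanks, so
        \<open>Final\<close> is met in every cell.\<close>
      have "xu.rel u T 0 d \<noteq> 1" unfolding xu.rel_def acc by (simp add: word_tape_def)
      then show ?thesis unfolding 4 using val0 \<open>t = T\<close> by simp
    qed
  qed
qed

lemma in_templates: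
  shows in_Transition: "q \<le> states M \<Longrightarrow> length ss = tapes M \<Longrightarrow> set ss \<subseteq> {..<symbols M} \<Longrightarrow>
      l \<in> set (effects (delta M q ss)) \<Longrightarrow> (Transition, scan_lits q ss @ [l]) \<in> set (templates M)"
    and in_Keep: "j < tapes M \<Longrightarrow> s < symbols M \<Longrightarrow>
      (Keep, [(0, Sy j s, False), (0, Wr j s, True)]) \<in> set (templates M)"
    and in_Broadcast: "j < tapes M \<Longrightarrow> (General, [(0, Mv j m, \<not> b), (1, Mv j m, b)]) \<in> set (templates M)"
    and in_Shift: "j < tapes M \<Longrightarrow> s < symbols M \<Longrightarrow>
      (General, [(0, Mv j m, False), (0, Wr j s, False), (target m, Sy j s, True)]) \<in> set (templates M)"
    and in_Initial: "j < tapes M \<Longrightarrow> s < symbols M \<Longrightarrow> (Initial j s, [(0, Sy j s, True)]) \<in> set (templates M)"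
    and in_Start: "(Start, [(0, St 0, True)]) \<in> set (templates M)"
    and in_Guess: "(Guess, [(0, Sy 2 0, True), (0, Sy 2 1, True), (0, Sy 2 2, True)]) \<in> set (templates M)"
      "(Guess, [(0, Sy 2 0, False), (1, Sy 2 0, True)]) \<in> set (templates M)"
    and in_Final: "(Final, [(0, Sy 0 1, False)]) \<in> set (templates M)"
  unfolding set_templates
  apply (rule UnI1, rule UnI1, rule UnI1, rule UnI1, rule UnI1, fast)
  apply (rule UnI1, rule UnI1, rule UnI1, rule UnI1, rule UnI2, fast)
  apply (rule UnI1, rule UnI1, rule UnI1, rule UnI2, fast)
  apply (rule UnI1, rule UnI1, rule UnI2, fast)
  apply (rule UnI1, rule UnI2, fast)
  apply (simp_all only: Un_iff insert_iff simp_thms)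
  done

lemma solvesD:
  "solves \<alpha> \<Longrightarrow> (ct, ls) \<in> set (templates M) \<Longrightarrow> t \<le> T \<Longrightarrow> \<bar>d\<bar> \<le> int D \<Longrightarrow> ct \<in> cats x p T D t d \<Longrightarrow>
    \<exists>(e, a, s) \<in> set ls. \<alpha> (ix t d + off e) a = s"
  unfolding solves_def by blast

section \<open>From a solution back to an accepting run\<close>

context
  fixes \<alpha> assumes sol: "solves \<alpha>"
begin

lemma cats_body: "t < T \<Longrightarrow> \<bar>d\<bar> \<le> int D \<Longrightarrow>
    General \<in> cats x p T D t d \<and> (if d = 0 then Transition else Keep) \<in> cats x p T D t d"
  unfolding cats_def by simp

lemma cats_initial: "\<bar>d\<bar> \<le> int D \<Longrightarrow> ct \<in> initial_cats x p d \<Longrightarrow> ct \<in> cats x p T D 0 d"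
  unfolding cats_def using T by simp

lemma keep:
  assumes "t < T" "\<bar>d\<bar> \<le> int D" "d \<noteq> 0" "j < tapes M" "s < symbols M" "\<alpha> (ix t d) (Sy j s)"
  shows "\<alpha> (ix t d) (Wr j s)"
proof -
  have 1: "(Keep, [(0, Sy j s, False), (0, Wr j s, True)]) \<in> set (templates M)"
    using assms(4,5) by (rule in_Keep)
  have 2: "Keep \<in> cats x p T D t d" using cats_body[OF assms(1,2)] assms(3) by simp
  from solvesD[OF sol 1 less_imp_le[OF assms(1)] assms(2) 2] show ?thesis
    using assms(6) by (simp add: ix_off(1)[OF assms(2)])
qed

lemma broadcast:
  assumes "t < T" "j < tapes M" "\<bar>d\<bar> \<le> int D"
  shows "\<alpha> (ix t d) (Mv j m) \<longleftrightarrow> \<alpha> (ix t (d + 1)) (Mv j m)"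
proof -
  have 1: "(General, [(0, Mv j m, \<not> b), (1, Mv j m, b)]) \<in> set (templates M)" for b
    using assms(2) by (rule in_Broadcast)
  have 2: "General \<in> cats x p T D t d" using cats_body[OF assms(1,3)] by simp
  note 3 = solvesD[OF sol 1 less_imp_le[OF assms(1)] assms(3) 2]
  from 3[of True] have "\<alpha> (ix t d) (Mv j m) \<longrightarrow> \<alpha> (ix t (d + 1)) (Mv j m)"
    by (simp add: ix_off(1,2)[OF assms(3), simplified])
  moreover from 3[of False] have "\<alpha> (ix t (d + 1)) (Mv j m) \<longrightarrow> \<alpha> (ix t d) (Mv j m)"
    by (auto simp: ix_off(1,2)[OF assms(3), simplified])
  ultimately show ?thesis by blast
qed

lemma broadcast_all:
  assumes "t < T" "j < tapes M" "\<alpha> (ix t 0) (Mv j m)" "\<bar>d\<bar> \<le> int D"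
  shows "\<alpha> (ix t d) (Mv j m)"
proof -
  have "\<alpha> (ix t (int n)) (Mv j m) \<and> \<alpha> (ix t (- int n)) (Mv j m)" if "n \<le> D" for n
    using that
  proof (induction n)
    case 0
    then show ?case using assms by simp
  next
    case (Suc n)
    have e: "int (Suc n) = int n + 1" "- int (Suc n) = - int n - 1" by simp_all
    have "\<alpha> (ix t (- int n - 1)) (Mv j m) \<longleftrightarrow> \<alpha> (ix t (- int n)) (Mv j m)"
      using broadcast[OF assms(1,2), of "- int n - 1" m] Suc.prems by simp
    moreover have "\<alpha> (ix t (int n)) (Mv j m) \<longleftrightarrow> \<alpha> (ix t (int n + 1)) (Mv j m)"
      using broadcast[OF assms(1,2), of "int n" m] Suc.prems by simp
    ultimately show ?case unfolding e using Suc by simp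
  qed
  from this[of "nat \<bar>d\<bar>"] show ?thesis using assms(4) by (cases "0 \<le> d") simp_all
qed

lemma shift_clause:
  assumes "t < T" "j < tapes M" "s < symbols M" "\<bar>d\<bar> \<le> int D" "\<alpha> (ix t d) (Mv j m)" "\<alpha> (ix t d) (Wr j s)"
  shows "\<alpha> (ix (Suc t) (d - disp m)) (Sy j s)"
proof -
  have "(General, [(0, Mv j m, False), (0, Wr j s, False), (target m, Sy j s, True)]) \<in> set (templates M)"
    using assms(2,3) by (rule in_Shift)
  moreover have "General \<in> cats x p T D t d" using cats_body[OF assms(1,4)] by simp
  ultimately show ?thesis
    using solvesD[OF sol _ less_imp_le[OF assms(1)] assms(4), of General "[(0, Mv j m, False), (0, Wr j s, False), (target m, Sy j s, True)]"]
      assms(5,6) by (simp add: ix_off(1,3)[OF assms(4)])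
qed

lemma transition:
  assumes "t < T" "\<alpha> (ix t 0) (St (xu.st u t))" "\<forall>j<tapes M. \<alpha> (ix t 0) (Sy j (xu.rel u t j 0))"
  shows "\<alpha> (ix (Suc t) 0) (St (xu.st u (Suc t)))"
    "j < tapes M \<Longrightarrow> \<alpha> (ix t 0) (Wr j (xu.written u t j))"
    "j < tapes M \<Longrightarrow> \<alpha> (ix t 0) (Mv j (xu.moved u t j))"
proof -
  let ?z = "delta M (xu.st u t) (xu.scanned u t)" and ?L = "scan_lits (xu.st u t) (xu.scanned u t)"
  have len: "length (snd ?z) = tapes M" using xu.wf_conf[where u = u and t = t] xu.scanned[where u = u and t = t] by (intro xu.delta_valid(2)) simp_all
  have eff: "\<alpha> (ix t 0 + off e) a = s" if l: "(e, a, s) \<in> set (effects ?z)" for e a s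
  proof -
    have "(Transition, ?L @ [(e, a, s)]) \<in> set (templates M)"
      using xu.wf_conf[where u = u and t = t] xu.scanned[where u = u and t = t] l by (intro in_Transition) simp_all
    moreover have "Transition \<in> cats x p T D t 0" using cats_body[OF assms(1), of 0] by simp
    ultimately have "\<exists>(e, a, s) \<in> set (?L @ [(e, a, s)]). \<alpha> (ix t 0 + off e) a = s"
      using solvesD[OF sol, of Transition "?L @ [(e, a, s)]" t 0] assms(1) by simp
    then obtain e' a' s' where z: "(e', a', s') \<in> set (?L @ [(e, a, s)])" "\<alpha> (ix t 0 + off e') a' = s'"
      by blast
    have "(e', a', s') \<notin> set ?L"
    proof
      assume "(e', a', s') \<in> set ?L"
      then consider "(e', a', s') = (0, St (xu.st u t), False)"
        | j where "j < tapes M" "(e', a', s') = (0, Sy j (xu.scanned u t ! j), False)"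
        unfolding scan_lits_def using xu.scanned(1)[where u = u and t = t] by auto
      then show False
      proof cases
        case 1
        then show False using z(2) assms(2) by (simp add: off_def)
      next
        case 2
        then show False using z(2) assms(3) xu.scanned_rel[OF 2(1), where u = u and t = t] by (simp add: off_def)
      qed
    qed
    then have "(e', a', s') = (e, a, s)" using z(1) by simp
    then show ?thesis using z(2) by simp
  qed
  show "\<alpha> (ix (Suc t) 0) (St (xu.st u (Suc t)))"
    using eff[of 3 "St (fst ?z)" True] ix_off(4)[of 0 t] by (simp add: effects_def xu.st_Suc)
  assume j: "j < tapes M"
  show "\<alpha> (ix t 0) (Wr j (xu.written u t j))"
    using eff[of 0 "Wr j (fst (snd ?z ! j))" True] ix_off(1)[of 0 t] j len
    by (simp add: effects_def xu.written_def)
  show "\<alpha> (ix t 0) (Mv j (xu.moved u t j))"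
    using eff[of 0 "Mv j (snd (snd ?z ! j))" True] ix_off(1)[of 0 t] j len
    by (simp add: effects_def xu.moved_def)
qed

lemma initial:
  assumes "j < tapes M" "s < symbols M" "\<bar>d\<bar> \<le> int D" "Initial j s \<in> initial_cats x p d"
  shows "\<alpha> (ix 0 d) (Sy j s)"
proof -
  have "(Initial j s, [(0, Sy j s, True)]) \<in> set (templates M)"
    using assms(1,2) by (rule in_Initial)
  from solvesD[OF sol this _ assms(3) cats_initial[OF assms(3,4)]] show ?thesis
    by (simp add: ix_off(1)[OF assms(3)])
qed

lemma start: "\<alpha> (ix 0 0) (St 0)"
proof -
  have 1: "(Start, [(0, St 0, True)]) \<in> set (templates M)" by (rule in_Start)
  have 2: "\<bar>0\<bar> \<le> int D" by simp
  have 3: "Start \<in> initial_cats x p 0" by (simp add: initial_cats_def)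
  from solvesD[OF sol 1 _ 2 cats_initial[OF 2 3]] show ?thesis by (simp add: ix_off(1)[OF 2])
qed

lemma guess:
  assumes "d < p"
  shows "\<alpha> (ix 0 (int d)) (Sy 2 0) \<or> \<alpha> (ix 0 (int d)) (Sy 2 1) \<or> \<alpha> (ix 0 (int d)) (Sy 2 2)"
    "\<alpha> (ix 0 (int d)) (Sy 2 0) \<Longrightarrow> \<alpha> (ix 0 (int d + 1)) (Sy 2 0)"
proof -
  have d: "\<bar>int d\<bar> \<le> int D" using assms D by simp
  have ct: "Guess \<in> cats x p T D 0 (int d)" using assms by (intro cats_initial[OF d]) (simp add: initial_cats_def)
  have "(Guess, [(0, Sy 2 0, True), (0, Sy 2 1, True), (0, Sy 2 2, True)]) \<in> set (templates M)"
    by (rule in_Guess)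
  from solvesD[OF sol this _ d ct]
  show "\<alpha> (ix 0 (int d)) (Sy 2 0) \<or> \<alpha> (ix 0 (int d)) (Sy 2 1) \<or> \<alpha> (ix 0 (int d)) (Sy 2 2)"
    using ix_off(1)[OF d, of 0] by simp
  have "(Guess, [(0, Sy 2 0, False), (1, Sy 2 0, True)]) \<in> set (templates M)"
    by (rule in_Guess)
  from solvesD[OF sol this _ d ct]
  show "\<alpha> (ix 0 (int d)) (Sy 2 0) \<Longrightarrow> \<alpha> (ix 0 (int d + 1)) (Sy 2 0)"
    using ix_off(1,2)[OF d, of 0] by simp
qed

text \<open>A solution may allow several symbols in one cell of the certificate tape, so a word has
  to be chosen: it ends at the first cell that may be blank, and a cell that may hold
  \<open>2\<close> is read as \<open>True\<close>. The alternative \<open>b = p\<close> makes the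
  minimum exist.\<close>

definition certificate :: word where
  "certificate = (let b = (LEAST b. b = p \<or> \<alpha> (ix 0 (int b)) (Sy 2 0)) in
    map (\<lambda>d. \<alpha> (ix 0 (int d)) (Sy 2 2)) [0..<b])"

text \<open>Before the end of the word one of the bits is allowed by \<open>Guess\<close>; from
  there up to \<open>p\<close> blanks propagate; outside the first \<open>p\<close> cells
  \<open>Initial\<close> prescribes blanks.\<close>

lemma certificate:
  shows "length certificate \<le> p"
    and "\<bar>d\<bar> \<le> int D \<Longrightarrow> \<alpha> (ix 0 d) (Sy 2 (word_tape certificate d))"
proof -
  define b where "b = (LEAST b. b = p \<or> \<alpha> (ix 0 (int b)) (Sy 2 0))"
  have b: "b = p \<or> \<alpha> (ix 0 (int b)) (Sy 2 0)"
    unfolding b_def by (rule LeastI[of _ p]) simp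
  have "b \<le> p" unfolding b_def by (rule Least_le) simp
  have less: "i \<noteq> p \<and> \<not> \<alpha> (ix 0 (int i)) (Sy 2 0)" if "i < b" for i
    using not_less_Least that unfolding b_def by blast
  have cert: "certificate = map (\<lambda>d. \<alpha> (ix 0 (int d)) (Sy 2 2)) [0..<b]"
    unfolding certificate_def Let_def b_def ..
  show "length certificate \<le> p" using \<open>b \<le> p\<close> by (simp add: cert)
  have sym: "0 < symbols M" using valid by (simp add: valid_tm_def)
  assume d: "\<bar>d\<bar> \<le> int D"
  consider "0 \<le> d" "nat d < b" | "0 \<le> d" "b \<le> nat d" "nat d < p" | "d < 0 \<or> p \<le> nat d" by linarith
  then show "\<alpha> (ix 0 d) (Sy 2 (word_tape certificate d))"
  proof cases
    case 1
    have "word_tape certificate d = (if \<alpha> (ix 0 d) (Sy 2 2) then 2 else 1)"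
      using 1 by (simp add: word_tape_def cert)
    moreover have "\<alpha> (ix 0 d) (Sy 2 1) \<or> \<alpha> (ix 0 d) (Sy 2 2)"
      using guess(1)[of "nat d"] less[OF 1(2)] 1 \<open>b \<le> p\<close> by simp
    ultimately show ?thesis by auto
  next
    case 2
    have "\<alpha> (ix 0 (int i)) (Sy 2 0)" if "b \<le> i" "i < p" for i
      using that
    proof (induction i rule: dec_induct)
      case base
      then show ?case using b by simp
    next
      case (step i)
      then show ?case using guess(2)[of i] by (simp add: add.commute)
    qed
    from this[OF 2(2,3)] have "\<alpha> (ix 0 d) (Sy 2 0)" using 2(1) by simp
    moreover have "word_tape certificate d = 0" using 2 by (simp add: word_tape_def cert)
    ultimately show ?thesis by simp
  next
    case 3
    then have "word_tape certificate d = 0" using \<open>b \<le> p\<close> by (auto simp: word_tape_def cert)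
    moreover have "\<alpha> (ix 0 d) (Sy 2 0)"
      using 3 by (intro initial[OF tapes sym d]) (auto simp: initial_cats_def)
    ultimately show ?thesis by simp
  qed
qed

text \<open>Only what the run makes true is asserted. The range \<open>D - t\<close> shrinks, since
  a cell of the next row is determined by a cell at distance at most one in the row above, which
  must itself be determined.\<close>

lemma row:
  assumes "t \<le> T"
  shows "\<alpha> (ix t 0) (St (xu.st certificate t)) \<and> (\<forall>j<tapes M. \<forall>d. \<bar>d\<bar> \<le> int D - int t \<longrightarrow>
    \<alpha> (ix t d) (Sy j (xu.rel certificate t j d)))"
  using assms
proof (induction t)
  case 0
  have "\<alpha> (ix 0 d) (Sy j (xu.rel certificate 0 j d))" if j: "j < tapes M" and d: "\<bar>d\<bar> \<le> int D" for j d
  proof (cases "j = 2")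
    case True
    then show ?thesis using certificate(2)[OF d] xu.rel_0[OF j] by (simp add: numeral_2_eq_2)
  next
    case False
    have "Initial j (xu.rel certificate 0 j d) \<in> initial_cats x p d"
      using False unfolding xu.rel_0[OF j] by (auto simp: initial_cats_def word_tape_def)
    then show ?thesis by (rule initial[OF j xu.rel_less(1)[OF j] d])
  qed
  then show ?case using start xu.st_0 by simp
next
  case (Suc t)
  let ?u = certificate
  have t: "t < T" using Suc.prems by simp
  have IH: "\<alpha> (ix t 0) (St (xu.st ?u t))"
    "\<And>j d. j < tapes M \<Longrightarrow> \<bar>d\<bar> \<le> int D - int t \<Longrightarrow> \<alpha> (ix t d) (Sy j (xu.rel ?u t j d))"
    using Suc by auto
  have "\<forall>j<tapes M. \<alpha> (ix t 0) (Sy j (xu.rel ?u t j 0))"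
    using IH(2)[of _ 0] t D by simp
  note tr = transition[OF t IH(1) this]
  have "\<alpha> (ix (Suc t) d) (Sy j (xu.rel ?u (Suc t) j d))"
    if j: "j < tapes M" and d: "\<bar>d\<bar> \<le> int D - int (Suc t)" for j d
  proof -
    define m where "m = xu.moved ?u t j"
    define d' where "d' = d + disp m"
    have d': "\<bar>d'\<bar> \<le> int D - int t" using d unfolding d'_def by (cases m; simp)
    then have dD: "\<bar>d'\<bar> \<le> int D" by simp
    have mv: "\<alpha> (ix t d') (Mv j m)" using broadcast_all[OF t j tr(3)[OF j] dD] by (simp add: m_def)
    have wr: "\<alpha> (ix t d') (Wr j (xu.relw ?u t j d'))"
    proof (cases "d' = 0")
      case True
      then show ?thesis using tr(2)[OF j] by (simp add: xu.relw_def)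
    next
      case False
      then show ?thesis
        using keep[OF t dD False j xu.rel_less(1)[OF j] IH(2)[OF j d']] by (simp add: xu.relw_def)
    qed
    have "\<alpha> (ix (Suc t) (d' - disp m)) (Sy j (xu.relw ?u t j d'))"
      by (rule shift_clause[OF t j xu.rel_less(2)[OF j] dD mv wr])
    then show ?thesis using xu.rel_Suc[OF j, where u = ?u and t = t and d = d'] by (simp add: d'_def m_def)
  qed
  then show ?case using tr(1) by blast
qed

lemma certificate_accepted: "xu.content certificate T 0 0 \<noteq> 1"
proof
  let ?u = certificate
  assume 1: "xu.content ?u T 0 0 = 1"
  \<comment> \<open>The displacement of output cell \<open>0\<close> from the head. It is at most
    \<open>T\<close> in absolute value, hence within the range \<open>D - T\<close> of the last
    row.\<close>
  define d where "d = - xu.head ?u T 0"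
  have 0: "0 < tapes M" using tapes by simp
  have "\<bar>d\<bar> \<le> int D - int T" using xu.head_bound[OF 0, where u = ?u and t = T] D by (simp add: d_def)
  moreover have "xu.rel ?u T 0 d = 1" using 1 by (simp add: xu.rel_def d_def)
  ultimately have *: "\<alpha> (ix T d) (Sy 0 1)" "\<bar>d\<bar> \<le> int D" using row[OF order_refl] 0 by force+
  have "(Final, [(0, Sy 0 1, False)]) \<in> set (templates M)" by (rule in_Final)
  from solvesD[OF sol this order_refl *(2)] show False
    using * ix_off(1)[OF *(2), of T] by (simp add: cats_def)
qed

end

theorem solvable_iff:
  assumes "\<And>u. length u \<le> p \<Longrightarrow> outputs_within M [x, u] [V u] T"
  shows "(\<exists>\<alpha>. solves \<alpha>) \<longleftrightarrow> (\<exists>u. length u \<le> p \<and> V u)"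
proof
  assume "\<exists>\<alpha>. solves \<alpha>"
  then obtain \<alpha> where \<alpha>: "solves \<alpha>" by blast
  let ?u = "certificate \<alpha>"
  have "xu.content ?u T 0 = word_tape [V ?u]"
    using assms[OF certificate(1)[OF \<alpha>]] by (rule xu.outputs_content)
  then have "V ?u" using certificate_accepted[OF \<alpha>] by (simp add: word_tape_def split: if_splits)
  then show "\<exists>u. length u \<le> p \<and> V u" using certificate(1)[OF \<alpha>] by blast
next
  assume "\<exists>u. length u \<le> p \<and> V u"
  then obtain u where u: "length u \<le> p" "V u" by blast
  have "xu.content u T 0 = word_tape [True]"
    using xu.outputs_content[OF assms[OF u(1)]] u(2) by simp
  then show "\<exists>\<alpha>. solves \<alpha>" using solves_assignment[OF u(1)] by blast
qed

end

section \<open>Emitting the numbers\<close>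

abbreviation bits_value :: "bool list \<Rightarrow> nat" where
  "bits_value \<equiv> horner_sum of_bool 2"

lemma binary_0 [simp]: "binary 0 = []"
  by (subst binary.simps) simp

lemma binary_pos: "m > 0 \<Longrightarrow> binary m = odd m # binary (m div 2)"
  by (subst binary.simps) simp

lemma binary_Nil_iff [simp]: "binary m = [] \<longleftrightarrow> m = 0"
  by (subst binary.simps) simp

lemma last_binary: "m > 0 \<Longrightarrow> last (binary m)"
proof (induction m rule: binary.induct)
  case (1 m)
  show ?case
  proof (cases "m = 1")
    case True
    then show ?thesis by (simp add: binary_pos)
  next
    case False
    then have "m div 2 > 0" using 1(2) by auto
    then show ?thesis using 1 by (simp add: binary_pos[of m])
  qed
qed

lemma bits_value_pos: "bs \<noteq> [] \<Longrightarrow> last bs \<Longrightarrow> bits_value bs > 0"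
  by (induction bs) (auto split: if_splits)

lemma binary_bits_value: "bs = [] \<or> last bs \<Longrightarrow> binary (bits_value bs) = bs"
proof (induction bs)
  case (Cons b bs)
  have "bits_value (b # bs) > 0" using bits_value_pos[of "b # bs"] Cons.prems by simp
  moreover have "odd (bits_value (b # bs)) = b" by simp
  moreover have "bits_value (b # bs) div 2 = bits_value bs" by simp
  moreover have "binary (bits_value bs) = bs" using Cons by (cases bs) auto
  ultimately show ?case using binary_pos[of "bits_value (b # bs)"] by (simp del: horner_sum_simps)
qed simp

lemma bits_value_zeros [simp]: "bits_value (replicate n False) = 0"
  by (induction n) simp_all

lemma length_binary_le: "m < 2 ^ k \<Longrightarrow> length (binary m) \<le> k"
proof (induction k arbitrary: m)
  case (Suc k)
  then have "m div 2 < 2 ^ k" by simp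
  from Suc.IH[OF this] show ?case by (cases "m = 0") (simp_all add: binary_pos[of m])
qed simp

definition enc :: "bool list \<Rightarrow> word" where
  "enc bs = concat (map (\<lambda>b. [True, b]) bs)"

lemma enc_append [simp]: "enc (xs @ ys) = enc xs @ enc ys"
  by (simp add: enc_def)

lemma enc_Nil [simp]: "enc [] = []" and enc_Cons [simp]: "enc (b # bs) = True # b # enc bs"
  by (simp_all add: enc_def)

lemma encode_nat_enc: "encode_nat m = enc (binary m) @ [False]"
  by (simp add: encode_nat_def enc_def)

lemma length_enc [simp]: "length (enc bs) = 2 * length bs"
  by (induction bs) simp_all

lemma enc_concat_replicate: "enc (concat (replicate n bs)) = concat (replicate n (enc bs))"
  by (induction n) simp_all

lemma replicate_mult: "replicate (m * n) x = concat (replicate m (replicate n x))"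
  by (induction m) (simp_all add: replicate_add)

lemma encode_nat_bits: "last bs \<Longrightarrow> bs \<noteq> [] \<Longrightarrow> encode_nat (bits_value bs) = enc bs @ [False]"
  by (simp add: encode_nat_enc binary_bits_value)

text \<open>
  Counter \<open>2\<close> holds the index \<open>r\<close>, counter \<open>4\<close> holds \<open>D\<close>, and \<open>3\<close> and \<open>5\<close> are scratch counters. The command emits the
  double of \<open>2 ^ (z * r) * (l + 2 ^ (z * (2 * D + 3)) * h)\<close>.
\<close>

definition number :: "nat \<Rightarrow> nat \<Rightarrow> nat \<Rightarrow> com" where
  "number z l h = emits [True, False] ;; For 2 3 (emits (enc (replicate z False))) ;;
    (if h = 0 then emits (enc (binary l))
     else emits (enc (binary l @ replicate (3 * z - length (binary l)) False)) ;;
       For 4 5 (emits (enc (replicate (2 * z) False))) ;; emits (enc (binary h))) ;;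
    emits [False]"

definition number_time :: "nat \<Rightarrow> nat \<Rightarrow> nat \<Rightarrow> nat \<Rightarrow> nat" where
  "number_time z l h N = 3 + (N * (2 * z + 9) + 2) +
    (6 * z + 2 * length (binary l) + (N * (4 * z + 9) + 2) + 2 * length (binary h))"

text \<open>The bound on \<open>l\<close> allows padding it to \<open>3 * z\<close> bits, and
  \<open>2 * z\<close> bits for each unit of \<open>D\<close> complete the distance
  \<open>z * (2 * D + 3)\<close> to \<open>h\<close>. Since \<open>0 < l + h\<close>, the last digit
  written is a one, as the encoding requires.\<close>

lemma runs_number:
  assumes e: "e 3 = 0" "e 5 = 0" "e 2 \<le> N" "e 4 \<le> N" and l: "l < 2 ^ (3 * z)" and "0 < l + h"
  shows "runs X (number z l h) (e, y) (number_time z l h N)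
    (e, y @ encode_nat (2 * (2 ^ (z * e 2) * (l + 2 ^ (z * (2 * e 4 + 3)) * h))))"
proof -
  define bs where "bs = (if h = 0 then binary l
    else binary l @ replicate (3 * z - length (binary l)) False @ replicate (e 4 * (2 * z)) False @ binary h)"
  define L where "L = False # replicate (e 2 * z) False @ bs"
  have len: "length (binary l) \<le> 3 * z" using l by (rule length_binary_le)
  have val: "bits_value bs = l + 2 ^ (z * (2 * e 4 + 3)) * h"
  proof (cases "h = 0")
    case False
    have "length (binary l) + (3 * z - length (binary l)) + e 4 * (2 * z) = z * (2 * e 4 + 3)"
      using len by (simp add: algebra_simps)
    then show ?thesis using False
      by (simp add: bs_def horner_sum_append horner_sum_binary flip: power_add mult.assoc add.assoc)
  qed (simp add: bs_def horner_sum_binary)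
  have "bs \<noteq> []" "last bs" using assms(6) last_binary[of l] last_binary[of h] by (auto simp: bs_def)
  then have "encode_nat (bits_value L) = enc L @ [False]" unfolding L_def by (intro encode_nat_bits) simp_all
  moreover have "bits_value L = 2 * (2 ^ (z * e 2) * (l + 2 ^ (z * (2 * e 4 + 3)) * h))"
    by (simp add: L_def horner_sum_append val mult.commute)
  ultimately have out: "encode_nat (2 * (2 ^ (z * e 2) * (l + 2 ^ (z * (2 * e 4 + 3)) * h))) = enc L @ [False]"
    by simp
  let ?y1 = "(y @ [True, False]) @ concat (replicate (e 2) (enc (replicate z False)))"
  have 1: "runs X (For 2 3 (emits (enc (replicate z False)))) (e, y @ [True, False]) (N * (2 * z + 9) + 2) (e, ?y1)"
    by (rule runs_conv[OF runs_For_emits]) (use e in simp_all)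
  have 2: "runs X (if h = 0 then emits (enc (binary l))
     else emits (enc (binary l @ replicate (3 * z - length (binary l)) False)) ;;
       For 4 5 (emits (enc (replicate (2 * z) False))) ;; emits (enc (binary h))) (e, ?y1)
     (6 * z + 2 * length (binary l) + (N * (4 * z + 9) + 2) + 2 * length (binary h)) (e, ?y1 @ enc bs)"
  proof (cases "h = 0")
    case True
    then show ?thesis by (auto simp: bs_def intro!: runs_conv[OF runs_emits])
  next
    case False
    have time: "2 * (3 * z - length (binary l)) + e 4 * (4 * z + 9) \<le> 6 * z + N * (4 * z + 9)"
      using mult_le_mono1[OF e(4), of "4 * z + 9"] by linarith
    show ?thesis
      unfolding if_not_P[OF False]
      by (rule runs_conv[OF runs_Seq[OF runs_emits runs_Seq[OF runs_For_emits runs_emits]]])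
        (use False e len in \<open>simp_all add: bs_def enc_concat_replicate replicate_mult[of "e 4"]\<close>, use time in linarith)
  qed
  show ?thesis
    unfolding number_def
    by (rule runs_conv[OF runs_Seq[OF runs_emits runs_Seq[OF 1 runs_Seq[OF 2 runs_emits]]]])
      (simp_all add: out L_def enc_concat_replicate replicate_mult[of "e 2"] number_time_def)
qed

lemma pb_number_time: "pb (number_time z l h)"
  unfolding number_time_def by (intro pb_add pb_mult pb_const pb_id)

lemma digit_sum_less:
  fixes B :: nat
  assumes B: "1 < B" and S: "finite S" "S \<subseteq> {..<n}"
  shows "(\<Sum>p\<in>S. B ^ p) < B ^ n"
proof -
  have "(\<Sum>p\<in>S. B ^ p) \<le> (\<Sum>p<n. B ^ p)" using S by (intro sum_mono2) auto
  also have "\<dots> < B ^ n"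
  proof (induction n)
    case (Suc n)
    have "2 * B ^ n \<le> B * B ^ n" using B by (intro mult_le_mono1) simp
    then show ?case using Suc unfolding sum.lessThan_Suc power_Suc by linarith
  qed simp
  finally show ?thesis .
qed

lemma div_mod_block: "y < k \<Longrightarrow> (x * k + y) div k = x" "y < k \<Longrightarrow> (x * k + y) mod k = y" for x y k :: nat
  by simp_all

text \<open>
  The emitter of the numbers for a list of clause templates that are labelled by their category; a placement is active iff
  its category is among those assigned to the current index.
\<close>

locale emitter =
  fixes Ct :: "('c \<times> (nat \<times> nat \<times> bool) list) list" and na w :: nat
  assumes wf: "(ct, ls) \<in> set Ct \<Longrightarrow> distinct ls \<and> ls \<noteq> [] \<and> fst (ls ! 0) = 0 \<and> (\<forall>(d, a, s) \<in> set ls. d < 5 \<and> a < na)"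
    and nonempty: "Ct \<noteq> []"
    and w: "1 < w" "(ct, ls) \<in> set Ct \<Longrightarrow> 2 * (length ls + 1) < 2 ^ w"
begin

definition Cs :: "(nat \<times> nat \<times> bool) list list" where
  "Cs = map snd Ct"

abbreviation "nc \<equiv> length Cs"
abbreviation "K \<equiv> nc + na"
abbreviation "B \<equiv> (2 :: nat) ^ w"
abbreviation "z \<equiv> w * K"

definition item_set :: "'c set \<Rightarrow> item set" where
  "item_set A = {Lit 0 a s |a s. a < na} \<union>
    {Slack 0 c k |c k. c < nc \<and> k < length (Cs ! c) \<and> \<not> (k = 0 \<and> fst (Ct ! c) \<in> A)} \<union>
    {Extra 0 c |c. c < nc \<and> fst (Ct ! c) \<notin> A}"

text \<open>Any enumeration will do: it is part of the program text and is not computed from the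
  input.\<close>

definition items_at :: "'c set \<Rightarrow> item list" where
  "items_at A = (SOME is. distinct is \<and> set is = item_set A)"

text \<open>Offset codes take the place of column numbers: they do not involve the row length, so
  the shapes of the items depend on the templates only.\<close>

fun shape :: "item \<Rightarrow> (nat \<times> nat) set" where
  "shape (Lit r a s) = insert (0, nc + a) {(d, c) |d c. c < nc \<and> (d, a, s) \<in> set (Cs ! c)}"
| "shape (Slack r c k) = {(fst (Cs ! c ! k), c)}"
| "shape (Extra r c) = {(0, c)}"
| "shape Falsum = {}"

text \<open>With \<open>P = 2 * D + 3\<close>, the column \<open>r + P + 1 - offset d\<close> is
  \<open>r + (4 - d)\<close> for \<open>d = 2, 3, 4\<close> and \<open>r + P + (1 - d)\<close> for
  \<open>d = 0, 1\<close>. The digits thus form two groups of constant size, one of them raised by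
  \<open>P\<close> columns.\<close>

definition low :: "item \<Rightarrow> nat" where
  "low i = (\<Sum>(d, j)\<in>{x \<in> shape i. 2 \<le> fst x}. B ^ ((4 - d) * K + j))"

definition high :: "item \<Rightarrow> nat" where
  "high i = (\<Sum>(d, j)\<in>{x \<in> shape i. fst x < 2}. B ^ ((1 - d) * K + j))"

definition item_weight :: "nat \<Rightarrow> nat \<Rightarrow> item \<Rightarrow> nat" where
  "item_weight D r i = 2 ^ (z * r) * (low i + 2 ^ (z * (2 * D + 3)) * high i)"

definition output_at :: "nat \<Rightarrow> nat \<Rightarrow> 'c set \<Rightarrow> word" where
  "output_at D r A = concat (map (\<lambda>i. encode_nat (2 * item_weight D r i)) (items_at A))"

definition block :: "'c set \<Rightarrow> com" where
  "block A = foldr (\<lambda>i c. number z (low i) (high i) ;; c) (items_at A) (Inc 2)"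

definition block_time :: "'c set \<Rightarrow> nat \<Rightarrow> nat" where
  "block_time A N = (\<Sum>i\<leftarrow>items_at A. number_time z (low i) (high i) N) + 1"

lemma pb_block_time: "pb (block_time A)"
proof -
  have "pb (\<lambda>N. \<Sum>i\<leftarrow>is. number_time z (low i) (high i) N)" for "is"
    by (induction "is") (auto intro: pb_const pb_add pb_number_time)
  then show ?thesis unfolding block_time_def by (intro pb_add pb_const)
qed

lemma Cs_wf:
  assumes "c < nc"
  shows "distinct (Cs ! c)" "Cs ! c \<noteq> []" "fst (Cs ! c ! 0) = 0"
    "(d, a, s) \<in> set (Cs ! c) \<Longrightarrow> d < 5 \<and> a < na" "2 * (length (Cs ! c) + 1) < B"
proof -
  obtain ct ls where Ct: "Ct ! c = (ct, ls)" by (cases "Ct ! c")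
  then have "(ct, ls) \<in> set Ct" "Cs ! c = ls" using assms nth_mem[of c Ct] by (simp_all add: Cs_def)
  then show "distinct (Cs ! c)" "Cs ! c \<noteq> []" "fst (Cs ! c ! 0) = 0"
    "(d, a, s) \<in> set (Cs ! c) \<Longrightarrow> d < 5 \<and> a < na" "2 * (length (Cs ! c) + 1) < B"
    using wf[of ct ls] w(2)[of ct ls] by auto
qed

lemma finite_item_set: "finite (item_set A)"
proof -
  have "item_set A \<subseteq> (\<lambda>(a, s). Lit 0 a s) ` ({..<na} \<times> UNIV) \<union>
      (\<Union>c<nc. Slack 0 c ` {..<length (Cs ! c)}) \<union> Extra 0 ` {..<nc}"
    unfolding item_set_def by (auto simp: image_iff)
  then show ?thesis by (rule finite_subset) auto
qed

lemma distinct_items_at: "distinct (items_at A)" and set_items_at: "set (items_at A) = item_set A"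
proof -
  have "\<exists>is. distinct is \<and> set is = item_set A"
    using finite_distinct_list[OF finite_item_set] by blast
  from someI_ex[OF this] show "distinct (items_at A)" "set (items_at A) = item_set A"
    unfolding items_at_def by blast+
qed

lemma items_at_cases:
  assumes "i \<in> set (items_at A)"
  obtains a s where "i = Lit 0 a s" "a < na"
  | c k where "i = Slack 0 c k" "c < nc" "k < length (Cs ! c)" "\<not> (k = 0 \<and> fst (Ct ! c) \<in> A)"
  | c where "i = Extra 0 c" "c < nc" "fst (Ct ! c) \<notin> A"
  using assms unfolding set_items_at item_set_def by blast

lemma shape_wf:
  assumes "i \<in> set (items_at A)"
  shows "finite (shape i)" "shape i \<noteq> {}" "(d, j) \<in> shape i \<Longrightarrow> d < 5 \<and> j < K"
proof -
  have fin: "finite {(d, c) |d c. c < nc \<and> (d, a, s) \<in> set (Cs ! c)}" for a s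
    by (rule finite_subset[of _ "(\<Union>c<nc. (\<lambda>x. (fst x, c)) ` set (Cs ! c))"]) force+
  from assms show "finite (shape i)" by (rule items_at_cases) (use fin in simp_all)
  from assms show "shape i \<noteq> {}" by (rule items_at_cases) simp_all
  assume d: "(d, j) \<in> shape i"
  from assms show "d < 5 \<and> j < K"
  proof (rule items_at_cases)
    fix a s assume "i = Lit 0 a s" "a < na"
    then show ?thesis using d Cs_wf(4) by auto
  next
    fix c k assume i: "i = Slack 0 c k" "c < nc" "k < length (Cs ! c)"
    obtain d' a s where "Cs ! c ! k = (d', a, s)" by (cases "Cs ! c ! k")
    moreover from this have "d' < 5" using Cs_wf(4)[OF i(2)] nth_mem[OF i(3)] by simp
    ultimately show ?thesis using d i by simp
  next
    fix c assume "i = Extra 0 c" "c < nc"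
    then show ?thesis using d by simp
  qed
qed

lemma B_gt_1: "1 < B"
  using one_less_power[of "2 :: nat" w] w(1) by simp

lemma low_less:
  assumes "i \<in> set (items_at A)"
  shows "low i < 2 ^ (3 * z)" and "0 < low i + high i"
proof -
  let ?S = "{x \<in> shape i. 2 \<le> fst x}" and ?f = "\<lambda>(d, j). (4 - d) * K + j"
  note wf = shape_wf[OF assms]
  have inj: "inj_on ?f ?S"
  proof (rule inj_onI)
    fix x y assume xy: "x \<in> ?S" "y \<in> ?S" "?f x = ?f y"
    obtain d j d' j' where x: "x = (d, j)" "y = (d', j')" by (cases x, cases y)
    have j: "j < K" "j' < K" "2 \<le> d" "d < 5" "2 \<le> d'" "d' < 5" using xy wf(3) x by auto
    have "(4 - d) = ((4 - d) * K + j) div K" "(4 - d') = ((4 - d') * K + j') div K"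
      using div_mod_block(1)[OF j(1)] div_mod_block(1)[OF j(2)] by metis+
    moreover have "j = ((4 - d) * K + j) mod K" "j' = ((4 - d') * K + j') mod K"
      using div_mod_block(2)[OF j(1)] div_mod_block(2)[OF j(2)] by metis+
    moreover have "(4 - d) * K + j = (4 - d') * K + j'" using xy(3) x by simp
    ultimately have "4 - d = 4 - d'" "j = j'" by metis+
    then show "x = y" using j x by simp
  qed
  have "?f ` ?S \<subseteq> {..<3 * K}"
  proof
    fix p assume "p \<in> ?f ` ?S"
    then obtain d j where "(d, j) \<in> shape i" "2 \<le> d" "p = (4 - d) * K + j" by auto
    moreover have "(4 - d) * K \<le> 2 * K" using \<open>2 \<le> d\<close> by (intro mult_le_mono1) simp
    ultimately show "p \<in> {..<3 * K}" using wf(3)[of d j] by simp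
  qed
  then have "(\<Sum>p\<in>?f ` ?S. B ^ p) < B ^ (3 * K)" using wf(1) by (intro digit_sum_less[OF B_gt_1]) simp_all
  moreover have "(\<Sum>p\<in>?f ` ?S. B ^ p) = low i"
    unfolding low_def by (subst sum.reindex[OF inj]) (simp add: comp_def case_prod_unfold)
  ultimately show "low i < 2 ^ (3 * z)" by (simp add: power_mult[symmetric] mult.left_commute mult.commute)
  obtain d j where d: "(d, j) \<in> shape i" using wf(2) by (metis equals0I surj_pair)
  show "0 < low i + high i"
  proof (cases "2 \<le> d")
    case True
    then have "0 < low i"
      unfolding low_def using d wf(1) by (intro sum_pos2[of _ "(d, j)"]) auto
    then show ?thesis by simp
  next
    case False
    then have "0 < high i"
      unfolding high_def using d wf(1) by (intro sum_pos2[of _ "(d, j)"]) auto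
    then show ?thesis by simp
  qed
qed

lemma runs_block:
  assumes e: "e 3 = 0" "e 5 = 0" "e 2 \<le> N" "e 4 \<le> N"
  shows "runs X (block A) (e, y) (block_time A N) (e(2 := Suc (e 2)), y @ output_at (e 4) (e 2) A)"
proof -
  have "runs X (foldr (\<lambda>i c. number z (low i) (high i) ;; c) is (Inc 2)) (e, y)
      ((\<Sum>i\<leftarrow>is. number_time z (low i) (high i) N) + 1)
      (e(2 := Suc (e 2)), y @ concat (map (\<lambda>i. encode_nat (2 * item_weight (e 4) (e 2) i)) is))"
    if "set is \<subseteq> set (items_at A)" for "is"
    using that
  proof (induction "is" arbitrary: y)
    case Nil
    then show ?case by (auto intro!: runs_conv[OF runs_Inc])
  next
    case (Cons i "is")
    then have i: "i \<in> set (items_at A)" "set is \<subseteq> set (items_at A)" by simp_all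
    have "runs X (number z (low i) (high i)) (e, y) (number_time z (low i) (high i) N)
        (e, y @ encode_nat (2 * item_weight (e 4) (e 2) i))"
      unfolding item_weight_def using e low_less[OF i(1)] by (intro runs_number) simp_all
    from runs_Seq[OF this Cons.IH[OF i(2)]] show ?case
      by (simp add: add.assoc)
  qed
  from this[of "items_at A"] show ?thesis unfolding block_def block_time_def output_at_def by simp
qed

end

section \<open>The emitted numbers as weights of the items\<close>

lemma halves_iff:
  assumes "distinct is"
  shows "(\<exists>I. halves (map (\<lambda>i. 2 * f i) is @ [1]) I) \<longleftrightarrow>
    (\<exists>U \<subseteq> set is. 2 * (\<Sum>i\<in>U. f i) = (\<Sum>i\<in>set is. f i))"
proof -
  let ?ws = "map (\<lambda>i. 2 * f i) is @ [1]" and ?n = "length is"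
  have range: "{1..<length ?ws} = {1..?n}" by auto
  have bij: "bij_betw (\<lambda>k. is ! (k - 1)) {1..?n} (set is)"
  proof -
    have "bij_betw (\<lambda>k. k - 1) {1..?n} {..<?n}"
      by (rule bij_betw_byWitness[where f' = Suc]) auto
    from bij_betw_trans[OF this bij_betw_nth[OF assms refl refl]] show ?thesis by (simp add: comp_def)
  qed
  have sum: "(\<Sum>k\<in>I. ?ws ! (k - 1)) = 2 * (\<Sum>i\<in>(\<lambda>k. is ! (k - 1)) ` I. f i)" if "I \<subseteq> {1..?n}" for I
  proof -
    have "inj_on (\<lambda>k. is ! (k - 1)) I" using bij that by (meson bij_betw_imp_inj_on inj_on_subset)
    then have "2 * (\<Sum>i\<in>(\<lambda>k. is ! (k - 1)) ` I. f i) = (\<Sum>k\<in>I. 2 * f (is ! (k - 1)))"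
      by (simp add: sum.reindex sum_distrib_left)
    also have "\<dots> = (\<Sum>k\<in>I. ?ws ! (k - 1))"
    proof (rule sum.cong[OF refl])
      fix k assume "k \<in> I"
      then have "k - 1 < ?n" using that by fastforce
      then show "2 * f (is ! (k - 1)) = ?ws ! (k - 1)" by (simp add: nth_append)
    qed
    finally show ?thesis by simp
  qed
  have img: "(\<lambda>k. is ! (k - 1)) ` {1..?n} = set is" using bij by (simp add: bij_betw_def)
  have halves: "halves ?ws I \<longleftrightarrow> I \<subseteq> {1..?n} \<and>
      2 * (\<Sum>i\<in>(\<lambda>k. is ! (k - 1)) ` I. f i) = (\<Sum>i\<in>set is. f i)" for I
  proof (cases "I \<subseteq> {1..?n}")
    case True
    show ?thesis unfolding halves_def range sum[OF True] sum[OF order_refl] img using True by simp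
  next
    case False
    then show ?thesis unfolding halves_def range by blast
  qed
  show ?thesis
  proof
    assume "\<exists>I. halves ?ws I"
    then obtain I where "I \<subseteq> {1..?n}"
      and eq: "2 * (\<Sum>i\<in>(\<lambda>k. is ! (k - 1)) ` I. f i) = (\<Sum>i\<in>set is. f i)"
      unfolding halves by blast
    then have "(\<lambda>k. is ! (k - 1)) ` I \<subseteq> set is" unfolding img[symmetric] by (intro image_mono)
    then show "\<exists>U \<subseteq> set is. 2 * (\<Sum>i\<in>U. f i) = (\<Sum>i\<in>set is. f i)"
      using eq by (intro exI[of _ "(\<lambda>k. is ! (k - 1)) ` I"] conjI)
  next
    assume "\<exists>U \<subseteq> set is. 2 * (\<Sum>i\<in>U. f i) = (\<Sum>i\<in>set is. f i)"
    then obtain U where U: "U \<subseteq> (\<lambda>k. is ! (k - 1)) ` {1..?n}" "2 * (\<Sum>i\<in>U. f i) = (\<Sum>i\<in>set is. f i)"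
      unfolding img by blast
    obtain I where "I \<subseteq> {1..?n}" "U = (\<lambda>k. is ! (k - 1)) ` I"
      using subset_imageE[OF U(1)] by blast
    then have "halves ?ws I" unfolding halves using U(2) by simp
    then show "\<exists>I. halves ?ws I" ..
  qed
qed

lemma power_block: "((2 :: nat) ^ w) ^ ((r + u) * k + j) = 2 ^ (w * k * r) * (2 ^ w) ^ (u * k + j)"
proof -
  have "w * ((r + u) * k + j) = w * k * r + w * (u * k + j)" by (simp add: algebra_simps)
  then show ?thesis by (simp only: power_mult[symmetric] power_add[symmetric])
qed

context emitter
begin

fun relabel :: "nat \<Rightarrow> item \<Rightarrow> item" where
  "relabel r (Lit _ a s) = Lit r a s"
| "relabel r (Slack _ c k) = Slack r c k"
| "relabel r (Extra _ c) = Extra r c"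
| "relabel r Falsum = Falsum"

lemma relabel_0: "i \<in> set (items_at A) \<Longrightarrow> relabel 0 (relabel r i) = i"
  by (erule items_at_cases) simp_all

fun index :: "item \<Rightarrow> nat" where
  "index (Lit r a s) = r"
| "index (Slack r c k) = r"
| "index (Extra r c) = r"
| "index Falsum = 0"

lemma index_relabel: "i \<in> set (items_at A) \<Longrightarrow> index (relabel r i) = r \<and> relabel r i \<noteq> Falsum"
  by (erule items_at_cases) simp_all

text \<open>The one number that is not a shifted constant: it has a one in the clause columns of
  every position of the line, where \<open>r + 2 * D + 4\<close> is the column
  \<open>r + P + 1\<close>.\<close>

definition Falsum_weight :: "nat \<Rightarrow> nat \<Rightarrow> nat" where
  "Falsum_weight D R = (\<Sum>r<R. 2 ^ (z * (r + 2 * D + 4)) * (\<Sum>c<nc. B ^ c))"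

definition weights :: "nat \<Rightarrow> 'c set list \<Rightarrow> nat list" where
  "weights D L = concat (map (\<lambda>r. map (\<lambda>i. 2 * item_weight D r i) (items_at (L ! r))) [0..<length L]) @
    [2 * Falsum_weight D (length L), 1]"

definition placement :: "'c set list \<Rightarrow> nat \<Rightarrow> nat \<Rightarrow> bool" where
  "placement L r c \<longleftrightarrow> r < length L \<and> c < nc \<and> fst (Ct ! c) \<in> L ! r"

lemma line_clauses:
  assumes "0 < D"
  shows "line_clauses (2 * D + 3) (length L) na Cs (placement L) B"
proof -
  have "2 < B" using power_strict_increasing[of 1 w "2 :: nat"] w(1) by simp
  show ?thesis
  proof
    show "4 \<le> 2 * D + 3" using assms by simp
    show "2 < B" by fact
  next
    fix c d a s assume "c < nc" "(d, a, s) \<in> set (Cs ! c)"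
    then show "d < 5 \<and> a < na" by (rule Cs_wf(4))
  next
    fix c assume "c < nc"
    then show "distinct (Cs ! c)" "Cs ! c \<noteq> [] \<and> fst (Cs ! c ! 0) = 0" "2 * (length (Cs ! c) + 1) < B"
      using Cs_wf(1,2,3,5) by blast+
  next
    fix r c assume "placement L r c"
    then show "r < length L" by (simp add: placement_def)
  qed
qed

context
  fixes D :: nat and L :: "'c set list" assumes D: "0 < D"
begin

interpretation lc: line_clauses "2 * D + 3" "length L" na Cs "placement L" B
  using D by (rule line_clauses)

text \<open>A position takes \<open>K\<close> digits of \<open>w\<close> bits, so index
  \<open>r\<close> contributes the factor \<open>2 ^ (z * r)\<close>. The sum over the shape is
  split where the offset jumps to the next row.\<close>

lemma weight_relabel:
  assumes "i \<in> set (items_at A)"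
  shows "lc.weight (relabel r i) = item_weight D r i"
proof -
  let ?f = "\<lambda>(d, j). (r + (2 * D + 3) + 1 - lc.offset d) * K + j"
  note wf = shape_wf[OF assms]
  have cols: "lc.cols (relabel r i) = (\<lambda>(d, j). (r + (2 * D + 3) + 1 - lc.offset d, j)) ` shape i"
    using assms
  proof (rule items_at_cases)
    fix a s assume i: "i = Lit 0 a s"
    have "{(f d, c) |d c. Q d c} = (\<lambda>(d, j). (f d, j)) ` {(d, c) |d c. Q d c}" for f :: "nat \<Rightarrow> nat" and Q :: "nat \<Rightarrow> nat \<Rightarrow> bool"
      by force
    moreover have "lc.offset 0 = 0" by (simp add: lc.offset_def)
    ultimately show ?thesis
      unfolding i relabel.simps lc.cols.simps shape.simps image_insert by simp
  next
    fix c k assume i: "i = Slack 0 c k"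
    show ?thesis unfolding i relabel.simps lc.cols.simps shape.simps by simp
  next
    fix c assume i: "i = Extra 0 c"
    show ?thesis unfolding i relabel.simps lc.cols.simps shape.simps by (simp add: lc.offset_def)
  qed
  have pos: "lc.pos (relabel r i) = ?f ` shape i"
    unfolding lc.pos_def cols image_image by (simp add: case_prod_unfold)
  have inj: "inj_on ?f (shape i)"
  proof (rule inj_onI)
    fix x y assume xy: "x \<in> shape i" "y \<in> shape i" "?f x = ?f y"
    obtain d j d' j' where x: "x = (d, j)" "y = (d', j')" by (cases x, cases y)
    have j: "j < K" "j' < K" "d < 5" "d' < 5" using xy wf(3) x by auto
    have eq: "(r + (2 * D + 3) + 1 - lc.offset d) * K + j = (r + (2 * D + 3) + 1 - lc.offset d') * K + j'"
      using xy(3) x by simp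
    have "r + (2 * D + 3) + 1 - lc.offset d = r + (2 * D + 3) + 1 - lc.offset d'"
      using arg_cong[OF eq, of "\<lambda>n. n div K"] div_mod_block(1)[OF j(1)] div_mod_block(1)[OF j(2)] by simp
    moreover have "j = j'"
      using arg_cong[OF eq, of "\<lambda>n. n mod K"] div_mod_block(2)[OF j(1)] div_mod_block(2)[OF j(2)] by simp
    ultimately show "x = y" using lc.pos_offset[OF j(3,4)] x by simp
  qed
  have split: "(\<Sum>x\<in>shape i. g x) = (\<Sum>x\<in>{x \<in> shape i. 2 \<le> fst x}. g x) + (\<Sum>x\<in>{x \<in> shape i. fst x < 2}. g x)"
    for g :: "nat \<times> nat \<Rightarrow> nat"
  proof -
    have "shape i = {x \<in> shape i. 2 \<le> fst x} \<union> {x \<in> shape i. fst x < 2}" by auto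
    moreover have "{x \<in> shape i. 2 \<le> fst x} \<inter> {x \<in> shape i. fst x < 2} = {}" by auto
    ultimately show ?thesis using wf(1) by (metis (no_types, lifting) finite_Un sum.union_disjoint)
  qed
  have "lc.weight (relabel r i) = (\<Sum>x\<in>shape i. B ^ ?f x)"
    unfolding lc.weight_def pos sum.reindex[OF inj] comp_def ..
  also have "\<dots> = (\<Sum>x\<in>{x \<in> shape i. 2 \<le> fst x}. B ^ ?f x) + (\<Sum>x\<in>{x \<in> shape i. fst x < 2}. B ^ ?f x)"
    by (rule split)
  also have "(\<Sum>x\<in>{x \<in> shape i. 2 \<le> fst x}. B ^ ?f x) = 2 ^ (z * r) * low i"
    unfolding low_def sum_distrib_left
  proof (rule sum.cong[OF refl])
    fix x assume "x \<in> {x \<in> shape i. 2 \<le> fst x}"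
    then obtain d j where x: "x = (d, j)" "2 \<le> d" "d < 5" using wf(3) by (cases x) auto
    then have off: "r + (2 * D + 3) + 1 - lc.offset d = r + (4 - d)" by (simp add: lc.offset_def)
    show "B ^ ?f x = 2 ^ (z * r) * (case x of (d, j) \<Rightarrow> B ^ ((4 - d) * K + j))"
      unfolding x prod.case off by (rule power_block)
  qed
  also have "(\<Sum>x\<in>{x \<in> shape i. fst x < 2}. B ^ ?f x) = 2 ^ (z * r) * (2 ^ (z * (2 * D + 3)) * high i)"
    unfolding high_def sum_distrib_left
  proof (rule sum.cong[OF refl])
    fix x assume "x \<in> {x \<in> shape i. fst x < 2}"
    then obtain d j where x: "x = (d, j)" "d < 2" by (cases x) auto
    then have off: "r + (2 * D + 3) + 1 - lc.offset d = r + ((2 * D + 3) + (1 - d))" by (simp add: lc.offset_def)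
    show "B ^ ?f x = 2 ^ (z * r) * (2 ^ (z * (2 * D + 3)) * (case x of (d, j) \<Rightarrow> B ^ ((1 - d) * K + j)))"
      unfolding x prod.case off power_block ..
  qed
  finally show ?thesis unfolding item_weight_def by (simp only: distrib_left)
qed

lemma weight_Falsum: "lc.weight Falsum = Falsum_weight D (length L)"
proof -
  let ?f = "\<lambda>(r, c). (r + (2 * D + 3) + 1) * K + c" and ?S = "{..<length L} \<times> {..<nc}"
  have pos: "lc.pos Falsum = ?f ` ?S"
  proof -
    have "lc.cols Falsum = (\<lambda>(r, c). (r + (2 * D + 3) + 1, c)) ` ?S"
      unfolding lc.cols.simps by force
    then show ?thesis unfolding lc.pos_def by (simp only: image_image case_prod_unfold fst_conv snd_conv)
  qed
  have inj: "inj_on ?f ?S"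
  proof (rule inj_onI)
    fix x y assume xy: "x \<in> ?S" "y \<in> ?S" "?f x = ?f y"
    obtain d j d' j' where x: "x = (d, j)" "y = (d', j')" by (cases x, cases y)
    have j: "j < K" "j' < K" using xy x by auto
    have eq: "(d + (2 * D + 3) + 1) * K + j = (d' + (2 * D + 3) + 1) * K + j'"
      using xy(3) x by simp
    have "d + (2 * D + 3) + 1 = d' + (2 * D + 3) + 1"
      using arg_cong[OF eq, of "\<lambda>n. n div K"] div_mod_block(1)[OF j(1)] div_mod_block(1)[OF j(2)] by simp
    moreover have "j = j'"
      using arg_cong[OF eq, of "\<lambda>n. n mod K"] div_mod_block(2)[OF j(1)] div_mod_block(2)[OF j(2)] by simp
    ultimately show "x = y" using x by simp
  qed
  have "lc.weight Falsum = (\<Sum>x\<in>?S. B ^ ?f x)"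
    unfolding lc.weight_def pos sum.reindex[OF inj] comp_def ..
  also have "\<dots> = (\<Sum>r<length L. \<Sum>c<nc. B ^ ((r + 2 * D + 4) * K + c))"
    by (simp add: sum.cartesian_product case_prod_unfold add_ac)
  also have "\<dots> = Falsum_weight D (length L)"
    unfolding Falsum_weight_def sum_distrib_left
    by (intro sum.cong refl) (use power_block[of w _ 0] in simp)
  finally show ?thesis .
qed

definition all_items :: "item list" where
  "all_items = concat (map (\<lambda>r. map (relabel r) (items_at (L ! r))) [0..<length L]) @ [Falsum]"

lemma relabel_item_set: "relabel r ` item_set A = {Lit r a s |a s. a < na} \<union>
    {Slack r c k |c k. c < nc \<and> k < length (Cs ! c) \<and> \<not> (k = 0 \<and> fst (Ct ! c) \<in> A)} \<union>
    {Extra r c |c. c < nc \<and> fst (Ct ! c) \<notin> A}"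
proof -
  have "relabel r ` {Lit 0 a s |a s. Q a} = {Lit r a s |a s. Q a}" for Q by force
  moreover have "relabel r ` {Slack 0 c k |c k. Q c k} = {Slack r c k |c k. Q c k}" for Q by force
  moreover have "relabel r ` {Extra 0 c |c. Q c} = {Extra r c |c. Q c}" for Q by force
  ultimately show ?thesis unfolding item_set_def image_Un by (simp only:)
qed

lemma set_all_items: "set all_items = lc.items"
proof -
  have "set all_items = (\<Union>r<length L. relabel r ` item_set (L ! r)) \<union> {Falsum}"
    unfolding all_items_def by (auto simp: set_items_at)
  also have "\<dots> = lc.items"
    unfolding lc.items_def relabel_item_set placement_def by blast
  finally show ?thesis .
qed

lemma distinct_all_items: "distinct all_items"
proof -
  have "distinct (concat (map (\<lambda>r. map (relabel r) (items_at (L ! r))) [0..<n]))" for n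
  proof (induction n)
    case (Suc n)
    have "inj_on (relabel n) (set (items_at (L ! n)))"
      by (rule inj_on_inverseI[of _ "relabel 0"]) (rule relabel_0)
    moreover have "relabel r i \<noteq> relabel n j" if "r < n" "i \<in> set (items_at (L ! r))" "j \<in> set (items_at (L ! n))" for r i j
      using index_relabel[OF that(2), of r] index_relabel[OF that(3), of n] that(1) by force
    then have "set (concat (map (\<lambda>r. map (relabel r) (items_at (L ! r))) [0..<n])) \<inter>
        set (map (relabel n) (items_at (L ! n))) = {}"
      by force
    ultimately show ?case using Suc distinct_items_at[of "L ! n"] by (simp add: distinct_map)
  qed simp
  moreover have "Falsum \<notin> set (concat (map (\<lambda>r. map (relabel r) (items_at (L ! r))) [0..<length L]))"
  proof
    assume "Falsum \<in> set (concat (map (\<lambda>r. map (relabel r) (items_at (L ! r))) [0..<length L]))"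
    then obtain r i where "i \<in> set (items_at (L ! r))" "Falsum = relabel r i" by auto
    then show False using index_relabel by metis
  qed
  ultimately show ?thesis unfolding all_items_def by simp
qed

lemma weights_items: "weights D L = map (\<lambda>i. 2 * lc.weight i) all_items @ [1]"
proof -
  have eq: "map (\<lambda>i. 2 * item_weight D r i) (items_at A) = map (\<lambda>i. 2 * lc.weight i) (map (relabel r) (items_at A))" for r A
    unfolding map_map comp_def by (rule map_cong[OF refl]) (simp only: weight_relabel)
  then show ?thesis
    unfolding weights_def all_items_def eq by (simp add: map_concat comp_def weight_Falsum)
qed

lemma weights_halves: "(\<exists>I. halves (weights D L) I) \<longleftrightarrow> (\<exists>\<alpha>. lc.satisfies \<alpha>)"
  unfolding weights_items halves_iff[OF distinct_all_items] set_all_items by (rule lc.balanced_iff_satisfiable)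

end

end

section \<open>Programs that write the list of weights\<close>

lemma runs_conv':
  "runs X c s t s' \<Longrightarrow> s = s0 \<Longrightarrow> s' = s'' \<Longrightarrow> t \<le> t' \<Longrightarrow> runs X c s0 t' s''"
  using runs_conv by blast

lemma bits_value_concat_replicate:
  "bits_value (concat (replicate n bs)) = (\<Sum>r<n. 2 ^ (length bs * r) * bits_value bs)"
proof (induction n)
  case (Suc n)
  have "concat (replicate (Suc n) bs) = concat (replicate n bs) @ bs"
    by (simp flip: replicate_append_same)
  moreover have "length (concat (replicate n bs)) = length bs * n"
    by (induction n) simp_all
  ultimately show ?case using Suc by (simp add: horner_sum_append)
qed simp

context emitter
begin

definition unit_digits :: nat where
  "unit_digits = (\<Sum>c<nc. B ^ c)"

lemma unit_digits: "0 < unit_digits" "length (binary unit_digits) \<le> z"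
proof -
  have "nc > 0" using nonempty by (simp add: Cs_def)
  then show "0 < unit_digits" unfolding unit_digits_def by (intro sum_pos2[of _ 0]) auto
  have "unit_digits < B ^ nc" unfolding unit_digits_def by (rule digit_sum_less[OF B_gt_1]) auto
  also have "\<dots> \<le> 2 ^ z" by (simp add: power_mult[symmetric])
  finally show "length (binary unit_digits) \<le> z" by (rule length_binary_le)
qed

text \<open>The zeros precede the digits of \<open>unit_digits\<close>, so that each chunk, and with
  it the whole numeral, ends in a one. The prefix written by \<open>falsum\<close> compensates this
  with \<open>length (binary unit_digits)\<close> further zeros.\<close>

definition chunk :: "bool list" where
  "chunk = replicate (z - length (binary unit_digits)) False @ binary unit_digits"

text \<open>Counter \<open>2\<close> has counted the positions already written, and each of them
  gets a chunk; so this number comes after all blocks.\<close>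

definition falsum :: com where
  "falsum = emits (True # False # enc (replicate (3 * z + length (binary unit_digits)) False)) ;;
    For 4 5 (emits (enc (replicate (2 * z) False))) ;; Loop 2 (emits (enc chunk)) ;; emits [False]"

definition falsum_time :: "nat \<Rightarrow> nat" where
  "falsum_time N = (2 + 8 * z) + ((N * (4 * z + 9) + 2) + ((N * (2 * z + 3) + 1) + 1))"

lemma pb_falsum_time: "pb falsum_time"
  unfolding falsum_time_def by (intro pb_add pb_mult pb_const pb_id)

lemma runs_falsum:
  assumes e: "e 5 = 0" "0 < e 2" "e 2 \<le> N" "e 4 \<le> N"
  shows "runs X falsum (e, y) (falsum_time N) (e(2 := 0), y @ encode_nat (2 * Falsum_weight (e 4) (e 2)))"
proof -
  let ?u = "binary unit_digits"
  define L where "L = False # replicate (3 * z + length ?u) False @ replicate (e 4 * (2 * z)) False @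
    concat (replicate (e 2) chunk)"
  have len: "length chunk = z" using unit_digits by (simp add: chunk_def)
  have val: "bits_value chunk = 2 ^ (z - length ?u) * unit_digits"
    by (simp add: chunk_def horner_sum_append horner_sum_binary)
  have chunk: "chunk \<noteq> []" "last chunk" using unit_digits(1) last_binary by (simp_all add: chunk_def)
  then have "last (concat (replicate (e 2) chunk))" "concat (replicate (e 2) chunk) \<noteq> []"
    using e(2) by (cases "e 2"; simp del: concat_replicate_trivial flip: replicate_append_same)+
  then have "encode_nat (bits_value L) = enc L @ [False]"
    unfolding L_def by (intro encode_nat_bits) (simp_all del: concat_replicate_trivial)
  moreover have "bits_value L = 2 * Falsum_weight (e 4) (e 2)"
  proof -
    have eq: "2 ^ (3 * z + length ?u) * (2 ^ (e 4 * (2 * z)) * (2 ^ (z * r) * (2 ^ (z - length ?u) * unit_digits))) =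
        2 ^ (z * (r + 2 * e 4 + 4)) * unit_digits" for r
    proof -
      have "(3 * z + length ?u) + (e 4 * (2 * z) + (z * r + (z - length ?u))) = z * (r + 2 * e 4 + 4)"
        using unit_digits(2) by (simp add: algebra_simps)
      then show ?thesis by (simp only: mult.assoc[symmetric] power_add[symmetric] add.assoc)
    qed
    show ?thesis
      by (simp add: L_def horner_sum_append bits_value_concat_replicate len val Falsum_weight_def
        unit_digits_def[symmetric] sum_distrib_left eq del: concat_replicate_trivial)
  qed
  ultimately have out: "encode_nat (2 * Falsum_weight (e 4) (e 2)) = enc L @ [False]" by simp
  have 1: "runs X (emits (True # False # enc (replicate (3 * z + length ?u) False))) (e, y) (2 + 8 * z)
      (e, y @ True # False # enc (replicate (3 * z + length ?u) False))"
    by (rule runs_conv[OF runs_emits]) (use unit_digits(2) in simp_all)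
  let ?y = "(y @ True # False # enc (replicate (3 * z + length ?u) False)) @ concat (replicate (e 4) (enc (replicate (2 * z) False)))"
  have "e 4 * (4 * z + 9) + 2 \<le> N * (4 * z + 9) + 2" using mult_le_mono1[OF e(4), of "4 * z + 9"] by simp
  then have 2: "runs X (For 4 5 (emits (enc (replicate (2 * z) False))))
      (e, y @ True # False # enc (replicate (3 * z + length ?u) False)) (N * (4 * z + 9) + 2) (e, ?y)"
    by (intro runs_conv[OF runs_For_emits]) (use e in simp_all)
  have 3: "runs X (Loop 2 (emits (enc chunk))) (e, ?y) (N * (2 * z + 3) + 1) (e(2 := 0), ?y @ concat (replicate (e 2) (enc chunk)))"
  proof -
    let ?f = "\<lambda>i. e(2 := e 2 - i)" and ?g = "\<lambda>i. ?y @ concat (replicate i (enc chunk))"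
    have "runs X (Loop 2 (emits (enc chunk))) (?f 0, ?g 0) (e 2 * (2 * z + 3) + 1) (?f (e 2), ?g (e 2))"
    proof (rule runs_Loop[where f = ?f and g = ?g])
      fix i
      show "runs X (emits (enc chunk)) ((?f i)(2 := e 2 - Suc i), ?g i) (2 * z) (?f (Suc i), ?g (Suc i))"
        by (rule runs_conv[OF runs_emits]) (simp_all add: len flip: replicate_append_same)
    qed simp_all
    moreover have "e 2 * (2 * z + 3) + 1 \<le> N * (2 * z + 3) + 1" using mult_le_mono1[OF e(3), of "2 * z + 3"] by simp
    ultimately show ?thesis by (elim runs_conv') simp_all
  qed
  show ?thesis
    unfolding falsum_def
    by (rule runs_conv[OF runs_Seq[OF 1 runs_Seq[OF 2 runs_Seq[OF 3 runs_emits]]]])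
      (simp_all add: out L_def enc_concat_replicate replicate_mult[of "e 4"] falsum_time_def)
qed

fun outputs :: "nat \<Rightarrow> nat \<Rightarrow> 'c set list \<Rightarrow> word" where
  "outputs D r [] = []"
| "outputs D r (A # As) = output_at D r A @ outputs D (Suc r) As"

lemma outputs_append: "outputs D r (As @ As') = outputs D r As @ outputs D (r + length As) As'"
  by (induction As arbitrary: r) simp_all

lemma outputs_upt: "outputs D r As = concat (map (\<lambda>i. output_at D (r + i) (As ! i)) [0..<length As])"
  by (induction As rule: rev_induct) (auto simp: outputs_append nth_append intro!: arg_cong[of _ _ concat])

lemma encode_weights:
  "encode (weights D L) = outputs D 0 L @ encode_nat (2 * Falsum_weight D (length L)) @ encode_nat 1"
proof -
  have "concat (concat xss) = concat (map concat xss)" for xss :: "word list list"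
    by (induction xss) simp_all
  then show ?thesis
    unfolding encode_def weights_def outputs_upt output_at_def by (simp add: map_concat comp_def)
qed

text \<open>The common bound \<open>N\<close> on the indices gives a time that does not depend on
  where in the table the list begins, so that pieces compose by adding their times.\<close>

definition emits_list :: "(nat \<Rightarrow> word) \<Rightarrow> nat \<Rightarrow> nat \<Rightarrow> com \<Rightarrow> 'c set list \<Rightarrow> nat \<Rightarrow> bool" where
  "emits_list X D N c As t \<longleftrightarrow> (\<forall>e y. e 3 = 0 \<longrightarrow> e 4 = D \<longrightarrow> e 5 = 0 \<longrightarrow> e 8 = D \<longrightarrow> e 9 = 0 \<longrightarrow> e 2 + length As \<le> N \<longrightarrow>
    runs X c (e, y) t (e(2 := e 2 + length As), y @ outputs D (e 2) As))"

lemma emits_list_Seq: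
  assumes "emits_list X D N c As t" "emits_list X D N d Bs t'"
  shows "emits_list X D N (c ;; d) (As @ Bs) (t + t')"
  unfolding emits_list_def
proof (intro allI impI)
  fix e :: "nat \<Rightarrow> nat" and y
  assume e: "e 3 = 0" "e 4 = D" "e 5 = 0" "e 8 = D" "e 9 = 0" "e 2 + length (As @ Bs) \<le> N"
  let ?e = "e(2 := e 2 + length As)" and ?y = "y @ outputs D (e 2) As"
  have 1: "runs X c (e, y) t (?e, ?y)"
    using assms(1) e unfolding emits_list_def by simp
  have 2: "runs X d (?e, ?y) t' (?e(2 := ?e 2 + length Bs), ?y @ outputs D (?e 2) Bs)"
    by (rule assms(2)[unfolded emits_list_def, rule_format]) (use e in simp_all)
  show "runs X (c ;; d) (e, y) (t + t') (e(2 := e 2 + length (As @ Bs)), y @ outputs D (e 2) (As @ Bs))"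
    by (rule runs_conv[OF runs_Seq[OF 1 2]]) (simp_all add: outputs_append add.assoc)
qed

lemma emits_list_block: "D \<le> N \<Longrightarrow> emits_list X D N (block A) [A] (block_time A N)"
  unfolding emits_list_def by (auto intro!: runs_conv[OF runs_block[where N = N]])

lemma emits_list_For:
  assumes "D \<le> N"
  shows "emits_list X D N (For 8 9 (block A)) (replicate D A) (N * (block_time A N + 9) + 2)"
  unfolding emits_list_def
proof (intro allI impI)
  fix e :: "nat \<Rightarrow> nat" and y
  assume e: "e 3 = 0" "e 4 = D" "e 5 = 0" "e 8 = D" "e 9 = 0" "e 2 + length (replicate D A) \<le> N"
  let ?f = "\<lambda>i. e(2 := e 2 + i)" and ?g = "\<lambda>i. y @ outputs D (e 2) (replicate i A)"
  have "runs X (For 8 9 (block A)) (?f 0, ?g 0) (D * (block_time A N + 9) + 2) (?f D, ?g D)"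
  proof (rule runs_For[where e = ?f and g = ?g])
    fix i assume "i < D"
    let ?e = "(?f i)(8 := D - Suc i, 9 := Suc i)"
    have "runs X (block A) (?e, ?g i) (block_time A N) (?e(2 := Suc (?e 2)), ?g i @ output_at (?e 4) (?e 2) A)"
      by (rule runs_block) (use e assms \<open>i < D\<close> in simp_all)
    then show "runs X (block A) (?e, ?g i) (block_time A N) ((?f (Suc i))(8 := D - Suc i, 9 := Suc i), ?g (Suc i))"
      by (rule runs_conv) (use e in \<open>simp_all add: fun_eq_iff outputs_append flip: replicate_append_same\<close>)
  qed (use e in simp_all)
  moreover have "D * (block_time A N + 9) + 2 \<le> N * (block_time A N + 9) + 2"
    using mult_le_mono1[OF assms, of "block_time A N + 9"] by simp
  ultimately show "runs X (For 8 9 (block A)) (e, y) (N * (block_time A N + 9) + 2)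
      (e(2 := e 2 + length (replicate D A)), y @ outputs D (e 2) (replicate D A))"
    by (elim runs_conv') simp_all
qed

definition row :: "nat \<Rightarrow> 'c set \<Rightarrow> 'c set \<Rightarrow> 'c set list" where
  "row D A H = [{}] @ replicate D A @ [H] @ replicate D A @ [{}]"

definition emit_row :: "'c set \<Rightarrow> 'c set \<Rightarrow> com" where
  "emit_row A H = block {} ;; For 8 9 (block A) ;; block H ;; For 8 9 (block A) ;; block {}"

definition row_time :: "'c set \<Rightarrow> 'c set \<Rightarrow> nat \<Rightarrow> nat" where
  "row_time A H N = block_time {} N + ((N * (block_time A N + 9) + 2) +
    (block_time H N + ((N * (block_time A N + 9) + 2) + block_time {} N)))"

lemma pb_row_time: "pb (row_time A H)"
  unfolding row_time_def by (intro pb_add pb_mult pb_const pb_id pb_block_time)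

lemma length_row: "length (row D A H) = 2 * D + 3"
  by (simp add: row_def)

lemma emits_list_row: "D \<le> N \<Longrightarrow> emits_list X D N (emit_row A H) (row D A H) (row_time A H N)"
  unfolding emit_row_def row_def row_time_def
  by (intro emits_list_Seq emits_list_block emits_list_For)

lemma runs_rows:
  assumes "e 3 = 0" "e 4 = D" "e 5 = 0" "e 8 = D" "e 9 = 0" "D \<le> N" "e 2 + e 6 * (2 * D + 3) \<le> N"
  shows "runs X (Loop 6 (emit_row A H)) (e, y) (N * (row_time A H N + 3) + 1)
    (e(2 := e 2 + e 6 * (2 * D + 3), 6 := 0), y @ outputs D (e 2) (concat (replicate (e 6) (row D A H))))"
proof -
  have len: "length (concat (replicate i (row D A H))) = i * (2 * D + 3)" for i
    by (induction i) (simp_all add: length_row)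
  let ?f = "\<lambda>i. e(6 := e 6 - i, 2 := e 2 + i * (2 * D + 3))"
  let ?g = "\<lambda>i. y @ outputs D (e 2) (concat (replicate i (row D A H)))"
  have "runs X (Loop 6 (emit_row A H)) (?f 0, ?g 0) (e 6 * (row_time A H N + 3) + 1) (?f (e 6), ?g (e 6))"
  proof (rule runs_Loop[where f = ?f and g = ?g])
    fix i assume "i < e 6"
    then have "i * (2 * D + 3) + (2 * D + 3) \<le> e 6 * (2 * D + 3)"
      using mult_le_mono1[of "Suc i" "e 6" "2 * D + 3"] by simp
    let ?e = "(?f i)(6 := e 6 - Suc i)"
    have "runs X (emit_row A H) (?e, ?g i) (row_time A H N)
        (?e(2 := ?e 2 + length (row D A H)), ?g i @ outputs D (?e 2) (row D A H))"
      by (rule emits_list_row[OF assms(6), unfolded emits_list_def, rule_format])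
        (use assms \<open>i * (2 * D + 3) + (2 * D + 3) \<le> e 6 * (2 * D + 3)\<close> in \<open>simp_all add: length_row\<close>)
    then show "runs X (emit_row A H) (?e, ?g i) (row_time A H N) (?f (Suc i), ?g (Suc i))"
      by (rule runs_conv)
        (simp_all add: fun_eq_iff length_row outputs_append len flip: replicate_append_same)
  qed simp_all
  moreover have "e 6 * 1 \<le> e 6 * (2 * D + 3)" by (rule mult_le_mono2) simp
  then have "e 6 \<le> N" using assms(7) by linarith
  then have "e 6 * (row_time A H N + 3) + 1 \<le> N * (row_time A H N + 3) + 1"
    using mult_le_mono1[of "e 6" N "row_time A H N + 3"] by simp
  ultimately show ?thesis by (elim runs_conv') (simp_all add: fun_upd_twist)
qed

end

lemma symb_tape: "e k = Suc i \<Longrightarrow> symb X e k = word_tape (X k) (int i)"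
  by (simp add: symb_def)

lemma word_tape_cases: "word_tape x i = 0 \<or> word_tape x i = 1 \<or> word_tape x i = 2"
  by (simp add: word_tape_def)

context emitter
begin

text \<open>
  The first row: the input head (counter \<open>1\<close>) moves along the input word, and counter \<open>7\<close> counts the remaining cells of the
  certificate. \<open>C s g h\<close> are the categories for input symbol \<open>s\<close>, within the certificate iff \<open>g\<close>, at the head iff \<open>h\<close>.
\<close>

definition pick :: "(nat \<Rightarrow> bool \<Rightarrow> bool \<Rightarrow> 'c set) \<Rightarrow> bool \<Rightarrow> nat \<Rightarrow> com" where
  "pick C h s = Branch 7 {3} (block (C s False h)) (Dec 7 ;; block (C s True h))"

definition cell :: "(nat \<Rightarrow> bool \<Rightarrow> bool \<Rightarrow> 'c set) \<Rightarrow> bool \<Rightarrow> com" where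
  "cell C h = Branch 1 {0} (pick C h 0) (Branch 1 {1} (pick C h 1) (pick C h 2)) ;; Inc 1"

definition pick_time :: "(nat \<Rightarrow> bool \<Rightarrow> bool \<Rightarrow> 'c set) \<Rightarrow> bool \<Rightarrow> nat \<Rightarrow> nat \<Rightarrow> nat" where
  "pick_time C h s N = block_time (C s False h) N + block_time (C s True h) N + 3"

definition cell_time :: "(nat \<Rightarrow> bool \<Rightarrow> bool \<Rightarrow> 'c set) \<Rightarrow> bool \<Rightarrow> nat \<Rightarrow> nat" where
  "cell_time C h N = pick_time C h 0 N + pick_time C h 1 N + pick_time C h 2 N + 5"

lemma pb_cell_time: "pb (cell_time C h)"
  unfolding cell_time_def pick_time_def by (intro pb_add pb_const pb_block_time)

lemma runs_pick:
  assumes "e 3 = 0" "e 4 = D" "e 5 = 0" "e 2 \<le> N" "D \<le> N" "e 7 = p - d"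
  shows "runs X (pick C h s) (e, y) (pick_time C h s N)
    (e(7 := p - Suc d, 2 := Suc (e 2)), y @ output_at D (e 2) (C s (d < p) h))"
proof (cases "d < p")
  case True
  have dec: "runs X (Dec 7) (e, y) 1 (e(7 := p - Suc d), y)"
    by (rule runs_conv[OF runs_Dec]) (use assms True in simp_all)
  have "runs X (block (C s True h)) (e(7 := p - Suc d), y) (block_time (C s True h) N)
      (e(7 := p - Suc d, 2 := Suc (e 2)), y @ output_at D (e 2) (C s True h))"
    by (rule runs_conv[OF runs_block[where N = N]]) (use assms in simp_all)
  from runs_Seq[OF dec this] have "runs X (Dec 7 ;; block (C s True h)) (e, y) (1 + block_time (C s True h) N)
      (e(7 := p - Suc d, 2 := Suc (e 2)), y @ output_at D (e 2) (C s True h))" .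
  moreover have "symb X e 7 \<notin> {3}" using assms(6) True by simp
  ultimately have "runs X (pick C h s) (e, y) ((1 + block_time (C s True h) N) + 2)
      (e(7 := p - Suc d, 2 := Suc (e 2)), y @ output_at D (e 2) (C s True h))"
    unfolding pick_def by (intro runs_BranchFalse) simp_all
  then show ?thesis by (rule runs_conv) (use True in \<open>simp_all add: pick_time_def\<close>)
next
  case False
  have "runs X (block (C s False h)) (e, y) (block_time (C s False h) N)
      (e(2 := Suc (e 2)), y @ output_at D (e 2) (C s False h))"
    by (rule runs_conv[OF runs_block[where N = N]]) (use assms in simp_all)
  moreover have "symb X e 7 \<in> {3}" using assms(6) False by simp
  ultimately have "runs X (pick C h s) (e, y) (block_time (C s False h) N + 2)
      (e(2 := Suc (e 2)), y @ output_at D (e 2) (C s False h))"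
    unfolding pick_def by (intro runs_BranchTrue) simp_all
  then show ?thesis
    by (rule runs_conv) (use False assms(6) in \<open>simp_all add: pick_time_def fun_upd_idem\<close>)
qed

lemma runs_cell:
  assumes "e 3 = 0" "e 4 = D" "e 5 = 0" "e 2 \<le> N" "D \<le> N" "e 7 = p - d" "e 1 = Suc d"
  shows "runs X (cell C h) (e, y) (cell_time C h N)
    (e(7 := p - Suc d, 2 := Suc (e 2), 1 := Suc (Suc d)),
     y @ output_at D (e 2) (C (word_tape (X 1) (int d)) (d < p) h))"
proof -
  let ?s = "word_tape (X 1) (int d)"
  let ?e = "e(7 := p - Suc d, 2 := Suc (e 2))" and ?y = "y @ output_at D (e 2) (C ?s (d < p) h)"
  have s: "symb X e 1 = ?s" using assms(7) by (rule symb_tape)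
  note pick = runs_pick[OF assms(1-6), of X C h _ y]
  have "runs X (Branch 1 {0} (pick C h 0) (Branch 1 {1} (pick C h 1) (pick C h 2))) (e, y)
      (pick_time C h 0 N + pick_time C h 1 N + pick_time C h 2 N + 4) (?e, ?y)"
  proof -
    consider "?s = 0" | "?s = 1" | "?s = 2" using word_tape_cases[of "X 1" "int d"] by (elim disjE)
    then show ?thesis
    proof cases
      case 1
      have "runs X (Branch 1 {0} (pick C h 0) (Branch 1 {1} (pick C h 1) (pick C h 2))) (e, y) (pick_time C h 0 N + 2) (?e, ?y)"
        using pick[of 0] s 1 by (intro runs_BranchTrue) simp_all
      then show ?thesis by (rule runs_mono) simp
    next
      case 2
      have "runs X (Branch 1 {0} (pick C h 0) (Branch 1 {1} (pick C h 1) (pick C h 2))) (e, y) (pick_time C h 1 N + 2 + 2) (?e, ?y)"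
        by (rule runs_BranchFalse[OF _ _ runs_BranchTrue]) (use pick[of 1] s 2 in simp_all)
      then show ?thesis by (rule runs_mono) simp
    next
      case 3
      have "runs X (Branch 1 {0} (pick C h 0) (Branch 1 {1} (pick C h 1) (pick C h 2))) (e, y) (pick_time C h 2 N + 2 + 2) (?e, ?y)"
        by (rule runs_BranchFalse[OF _ _ runs_BranchFalse]) (use pick[of 2] s 3 in simp_all)
      then show ?thesis by (rule runs_mono) simp
    qed
  qed
  from runs_Seq[OF this runs_Inc[of 1]] show ?thesis
    unfolding cell_def by (rule runs_conv) (use assms(7) in \<open>simp_all add: cell_time_def\<close>)
qed

text \<open>Left of displacement \<open>0\<close> the input and the certificate are blank, so these
  cells are all alike and reading starts only at \<open>0\<close>.\<close>

definition first_row :: "nat \<Rightarrow> (nat \<Rightarrow> bool \<Rightarrow> bool \<Rightarrow> 'c set) \<Rightarrow> word \<Rightarrow> nat \<Rightarrow> 'c set list" where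
  "first_row D C x p = [{}] @ replicate D (C 0 False False) @
    map (\<lambda>d. C (word_tape x (int d)) (d < p) (d = 0)) [0..<Suc D] @ [{}]"

definition emit_first_row :: "(nat \<Rightarrow> bool \<Rightarrow> bool \<Rightarrow> 'c set) \<Rightarrow> com" where
  "emit_first_row C = (block {} ;; For 8 9 (block (C 0 False False))) ;;
    cell C True ;; For 8 9 (cell C False) ;; block {}"

definition first_row_time :: "(nat \<Rightarrow> bool \<Rightarrow> bool \<Rightarrow> 'c set) \<Rightarrow> nat \<Rightarrow> nat" where
  "first_row_time C N = (block_time {} N + (N * (block_time (C 0 False False) N + 9) + 2)) +
    (cell_time C True N + ((N * (cell_time C False N + 9) + 2) + block_time {} N))"

lemma pb_first_row_time: "pb (first_row_time C)"
  unfolding first_row_time_def by (intro pb_add pb_mult pb_const pb_id pb_block_time pb_cell_time)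

lemma runs_first_row:
  assumes e: "e 3 = 0" "e 4 = D" "e 5 = 0" "e 8 = D" "e 9 = 0" "e 2 = 0" "e 1 = 1" "e 7 = p"
    and N: "2 * D + 3 \<le> N"
  shows "runs X (emit_first_row C) (e, y) (first_row_time C N)
    (e(7 := p - Suc D, 1 := Suc (Suc D), 2 := 2 * D + 3), y @ outputs D 0 (first_row D C (X 1) p))"
proof -
  let ?As = "[{}] @ replicate D (C 0 False False)"
  let ?cell = "\<lambda>d. C (word_tape (X 1) (int d)) (d < p) (d = 0)"
  let ?f = "\<lambda>d. e(7 := p - d, 1 := Suc d, 2 := Suc D + d)"
  let ?g = "\<lambda>d. y @ outputs D 0 (?As @ map ?cell [0..<d])"
  have DN: "D \<le> N" using N by simp
  have len: "length ?As = Suc D" by simp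
  have "emits_list X D N (block {} ;; For 8 9 (block (C 0 False False))) ?As
      (block_time {} N + (N * (block_time (C 0 False False) N + 9) + 2))"
    by (intro emits_list_Seq emits_list_block emits_list_For DN)
  then have "runs X (block {} ;; For 8 9 (block (C 0 False False))) (e, y)
      (block_time {} N + (N * (block_time (C 0 False False) N + 9) + 2))
      (e(2 := e 2 + length ?As), y @ outputs D (e 2) ?As)"
    by (rule emits_list_def[THEN iffD1, rule_format]) (use e N in simp_all)
  then have 1: "runs X (block {} ;; For 8 9 (block (C 0 False False))) (e, y)
      (block_time {} N + (N * (block_time (C 0 False False) N + 9) + 2)) (?f 0, ?g 0)"
    by (rule runs_conv) (use e in \<open>simp_all add: fun_eq_iff\<close>)
  have cell: "runs X (cell C (d = 0)) (?f d, ?g d) (cell_time C (d = 0) N) (?f (Suc d), ?g (Suc d))" if "d \<le> D" for d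
  proof -
    have "runs X (cell C (d = 0)) (?f d, ?g d) (cell_time C (d = 0) N)
        ((?f d)(7 := p - Suc d, 2 := Suc (?f d 2), 1 := Suc (Suc d)),
         ?g d @ output_at D (?f d 2) (C (word_tape (X 1) (int d)) (d < p) (d = 0)))"
      by (rule runs_cell) (use e N that in simp_all)
    then show ?thesis by (rule runs_conv) (simp_all add: fun_eq_iff outputs_append)
  qed
  have 2: "runs X (cell C True) (?f 0, ?g 0) (cell_time C True N) (?f 1, ?g 1)"
    using cell[of 0] by simp
  have "runs X (For 8 9 (cell C False)) (?f (Suc 0), ?g (Suc 0)) (D * (cell_time C False N + 9) + 2) (?f (Suc D), ?g (Suc D))"
  proof (rule runs_For[where e = "\<lambda>i. ?f (Suc i)" and g = "\<lambda>i. ?g (Suc i)"])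
    fix i assume i: "i < D"
    let ?d = "Suc i"
    let ?e = "(?f ?d)(8 := D - Suc i, 9 := Suc i)"
    have "runs X (cell C False) (?e, ?g ?d) (cell_time C False N)
        (?e(7 := p - Suc ?d, 2 := Suc (?e 2), 1 := Suc (Suc ?d)),
         ?g ?d @ output_at D (?e 2) (C (word_tape (X 1) (int ?d)) (?d < p) False))"
      by (rule runs_cell) (use e N i in simp_all)
    then show "runs X (cell C False) (?e, ?g ?d) (cell_time C False N)
        ((?f (Suc ?d))(8 := D - Suc i, 9 := Suc i), ?g (Suc ?d))"
      by (rule runs_conv) (simp_all add: fun_eq_iff outputs_append)
  qed (use e in simp_all)
  moreover have "D * (cell_time C False N + 9) + 2 \<le> N * (cell_time C False N + 9) + 2"
    using mult_le_mono1[OF DN, of "cell_time C False N + 9"] by simp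
  ultimately have 3: "runs X (For 8 9 (cell C False)) (?f 1, ?g 1) (N * (cell_time C False N + 9) + 2) (?f (Suc D), ?g (Suc D))"
    by (elim runs_conv') simp_all
  have "runs X (block {}) (?f (Suc D), ?g (Suc D)) (block_time {} N)
      ((?f (Suc D))(2 := Suc (?f (Suc D) 2)), ?g (Suc D) @ output_at (?f (Suc D) 4) (?f (Suc D) 2) {})"
    by (rule runs_block) (use e N in simp_all)
  then have 4: "runs X (block {}) (?f (Suc D), ?g (Suc D)) (block_time {} N)
      (e(7 := p - Suc D, 1 := Suc (Suc D), 2 := 2 * D + 3), y @ outputs D 0 (first_row D C (X 1) p))"
    by (rule runs_conv) (use e in \<open>simp_all add: fun_eq_iff outputs_append first_row_def\<close>)
  show ?thesis
    unfolding emit_first_row_def first_row_time_def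
    by (intro runs_Seq[OF 1 runs_Seq[OF 2 runs_Seq[OF 3 4]]])
qed

definition emit_all :: "(nat \<Rightarrow> bool \<Rightarrow> bool \<Rightarrow> 'c set) \<Rightarrow> 'c set \<Rightarrow> 'c set \<Rightarrow> 'c set \<Rightarrow> com" where
  "emit_all C A H F = emit_first_row C ;; Loop 6 (emit_row A H) ;; emit_row F F ;; falsum ;; emits (encode_nat 1)"

definition emit_time :: "(nat \<Rightarrow> bool \<Rightarrow> bool \<Rightarrow> 'c set) \<Rightarrow> 'c set \<Rightarrow> 'c set \<Rightarrow> 'c set \<Rightarrow> nat \<Rightarrow> nat" where
  "emit_time C A H F N = first_row_time C N +
    ((N * (row_time A H N + 3) + 1) + (row_time F F N + (falsum_time N + length (encode_nat 1))))"

lemma pb_emit_time: "pb (emit_time C A H F)"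
  unfolding emit_time_def
  by (intro pb_add pb_mult pb_const pb_id pb_first_row_time pb_row_time pb_falsum_time)

definition table :: "nat \<Rightarrow> (nat \<Rightarrow> bool \<Rightarrow> bool \<Rightarrow> 'c set) \<Rightarrow> 'c set \<Rightarrow> 'c set \<Rightarrow> 'c set \<Rightarrow> word \<Rightarrow> nat \<Rightarrow> nat \<Rightarrow> 'c set list" where
  "table D C A H F x p n = first_row D C x p @ concat (replicate n (row D A H)) @ row D F F"

lemma length_table: "length (table D C A H F x p n) = (n + 2) * (2 * D + 3)"
proof -
  have "length (concat (replicate n (row D A H))) = n * (2 * D + 3)"
    by (induction n) (simp_all add: length_row)
  then show ?thesis by (simp add: table_def first_row_def length_row)
qed

lemma runs_emit_all:
  assumes e: "e 3 = 0" "e 4 = D" "e 5 = 0" "e 8 = D" "e 9 = 0" "e 2 = 0" "e 1 = 1" "e 7 = p" "e 6 = n"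
    and N: "(n + 2) * (2 * D + 3) \<le> N"
  shows "\<exists>e'. runs X (emit_all C A H F) (e, []) (emit_time C A H F N)
    (e', encode (weights D (table D C A H F (X 1) p n)))"
proof -
  let ?e1 = "e(7 := p - Suc D, 1 := Suc (Suc D), 2 := 2 * D + 3)" and ?y1 = "outputs D 0 (first_row D C (X 1) p)"
  let ?R = "concat (replicate n (row D A H))"
  let ?e2 = "?e1(2 := (n + 1) * (2 * D + 3), 6 := 0)" and ?y2 = "outputs D 0 (first_row D C (X 1) p @ ?R)"
  let ?e3 = "?e2(2 := (n + 2) * (2 * D + 3))" and ?y3 = "outputs D 0 (table D C A H F (X 1) p n)"
  have N': "(n + 2) * (2 * D + 3) = (n + 1) * (2 * D + 3) + (2 * D + 3)"
    "(n + 1) * (2 * D + 3) = n * (2 * D + 3) + (2 * D + 3)" by (simp_all add: algebra_simps)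
  have len1: "length (first_row D C (X 1) p) = 2 * D + 3" by (simp add: first_row_def)
  have len2: "length ?R = n * (2 * D + 3)"
    by (induction n) (simp_all add: length_row)
  have 1: "runs X (emit_first_row C) (e, []) (first_row_time C N) (?e1, ?y1)"
    using runs_first_row[OF e(1-8), of N X C "[]"] N N' by simp
  have "runs X (Loop 6 (emit_row A H)) (?e1, ?y1) (N * (row_time A H N + 3) + 1)
      (?e1(2 := ?e1 2 + ?e1 6 * (2 * D + 3), 6 := 0),
        ?y1 @ outputs D (?e1 2) (concat (replicate (?e1 6) (row D A H))))"
    by (rule runs_rows) (use e N N' in simp_all)
  then have 2: "runs X (Loop 6 (emit_row A H)) (?e1, ?y1) (N * (row_time A H N + 3) + 1) (?e2, ?y2)"
    by (rule runs_conv) (use e len1 N' in \<open>simp_all add: fun_eq_iff outputs_append\<close>)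
  have "runs X (emit_row F F) (?e2, ?y2) (row_time F F N)
      (?e2(2 := ?e2 2 + length (row D F F)), ?y2 @ outputs D (?e2 2) (row D F F))"
    by (rule emits_list_row[unfolded emits_list_def, rule_format, where N = N])
      (use e N N' in \<open>simp_all add: length_row\<close>)
  then have 3: "runs X (emit_row F F) (?e2, ?y2) (row_time F F N) (?e3, ?y3)"
    by (rule runs_conv) (use e len1 len2 N' in \<open>simp_all add: fun_eq_iff outputs_append length_row table_def\<close>)
  have 4: "runs X falsum (?e3, ?y3) (falsum_time N) (?e3(2 := 0), ?y3 @ encode_nat (2 * Falsum_weight (?e3 4) (?e3 2)))"
    by (rule runs_falsum) (use e N N' in simp_all)
  have "runs X (emit_all C A H F) (e, []) (emit_time C A H F N)
      (?e3(2 := 0), (?y3 @ encode_nat (2 * Falsum_weight (?e3 4) (?e3 2))) @ encode_nat 1)"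
    unfolding emit_all_def emit_time_def
    by (rule runs_Seq[OF 1 runs_Seq[OF 2 runs_Seq[OF 3 runs_Seq[OF 4 runs_emits]]]])
  moreover have "(?y3 @ encode_nat (2 * Falsum_weight (?e3 4) (?e3 2))) @ encode_nat 1 =
      encode (weights D (table D C A H F (X 1) p n))"
    unfolding encode_weights length_table using e by simp
  ultimately show ?thesis by metis
qed

end

section \<open>NP-hardness\<close>

definition coded :: "tm \<Rightarrow> (cat \<times> (nat \<times> nat \<times> bool) list) list" where
  "coded M = map (\<lambda>(ct, ls). (ct, map (\<lambda>(d, a, s). (d, to_nat a, s)) ls)) (templates M)"

text \<open>A sum over all templates is a crude strict bound. Like \<open>digit_width\<close>, it
  depends on \<open>M\<close> alone, so the base and the number of digits per position are constants
  of the reduction.\<close>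

definition attr_bound :: "tm \<Rightarrow> nat" where
  "attr_bound M = Suc (\<Sum>(ct, ls)\<leftarrow>templates M. \<Sum>(d, a, s)\<leftarrow>ls. to_nat a)"

definition digit_width :: "tm \<Rightarrow> nat" where
  "digit_width M = 2 + (\<Sum>(ct, ls)\<leftarrow>templates M. 2 * (length ls + 1))"

lemma emitter_templates: "emitter (coded M) (attr_bound M) (digit_width M)"
proof
  fix ct ls assume "(ct, ls) \<in> set (coded M)"
  then obtain ls' where ls': "(ct, ls') \<in> set (templates M)" "ls = map (\<lambda>(d, a, s). (d, to_nat a, s)) ls'"
    unfolding coded_def by auto
  note wf = templates_wf[OF ls'(1)]
  have "inj_on (\<lambda>(d, a :: attr, s). (d, to_nat a, s)) (set ls')" by (auto intro!: inj_onI)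
  then have "distinct ls" using wf(1) by (simp add: ls'(2) distinct_map)
  moreover have "ls \<noteq> []" "fst (ls ! 0) = 0" using wf(2,3) by (auto simp: ls'(2) split: prod.split)
  moreover have "d < 5 \<and> a < attr_bound M" if das: "(d, a, s) \<in> set ls" for d a s
  proof -
    obtain a' where a': "(d, a', s) \<in> set ls'" "a = to_nat a'" using das ls'(2) by auto
    have "a \<le> (\<Sum>(d, a, s)\<leftarrow>ls'. to_nat a)"
      using member_le_sum_list[of a "map (\<lambda>(d, a, s). to_nat a) ls'"] a' by force
    also have "\<dots> \<le> (\<Sum>(ct, ls)\<leftarrow>templates M. \<Sum>(d, a, s)\<leftarrow>ls. to_nat a)"
      using ls'(1) by (intro member_le_sum_list, force, simp)
    finally show ?thesis using wf(4) a'(1) by (auto simp: attr_bound_def)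
  qed
  ultimately show "distinct ls \<and> ls \<noteq> [] \<and> fst (ls ! 0) = 0 \<and> (\<forall>(d, a, s) \<in> set ls. d < 5 \<and> a < attr_bound M)"
    by blast
  have "2 * (length ls + 1) \<le> (\<Sum>(ct, ls)\<leftarrow>templates M. 2 * (length ls + 1))"
    using ls' by (intro member_le_sum_list, force, simp)
  then have "2 * (length ls + 1) \<le> digit_width M" by (simp add: digit_width_def)
  also have "\<dots> < 2 ^ digit_width M" by (rule less_exp)
  finally show "2 * (length ls + 1) < 2 ^ digit_width M" .
qed (simp_all add: coded_def templates_def digit_width_def)

text \<open>In the first row the categories depend on the input only through three data with
  finitely many values, so that each combination can have its own block of code.\<close>

definition cell_cats :: "nat \<Rightarrow> bool \<Rightarrow> bool \<Rightarrow> cat set" where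
  "cell_cats s g h = {General} \<union> (if h then {Transition} else {Keep}) \<union>
    ({Initial j 0 |j. j \<noteq> 1 \<and> j \<noteq> 2} \<union> {Initial 1 s} \<union> (if g then {Guess} else {Initial 2 0}) \<union>
     (if h then {Start} else {}))"

lemma concat_replicate_nth:
  "t < n \<Longrightarrow> c < length xs \<Longrightarrow> concat (replicate n xs) ! (t * length xs + c) = xs ! c"
proof (induction n arbitrary: t)
  case (Suc n)
  then show ?case by (cases t) (simp_all add: nth_append add.assoc)
qed simp

context tableau
begin

interpretation em: emitter "coded M" "attr_bound M" "digit_width M"
  by (rule emitter_templates)

definition layout :: "cat set list" where
  "layout = em.table D cell_cats {General, Keep} {General, Transition} {Final} x p (T - 1)"

lemma length_layout: "length layout = (T + 1) * P"
proof -
  have "T - 1 + 2 = T + 1" using T by simp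
  then show ?thesis unfolding layout_def em.length_table P_def by simp
qed

lemma row_nth: "c < 2 * D + 3 \<Longrightarrow>
    em.row D A H ! c = (if c = 0 \<or> c = 2 * D + 2 then {} else if c = D + 1 then H else A)"
  by (auto simp: em.row_def nth_append nth_Cons')

lemma first_row_nth: "c < 2 * D + 3 \<Longrightarrow> em.first_row D cell_cats x p ! c =
    (if c = 0 \<or> c = 2 * D + 2 then {} else if c \<le> D then cell_cats 0 False False
     else cell_cats (word_tape x (int (c - (D + 1)))) (c - (D + 1) < p) (c = D + 1))"
proof -
  assume c: "c < 2 * D + 3"
  let ?f = "\<lambda>d. cell_cats (word_tape x (int d)) (d < p) (d = 0)"
  consider "c = 0" | k where "c = Suc k" "k < D" | k where "c = Suc (D + k)" "k < Suc D" | "c = 2 * D + 2"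
    using c that(2)[of "c - 1"] that(3)[of "c - Suc D"] by (cases "c = 0"; cases "c \<le> D"; cases "c = 2 * D + 2"; simp)
  then show ?thesis
    by cases (simp_all add: em.first_row_def nth_append del: upt_Suc)
qed

lemma layout_nth:
  assumes "t \<le> T" "\<bar>d\<bar> \<le> int D + 1"
  shows "layout ! ix t d = cats x p T D t d"
proof -
  define c where "c = nat (d + int D + 1)"
  have c: "c < P" "ix t d = t * P + c" "d = int c - int D - 1"
  proof -
    show "c < P" "d = int c - int D - 1" using assms(2) P_def unfolding c_def by linarith+
    show "ix t d = t * P + c" by (simp add: c_def ix_def)
  qed
  have len1: "length (em.first_row D cell_cats x p) = P" by (simp add: em.first_row_def P_def)
  have lenr: "length (em.row D A H) = P" for A H by (simp add: em.length_row P_def)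
  have lenc: "length (concat (replicate n (em.row D A H))) = n * P" for n A H
    by (induction n) (simp_all add: lenr)
  show ?thesis
  proof (cases "t = 0")
    case True
    have "layout ! ix t d = em.first_row D cell_cats x p ! c"
      using c True len1 by (simp add: layout_def em.table_def nth_append)
    also have "\<dots> = cats x p T D t d"
    proof (cases "c = 0 \<or> c = 2 * D + 2")
      case True
      then have "\<bar>d\<bar> > int D" using c(3) by auto
      then show ?thesis using first_row_nth[of c] c(1) True P_def by (simp add: cats_def)
    next
      case False
      have "c \<noteq> 0" "c < 2 * D + 2" using c(1) False P_def by linarith+
      then have d: "\<bar>d\<bar> \<le> int D" using c(3) by linarith
      show ?thesis
      proof (cases "c \<le> D")
        case True
        then have "d < 0" using c(3) by simp
        then show ?thesis
          using first_row_nth[of c] c(1) False True P_def d \<open>t = 0\<close> T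
          by (simp add: cats_def cell_cats_def initial_cats_def word_tape_def)
      next
        case gt: False
        then have "d = int (c - (D + 1))" using c(3) by simp
        moreover from this have "(d = 0) = (c = D + 1)" "(d < int p) = (c - (D + 1) < p)" using gt by auto
        ultimately show ?thesis
          using first_row_nth[of c] c(1) False gt P_def d \<open>t = 0\<close> T
          by (simp add: cats_def cell_cats_def initial_cats_def)
      qed
    qed
    finally show ?thesis .
  next
    case t0: False
    have body: "(if c = 0 \<or> c = 2 * D + 2 then {} else if c = D + 1 then H else A) =
        (if \<bar>d\<bar> > int D then {} else if d = 0 then H else A)" for H A :: "cat set"
      using c P_def by auto
    show ?thesis
    proof (cases "t = T")
      case True
      have "layout ! ix t d = em.row D {Final} {Final} ! c"
      proof -
        have "T * P = P + (T - 1) * P" using T mult_Suc[of "T - 1" P] by simp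
        then have "ix t d = P + ((T - 1) * P + c)" using c(2) unfolding True by linarith
        then show ?thesis unfolding layout_def em.table_def using len1 lenc by (simp add: nth_append)
      qed
      then show ?thesis using row_nth[of c] c(1) P_def body[of "{Final}" "{Final}"] True by (simp add: cats_def)
    next
      case False
      have tT: "t - 1 < T - 1" "t * P + c = P + ((t - 1) * P + c)" "t * P + c - P = (t - 1) * P + c"
        using False t0 assms(1) by (cases t; simp)+
      have less: "(t - 1) * P + c < (T - 1) * P"
        using mult_le_mono1[of "Suc (t - 1)" "T - 1" P] tT(1) c(1) by simp
      have "layout ! ix t d = concat (replicate (T - 1) (em.row D {General, Keep} {General, Transition})) ! ((t - 1) * P + c)"
        unfolding c(2) layout_def em.table_def using len1 lenc tT less by (simp add: nth_append)
      also have "\<dots> = em.row D {General, Keep} {General, Transition} ! c"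
        using concat_replicate_nth[of "t - 1" "T - 1" c "em.row D {General, Keep} {General, Transition}"] tT(1) c(1)
        by (simp add: lenr)
      finally show ?thesis
        using row_nth[of c] c(1) P_def body[of "{General, Transition}" "{General, Keep}"] t0 False
        by (simp add: cats_def)
    qed
  qed
qed

lemma ix_cases:
  assumes "r < (T + 1) * P"
  obtains t d where "r = ix t d" "t \<le> T" "\<bar>d\<bar> \<le> int D + 1"
proof
  have P: "0 < P" by (simp add: P_def)
  show "r div P \<le> T" using assms P by (simp add: div_less_iff_less_mult less_Suc_eq_le[symmetric])
  have "r mod P < 2 * D + 3" using P mod_less_divisor[of P r] P_def by simp
  then show "\<bar>int (r mod P) - int D - 1\<bar> \<le> int D + 1" by linarith
  show "r = ix (r div P) (int (r mod P) - int D - 1)" by (simp add: ix_def)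
qed

lemma ix_less: "t \<le> T \<Longrightarrow> \<bar>d\<bar> \<le> int D + 1 \<Longrightarrow> ix t d < (T + 1) * P"
proof -
  assume t: "t \<le> T" and d: "\<bar>d\<bar> \<le> int D + 1"
  have "nat (d + int D + 1) < P" using d P_def by linarith
  moreover have "t * P \<le> T * P" using t by (rule mult_le_mono1)
  moreover have "(T + 1) * P = T * P + P" by simp
  ultimately show ?thesis unfolding ix_def by linarith
qed

lemma ix_off_less:
  assumes "t < T" "\<bar>d\<bar> \<le> int D" "e < 5"
  shows "ix t d + off e < (T + 1) * P"
proof -
  have "nat (d + int D + 1) + 1 < P" using assms(2) P_def by linarith
  moreover have "off e \<le> P + 1" using assms(3) by (auto simp: off_def)
  moreover have "t * P + 2 * P \<le> (T + 1) * P" using mult_le_mono1[of "t + 2" "T + 1" P] assms(1) by (simp add: algebra_simps)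
  ultimately show ?thesis by (simp add: ix_def)
qed

lemma Cs_nth: "c < length (templates M) \<Longrightarrow>
    em.Cs ! c = map (\<lambda>(d, a, s). (d, to_nat a, s)) (snd (templates M ! c)) \<and> fst (coded M ! c) = fst (templates M ! c)"
  unfolding em.Cs_def by (simp add: coded_def split: prod.split)

lemma length_Cs: "length em.Cs = length (templates M)"
  unfolding em.Cs_def by (simp add: coded_def)

lemma D_pos: "0 < D"
  using T D by simp

interpretation lc: line_clauses "2 * D + 3" "length layout" "attr_bound M" em.Cs "em.placement layout" "2 ^ digit_width M"
  by (rule em.line_clauses[OF D_pos])

lemma offset_off: "lc.offset e = off e"
  unfolding lc.offset_def off_def using P_def by simp

lemma satisfies_solves:
  assumes "lc.satisfies \<alpha>"
  shows "solves (\<lambda>r a. \<alpha> r (to_nat a))"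
  unfolding solves_def
proof (intro allI impI)
  fix t d ct ls
  assume td: "t \<le> T" "\<bar>d\<bar> \<le> int D" and ls: "(ct, ls) \<in> set (templates M)" and ct: "ct \<in> cats x p T D t d"
  obtain c where c: "c < length (templates M)" "templates M ! c = (ct, ls)" using ls by (auto simp: in_set_conv_nth)
  have "em.placement layout (ix t d) c"
    using c ct td layout_nth[of t d] ix_less[of t d] Cs_nth[OF c(1)] by (simp add: em.placement_def length_layout length_Cs)
  then obtain e n s where "(e, n, s) \<in> set (em.Cs ! c)" "\<alpha> (ix t d + off e) n = s"
    using assms c(1) unfolding lc.satisfies_def offset_off length_Cs by blast
  then obtain a where "(e, a, s) \<in> set ls" "\<alpha> (ix t d + off e) (to_nat a) = s"
    using Cs_nth[OF c(1)] c(2) by auto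
  then show "\<exists>(e, a, s)\<in>set ls. \<alpha> (ix t d + off e) (to_nat a) = s" by blast
qed

text \<open>A literal counts only if its position is on the line. Above the last row there is a next
  row, with its borders; in the last row only \<open>Final\<close> is active, which stays in its own
  cell.\<close>

lemma solves_satisfies:
  assumes "solves \<alpha>"
  shows "lc.satisfies (\<lambda>r n. \<alpha> r (from_nat n))"
  unfolding lc.satisfies_def
proof (intro allI impI)
  fix r c assume "c < length em.Cs" and act: "em.placement layout r c"
  then have c: "c < length (templates M)" by (simp add: length_Cs)
  obtain ct ls where ls: "templates M ! c = (ct, ls)" by (cases "templates M ! c")
  then have mem: "(ct, ls) \<in> set (templates M)" using nth_mem[OF c] by simp
  have "r < (T + 1) * P" using act by (simp add: em.placement_def length_layout)
  then obtain t d where r: "r = ix t d" "t \<le> T" "\<bar>d\<bar> \<le> int D + 1" by (rule ix_cases)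
  have ct: "ct \<in> cats x p T D t d"
    using act layout_nth[OF r(2,3)] Cs_nth[OF c] ls r(1) by (simp add: em.placement_def)
  then have d: "\<bar>d\<bar> \<le> int D" by (simp add: cats_def split: if_splits)
  from solvesD[OF assms mem r(2) d ct] obtain e a s
    where eas: "(e, a, s) \<in> set ls" "\<alpha> (ix t d + off e) a = s" by blast
  have "ix t d + off e < (T + 1) * P"
  proof (cases "t < T")
    case True
    then show ?thesis using ix_off_less[OF True d] templates_wf(4)[OF mem eas(1)] by simp
  next
    case False
    then have "ct = Final" using ct r(2) by (simp add: cats_def split: if_splits)
    then have "e = 0" using templates_wf(5)[OF mem _ eas(1)] by simp
    then show ?thesis using ix_less[OF r(2,3)] by (simp add: off_def)
  qed
  moreover have "(e, to_nat a, s) \<in> set (em.Cs ! c)" using Cs_nth[OF c] ls eas(1) by force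
  ultimately show "\<exists>(e, n, s)\<in>set (em.Cs ! c). r + lc.offset e < length layout \<and> \<alpha> (r + lc.offset e) (from_nat n) = s"
    using eas(2) r(1) by (intro bexI[of _ "(e, to_nat a, s)"]) (simp_all add: offset_off length_layout)
qed

lemma halves_layout: "(\<exists>I. halves (em.weights D layout) I) \<longleftrightarrow> (\<exists>\<alpha>. solves \<alpha>)"
  unfolding em.weights_halves[OF D_pos] using satisfies_solves solves_satisfies by blast

end

context emitter
begin

lemma SHP_instance_weights:
  assumes "L \<noteq> []"
  shows "SHP_instance (weights D L)"
proof -
  define vs where "vs = concat (map (\<lambda>r. map (\<lambda>i. item_weight D r i) (items_at (L ! r))) [0..<length L]) @
    [Falsum_weight D (length L)]"
  have ws: "weights D L = map ((*) 2) vs @ [1]"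
    unfolding weights_def vs_def by (simp add: map_concat comp_def)
  have "0 < Falsum_weight D (length L)"
    unfolding Falsum_weight_def using assms unit_digits(1)[unfolded unit_digits_def]
    by (intro sum_pos2[of _ 0]) simp_all
  then have pos: "\<forall>v\<in>set vs. 0 < v"
    unfolding vs_def using low_less(2) by (fastforce simp: item_weight_def)
  have pos: "vs ! k > 0" if "k < length vs" for k using pos that nth_mem by blast
  have "vs \<noteq> []" by (simp add: vs_def)
  then show ?thesis
    unfolding SHP_instance_def Let_def ws
  proof (intro conjI ballI)
    fix i assume "i \<in> {1..length (map ((*) 2) vs @ [1])}"
    then show "0 < (map ((*) 2) vs @ [1]) ! (i - 1)" using pos[of "i - 1"] by (auto simp: nth_append)
  qed (auto simp: nth_append Suc_le_eq)
qed

end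

lemma poly_mono_nat: "m \<le> n \<Longrightarrow> poly q m \<le> poly q n" for q :: "nat poly"
  by (induction q) (auto intro: add_mono mult_mono)

lemma outputs_within_mono:
  assumes "outputs_within M xs y t" "t \<le> t'"
  shows "outputs_within M xs y t'"
proof -
  obtain ts where "(step M ^^ t) (init M xs) = (states M, ts)" "fst (hd ts) = word_tape y"
    using assms(1) unfolding outputs_within_def by (auto split: prod.splits)
  moreover have "(step M ^^ t') = (step M ^^ (t' - t)) \<circ> (step M ^^ t)"
    using assms(2) by (simp flip: funpow_add)
  ultimately show ?thesis unfolding outputs_within_def by (simp add: step_halt)
qed

text \<open>Value \<open>0\<close> of counter \<open>1\<close> is the marker, so the scan starts at
  value \<open>1\<close>. It stops at the first blank, and the counter is then cleared.\<close>

definition count_input :: com where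
  "count_input = Inc 1 ;; While 1 {1, 2} (Inc 1 ;; Inc 2) ;; Loop 1 Skip"

lemma runs_count_input:
  "runs X count_input (\<lambda>_. 0, y) (1 + ((length (X 1) * 4 + 1) + (Suc (length (X 1)) * 3 + 1)))
    ((\<lambda>_. 0)(2 := length (X 1)), y)"
proof -
  let ?n = "length (X 1)"
  let ?f = "\<lambda>i. (\<lambda>_. 0)(1 := Suc i, 2 := i)"
  have 1: "runs X (Inc 1) (\<lambda>_. 0, y) 1 (?f 0, y)"
    by (rule runs_conv[OF runs_Inc]) (simp_all add: fun_eq_iff)
  have 2: "runs X (While 1 {1, 2} (Inc 1 ;; Inc 2)) (?f 0, y) (?n * (2 + 2) + 1) (?f ?n, y)"
  proof (rule runs_While[where f = ?f and g = "\<lambda>_. y"])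
    fix i assume "i < ?n"
    then show "symb X (?f i) 1 \<in> {1, 2}" by (simp add: symb_def word_tape_def)
    show "runs X (Inc 1 ;; Inc 2) (?f i, y) 2 (?f (Suc i), y)"
      by (rule runs_conv[OF runs_Seq[OF runs_Inc runs_Inc]]) (simp_all add: fun_eq_iff)
  next
    show "symb X (?f ?n) 1 \<notin> {1, 2}" by (simp add: symb_def word_tape_def)
  qed simp
  let ?h = "\<lambda>i. (\<lambda>_. 0)(1 := Suc ?n - i, 2 := ?n)"
  have "runs X (Loop 1 Skip) (?h 0, y) (Suc ?n * (0 + 3) + 1) (?h (Suc ?n), y)"
  proof (rule runs_Loop[where f = ?h and g = "\<lambda>_. y"])
    fix i
    show "runs X Skip ((?h i)(1 := Suc ?n - Suc i), y) 0 (?h (Suc i), y)"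
      by (rule runs_conv[OF runs_Skip]) (simp_all add: fun_eq_iff)
  qed simp_all
  then have 3: "runs X (Loop 1 Skip) (?f ?n, y) (Suc ?n * 3 + 1) ((\<lambda>_. 0)(2 := ?n), y)"
    by (rule runs_conv') (simp_all add: fun_eq_iff)
  show ?thesis
    unfolding count_input_def by (rule runs_conv[OF runs_Seq[OF 1 runs_Seq[OF 2 3]]]) simp_all
qed

text \<open>Counters \<open>6\<close>, \<open>7\<close> and \<open>8\<close> get the number of
  middle rows, the length of certificates and \<open>D\<close>. Counter \<open>4\<close> is to hold
  \<open>D\<close> as well, but it is scratch for \<open>horner\<close>; so the value is prepared in
  counter \<open>10\<close> and moved afterwards. The final \<open>Inc\<close> puts the input head
  on the first letter.\<close>

definition setup_counters :: "nat poly \<Rightarrow> nat poly \<Rightarrow> nat poly \<Rightarrow> com" where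
  "setup_counters q p d = count_input ;; horner (coeffs q) 6 ;; horner (coeffs p) 7 ;; horner (coeffs d) 8 ;;
    horner (coeffs d) 10 ;; Loop 2 Skip ;; Loop 10 (Inc 4) ;; Inc 1"

lemma runs_setup_counters:
  "\<exists>t. pb t \<and> (\<forall>X y. runs X (setup_counters q p d) (\<lambda>_. 0, y) (t (length (X 1)))
    ((\<lambda>_. 0)(1 := 1, 4 := poly d (length (X 1)), 6 := poly q (length (X 1)), 7 := poly p (length (X 1)),
      8 := poly d (length (X 1))), y))"
proof -
  obtain tq where tq: "pb tq" "\<And>X e y a. a = 6 \<Longrightarrow> e a = 0 \<Longrightarrow> e 3 = 0 \<Longrightarrow> e 4 = 0 \<Longrightarrow>
      runs X (horner (coeffs q) a) (e, y) (tq (e 2)) (e(a := poly q (e 2)), y)"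
    using runs_horner[of 6 "coeffs q"] by auto
  obtain tp where tp: "pb tp" "\<And>X e y a. a = 7 \<Longrightarrow> e a = 0 \<Longrightarrow> e 3 = 0 \<Longrightarrow> e 4 = 0 \<Longrightarrow>
      runs X (horner (coeffs p) a) (e, y) (tp (e 2)) (e(a := poly p (e 2)), y)"
    using runs_horner[of 7 "coeffs p"] by auto
  obtain td where td: "pb td" "\<And>X e y a. a = 8 \<Longrightarrow> e a = 0 \<Longrightarrow> e 3 = 0 \<Longrightarrow> e 4 = 0 \<Longrightarrow>
      runs X (horner (coeffs d) a) (e, y) (td (e 2)) (e(a := poly d (e 2)), y)"
    using runs_horner[of 8 "coeffs d"] by auto
  obtain td' where td': "pb td'" "\<And>X e y a. a = 10 \<Longrightarrow> e a = 0 \<Longrightarrow> e 3 = 0 \<Longrightarrow> e 4 = 0 \<Longrightarrow>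
      runs X (horner (coeffs d) a) (e, y) (td' (e 2)) (e(a := poly d (e 2)), y)"
    using runs_horner[of 10 "coeffs d"] by auto
  let ?t = "\<lambda>n. (1 + ((n * 4 + 1) + ((n + 1) * 3 + 1))) + (tq n + (tp n + (td n + (td' n +
    ((n * (0 + 3) + 1) + ((poly d n * (1 + 3) + 1) + 1))))))"
  have "pb ?t" using tq(1) tp(1) td(1) td'(1) by (intro pb_add pb_mult pb_const pb_id pb_poly)
  moreover have "runs X (setup_counters q p d) (\<lambda>_. 0, y) (?t (length (X 1)))
    ((\<lambda>_. 0)(1 := 1, 4 := poly d (length (X 1)), 6 := poly q (length (X 1)), 7 := poly p (length (X 1)),
      8 := poly d (length (X 1))), y)" for X y
  proof -
    define n where "n = length (X 1)"
    define e0 :: "nat \<Rightarrow> nat" where "e0 = (\<lambda>_. 0)(2 := n)"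
    define e1 where "e1 = e0(6 := poly q n)"
    define e2 where "e2 = e1(7 := poly p n)"
    define e3 where "e3 = e2(8 := poly d n)"
    define e4 where "e4 = e3(10 := poly d n)"
    define e5 where "e5 = e4(2 := 0)"
    define e6 where "e6 = e5(10 := 0, 4 := poly d n)"
    have v: "e0 2 = n" "e1 2 = n" "e2 2 = n" "e3 2 = n" "e4 2 = n" "e5 10 = poly d n" "e5 4 = 0"
      by (simp_all add: e0_def e1_def e2_def e3_def e4_def e5_def)
    have 0: "runs X count_input (\<lambda>_. 0, y) (1 + ((n * 4 + 1) + ((n + 1) * 3 + 1))) (e0, y)"
      using runs_count_input[of X y] by (simp add: n_def e0_def)
    have 1: "runs X (horner (coeffs q) 6) (e0, y) (tq n) (e1, y)"
      using tq(2)[of 6 e0 X y] v by (simp add: e0_def e1_def)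
    have 2: "runs X (horner (coeffs p) 7) (e1, y) (tp n) (e2, y)"
      using tp(2)[of 7 e1 X y] v by (simp add: e0_def e1_def e2_def)
    have 3: "runs X (horner (coeffs d) 8) (e2, y) (td n) (e3, y)"
      using td(2)[of 8 e2 X y] v by (simp add: e0_def e1_def e2_def e3_def)
    have 4: "runs X (horner (coeffs d) 10) (e3, y) (td' n) (e4, y)"
      using td'(2)[of 10 e3 X y] v by (simp add: e0_def e1_def e2_def e3_def e4_def)
    have "runs X (Loop 2 Skip) ((\<lambda>i. e4(2 := n - i)) 0, y) (n * (0 + 3) + 1) ((\<lambda>i. e4(2 := n - i)) n, y)"
      by (rule runs_Loop[where g = "\<lambda>_. y"]) (auto intro!: runs_conv[OF runs_Skip])
    then have 5: "runs X (Loop 2 Skip) (e4, y) (n * (0 + 3) + 1) (e5, y)"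
      by (rule runs_conv') (use v in \<open>simp_all add: e5_def fun_upd_idem\<close>)
    let ?D = "poly d n" and ?f = "\<lambda>i. e5(10 := poly d n - i, 4 := i)"
    have "runs X (Loop 10 (Inc 4)) (?f 0, y) (?D * (1 + 3) + 1) (?f ?D, y)"
    proof (rule runs_Loop[where f = ?f and g = "\<lambda>_. y"])
      fix i
      show "runs X (Inc 4) ((?f i)(10 := ?D - Suc i), y) 1 (?f (Suc i), y)"
        by (rule runs_conv[OF runs_Inc]) (simp_all add: fun_eq_iff)
    qed simp_all
    then have 6: "runs X (Loop 10 (Inc 4)) (e5, y) (?D * (1 + 3) + 1) (e6, y)"
      by (rule runs_conv') (use v in \<open>simp_all add: e6_def fun_eq_iff\<close>)
    have 7: "runs X (Inc 1) (e6, y) 1 (e6(1 := Suc (e6 1)), y)" by (rule runs_Inc) simp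
    show ?thesis
      unfolding setup_counters_def n_def[symmetric]
      by (rule runs_conv[OF runs_Seq[OF 0 runs_Seq[OF 1 runs_Seq[OF 2 runs_Seq[OF 3 runs_Seq[OF 4 runs_Seq[OF 5 runs_Seq[OF 6 7]]]]]]]])
        (simp_all add: e0_def e1_def e2_def e3_def e4_def e5_def e6_def fun_eq_iff)
  qed
  ultimately show ?thesis by blast
qed

theorem NP_hard_SHP: "NP_hard SHP"
  unfolding NP_hard_def
proof
  fix L' assume "L' \<in> NP"
  then obtain V :: "word \<Rightarrow> word \<Rightarrow> bool" and p :: "nat poly" where "polytime 2 (\<lambda>xs. [V (xs ! 0) (xs ! 1)])"
    and L': "\<And>x. x \<in> L' \<longleftrightarrow> (\<exists>u. length u \<le> poly p (length x) \<and> V x u)"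
    unfolding NP_def by auto
  then obtain M and q :: "nat poly" where M: "valid_tm M" "2 < tapes M"
    and out: "\<And>xs. length xs = 2 \<Longrightarrow> outputs_within M xs [V (xs ! 0) (xs ! 1)] (poly q (\<Sum>x\<leftarrow>xs. length x))"
    unfolding polytime_def by auto
  define q' where "q' = pcompose q ([:0, 1:] + p)"
  \<comment> \<open>With \<open>T = q' + 1\<close>, which is positive, this is
    \<open>2 * T + p\<close>, enough for both requirements on \<open>D\<close>; there are then
    \<open>q'\<close> middle rows.\<close>
  define d where "d = q' + q' + [:2:] + p"
  have q': "poly q' n = poly q (n + poly p n)" for n by (simp add: q'_def poly_pcompose)
  have d: "poly d n = 2 * Suc (poly q' n) + poly p n" for n by (simp add: d_def)
  interpret em: emitter "coded M" "attr_bound M" "digit_width M" by (rule emitter_templates)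
  let ?GK = "{General, Keep}" and ?GT = "{General, Transition}" and ?F = "{Final}"
  define L where "L x = em.table (poly d (length x)) cell_cats ?GK ?GT ?F x (poly p (length x)) (poly q' (length x))" for x
  define f where "f x = encode (em.weights (poly d (length x)) (L x))" for x
  obtain t where t: "pb t" "\<And>X y. runs X (setup_counters q' p d) (\<lambda>_. 0, y) (t (length (X 1)))
    ((\<lambda>_. 0)(1 := 1, 4 := poly d (length (X 1)), 6 := poly q' (length (X 1)), 7 := poly p (length (X 1)),
      8 := poly d (length (X 1))), y)"
    using runs_setup_counters[of q' p d] by blast
  define N where "N n = (poly q' n + 2) * (2 * poly d n + 3)" for n
  obtain r :: "nat poly" where r: "\<And>n. em.emit_time cell_cats ?GK ?GT ?F n \<le> poly r n"
    using em.pb_emit_time[of cell_cats ?GK ?GT ?F] unfolding pb_def by blast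
  have pbN: "pb N" unfolding N_def by (intro pb_add pb_mult pb_const pb_poly)
  then obtain N' :: "nat poly" where N': "\<And>n. N n \<le> poly N' n" unfolding pb_def by blast
  have "polytime 1 (\<lambda>xs. f (xs ! 0))"
  proof (rule polytimeI)
    show "pb (\<lambda>n. t n + poly (pcompose r N') n)" using t(1) by (intro pb_add pb_poly)
    fix xs :: "word list" assume "length xs = 1"
    then obtain x where xs: "xs = [x]" by (cases xs) auto
    let ?X = "inputs xs" and ?n = "length x"
    have X1: "?X 1 = x" by (simp add: inputs_def xs)
    let ?e = "(\<lambda>_. 0)(1 := 1, 4 := poly d ?n, 6 := poly q' ?n, 7 := poly p ?n, 8 := poly d ?n) :: nat \<Rightarrow> nat"
    have 1: "runs ?X (setup_counters q' p d) (\<lambda>_. 0, []) (t ?n) (?e, [])"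
      using t(2)[of ?X "[]"] unfolding X1 .
    obtain e' where 2: "runs ?X (em.emit_all cell_cats ?GK ?GT ?F) (?e, []) (em.emit_time cell_cats ?GK ?GT ?F (N ?n)) (e', f x)"
      using em.runs_emit_all[of ?e "poly d ?n" "poly p ?n" "poly q' ?n" "N ?n" ?X cell_cats ?GK ?GT ?F]
      unfolding X1 f_def L_def N_def by auto
    have "em.emit_time cell_cats ?GK ?GT ?F (N ?n) \<le> poly r (poly N' ?n)"
      using r[of "N ?n"] poly_mono_nat[OF N'] le_trans by blast
    then have time: "t ?n + em.emit_time cell_cats ?GK ?GT ?F (N ?n) \<le> t ?n + poly (pcompose r N') ?n"
      by (simp add: poly_pcompose)
    have sum: "(\<Sum>x\<leftarrow>xs. length x) = ?n" and x: "f (xs ! 0) = f x" by (simp_all add: xs)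
    show "\<exists>e. runs ?X (setup_counters q' p d ;; em.emit_all cell_cats ?GK ?GT ?F) (\<lambda>_. 0, [])
        (t (\<Sum>x\<leftarrow>xs. length x) + poly (pcompose r N') (\<Sum>x\<leftarrow>xs. length x)) (e, f (xs ! 0))"
      unfolding sum x
    proof
      show "runs ?X (setup_counters q' p d ;; em.emit_all cell_cats ?GK ?GT ?F) (\<lambda>_. 0, [])
        (t ?n + poly (pcompose r N') ?n) (e', f x)"
        by (rule runs_mono[OF runs_Seq[OF 1 2] time])
    qed
  qed
  moreover have "x \<in> L' \<longleftrightarrow> f x \<in> SHP" for x
  proof -
    let ?n = "length x"
    let ?D = "poly d ?n" and ?T = "Suc (poly q' ?n)" and ?p = "poly p ?n"
    interpret tab: tableau M x ?p ?T ?D "2 * ?D + 3"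
      by unfold_locales (use M d[of ?n] in auto)
    have L: "tab.layout = L x" unfolding tab.layout_def L_def by simp
    have "outputs_within M [x, u] [V x u] ?T" if "length u \<le> ?p" for u
    proof -
      have "poly q (?n + length u) \<le> poly q (?n + ?p)" by (rule poly_mono_nat) (rule add_left_mono[OF that])
      also have "\<dots> \<le> ?T" unfolding q' by (rule le_SucI) (rule order_refl)
      finally have "poly q (?n + length u) \<le> ?T" .
      moreover have "outputs_within M [x, u] [V x u] (poly q (?n + length u))"
        using out[of "[x, u]"] by simp
      ultimately show ?thesis by (rule outputs_within_mono[rotated])
    qed
    from tab.solvable_iff[OF this] have "x \<in> L' \<longleftrightarrow> (\<exists>\<alpha>. tab.solves \<alpha>)" by (simp add: L')
    also have "\<dots> \<longleftrightarrow> (\<exists>I. halves (em.weights ?D (L x)) I)" using tab.halves_layout by (simp add: L)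
    also have "\<dots> \<longleftrightarrow> f x \<in> SHP"
    proof -
      have "length (L x) = (poly q' ?n + 2) * (2 * ?D + 3)" unfolding L_def by (rule em.length_table)
      then have "L x \<noteq> []" by auto
      then have inst: "SHP_instance (em.weights ?D (L x))" by (rule em.SHP_instance_weights)
      have "f x \<in> SHP \<longleftrightarrow> SHP_question (em.weights ?D (L x))"
        unfolding SHP_def f_def using inst injD[OF inj_encode] by blast
      then show ?thesis using SHP_question_iff[OF inst] by simp
    qed
    finally show ?thesis .
  qed
  ultimately show "poly_reducible L' SHP" unfolding poly_reducible_def by blast
qed

section \<open>Membership in NP\<close>

definition numerals_word :: "bool list list \<Rightarrow> word" where
  "numerals_word bss = concat (map (\<lambda>bs. enc bs @ [False]) bss)"

lemma numerals_word_simps [simp]: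
  "numerals_word [] = []" "numerals_word (bs # bss) = enc bs @ False # numerals_word bss"
  by (simp_all add: numerals_word_def)

definition even_numeral :: "bool list \<Rightarrow> bool" where
  "even_numeral bs \<longleftrightarrow> bs \<noteq> [] \<and> \<not> hd bs \<and> last bs"

fun numerals :: "bool list list \<Rightarrow> bool" where
  "numerals [] = False"
| "numerals [bs] = (bs = [True])"
| "numerals (bs # bss) = (even_numeral bs \<and> numerals bss)"

lemma numerals_Cons: "bss \<noteq> [] \<Longrightarrow> numerals (bs # bss) \<longleftrightarrow> even_numeral bs \<and> numerals bss"
  by (cases bss) simp_all

text \<open>A finite automaton recognizes the instances: state \<open>8\<close> is accepting and \<open>9\<close> is a dead state.\<close>

definition next_state :: "nat \<Rightarrow> bool \<Rightarrow> nat" where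
  "next_state q b = (if b then [1, 9, 3, 4, 3, 9, 7, 5, 9, 9] ! q else [9, 2, 9, 2, 6, 8, 9, 2, 9, 9] ! q)"

lemma next_state_less: "q < 10 \<Longrightarrow> next_state q b < 10"
  unfolding next_state_def by (cases b) (auto simp: eval_nat_numeral less_Suc_eq)

text \<open>Describes the remainders that are accepted from \<open>q\<close>: \<open>0\<close> is
  the start, \<open>6\<close> the start of a later number, and \<open>1\<close> and \<open>7\<close>
  follow the first digit marker there; \<open>2\<close> and \<open>4\<close> are inside a number
  whose last digit was zero or one; \<open>3\<close> awaits a further digit; \<open>5\<close> has
  seen a lowest digit one, so that only the end of the final number \<open>1\<close> may
  follow.\<close>

definition suffix_of :: "nat \<Rightarrow> word \<Rightarrow> bool" where
  "suffix_of q x \<longleftrightarrow>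
    (if q = 0 then \<exists>bs bss. even_numeral bs \<and> numerals bss \<and> x = numerals_word (bs # bss)
     else if q = 1 then \<exists>bs bss. bs \<noteq> [] \<and> last bs \<and> numerals bss \<and> x = False # numerals_word (bs # bss)
     else if q = 2 then \<exists>bs bss. bs \<noteq> [] \<and> last bs \<and> numerals bss \<and> x = numerals_word (bs # bss)
     else if q = 3 then \<exists>b bs bss. last (b # bs) \<and> numerals bss \<and> x = b # numerals_word (bs # bss)
     else if q = 4 then \<exists>bs bss. (bs = [] \<or> last bs) \<and> numerals bss \<and> x = numerals_word (bs # bss)
     else if q = 5 then x = [False]
     else if q = 6 then \<exists>bss. numerals bss \<and> x = numerals_word bss
     else if q = 7 then x = [True, False] \<or>
       (\<exists>bs bss. bs \<noteq> [] \<and> last bs \<and> numerals bss \<and> x = False # numerals_word (bs # bss))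
     else q = 8 \<and> x = [])"

lemma suffix_of_step:
  assumes "q < 10" "suffix_of (next_state q b) x"
  shows "suffix_of q (b # x)"
proof -
  consider "q = 0" | "q = 1" | "q = 2" | "q = 3" | "q = 4" | "q = 5" | "q = 6" | "q = 7" | "q = 8" | "q = 9"
    using assms(1) by (auto simp: eval_nat_numeral less_Suc_eq)
  then show ?thesis
  proof cases
    case 1
    show ?thesis
    proof (cases b)
      case True
      then obtain bs bss where "bs \<noteq> []" "last bs" "numerals bss" "x = False # numerals_word (bs # bss)"
        using assms(2) 1 by (auto simp: suffix_of_def next_state_def)
      then have "even_numeral (False # bs) \<and> numerals bss \<and> True # x = numerals_word ((False # bs) # bss)"
        by (simp add: even_numeral_def)
      then have "\<exists>bs bss. even_numeral bs \<and> numerals bss \<and> True # x = numerals_word (bs # bss)" by blast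
      then show ?thesis using 1 True unfolding suffix_of_def by simp
    qed (use assms(2) 1 in \<open>simp add: suffix_of_def next_state_def\<close>)
  next
    case 2
    then show ?thesis using assms(2) by (cases b) (simp_all add: suffix_of_def next_state_def)
  next
    case 3
    show ?thesis
    proof (cases b)
      case True
      then obtain d bs bss where "last (d # bs)" "numerals bss" "x = d # numerals_word (bs # bss)"
        using assms(2) 3 by (auto simp: suffix_of_def next_state_def)
      then have "d # bs \<noteq> [] \<and> last (d # bs) \<and> numerals bss \<and> True # x = numerals_word ((d # bs) # bss)"
        by simp
      then have "\<exists>bs bss. bs \<noteq> [] \<and> last bs \<and> numerals bss \<and> True # x = numerals_word (bs # bss)" by blast
      then show ?thesis using 3 True unfolding suffix_of_def by simp
    qed (use assms(2) 3 in \<open>simp add: suffix_of_def next_state_def\<close>)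
  next
    case 4
    have "\<exists>bs bss. last (b # bs) \<and> numerals bss \<and> b # x = b # numerals_word (bs # bss)"
      if "bs = [] \<and> b \<or> bs \<noteq> [] \<and> last bs" "numerals bss" "x = numerals_word (bs # bss)" for bs bss
      using that by (intro exI[of _ bs] exI[of _ bss]) auto
    moreover have "\<exists>bs bss. (bs = [] \<and> b \<or> bs \<noteq> [] \<and> last bs) \<and> numerals bss \<and> x = numerals_word (bs # bss)"
      using assms(2) 4 by (cases b) (auto simp: suffix_of_def next_state_def)
    ultimately have "\<exists>d bs bss. last (d # bs) \<and> numerals bss \<and> b # x = d # numerals_word (bs # bss)" by blast
    then show ?thesis using 4 by (simp add: suffix_of_def del: last.simps numerals_word_simps list.inject)
  next
    case 5
    show ?thesis
    proof (cases b)
      case True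
      then obtain d bs bss where "last (d # bs)" "numerals bss" "x = d # numerals_word (bs # bss)"
        using assms(2) 5 by (auto simp: suffix_of_def next_state_def)
      then have "(d # bs = [] \<or> last (d # bs)) \<and> numerals bss \<and> True # x = numerals_word ((d # bs) # bss)"
        by simp
      then have "\<exists>bs bss. (bs = [] \<or> last bs) \<and> numerals bss \<and> True # x = numerals_word (bs # bss)" by blast
      then show ?thesis using 5 True unfolding suffix_of_def by simp
    next
      case False
      then obtain bss where "numerals bss" "x = numerals_word bss"
        using assms(2) 5 by (auto simp: suffix_of_def next_state_def)
      then have "([] = [] \<or> last []) \<and> numerals bss \<and> False # x = numerals_word ([] # bss)" by simp
      then have "\<exists>bs bss. (bs = [] \<or> last bs) \<and> numerals bss \<and> False # x = numerals_word (bs # bss)" by blast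
      then show ?thesis using 5 False unfolding suffix_of_def by simp
    qed
  next
    case 6
    then show ?thesis using assms(2) by (cases b) (simp_all add: suffix_of_def next_state_def)
  next
    case 7
    show ?thesis
    proof (cases b)
      case True
      then consider "x = [True, False]" | bs bss where "bs \<noteq> []" "last bs" "numerals bss" "x = False # numerals_word (bs # bss)"
        using assms(2) 7 by (auto simp: suffix_of_def next_state_def)
      then have "\<exists>bss. numerals bss \<and> True # x = numerals_word bss"
      proof cases
        case 1
        then have "numerals [[True]] \<and> True # x = numerals_word [[True]]" by simp
        then show ?thesis by blast
      next
        case (2 bs bss)
        then have "bss \<noteq> []" by auto
        then have "numerals ((False # bs) # bss) \<and> True # x = numerals_word ((False # bs) # bss)"
          using 2 by (simp add: numerals_Cons even_numeral_def)
        then show ?thesis by blast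
      qed
      then show ?thesis using 7 True by (simp add: suffix_of_def)
    qed (use assms(2) 7 in \<open>simp add: suffix_of_def next_state_def\<close>)
  next
    case 8
    then show ?thesis using assms(2) by (cases b) (simp_all add: suffix_of_def next_state_def)
  next
    case 9
    then show ?thesis using assms(2) by (cases b) (simp_all add: suffix_of_def next_state_def)
  next
    case 10
    then show ?thesis using assms(2) by (cases b) (simp_all add: suffix_of_def next_state_def)
  qed
qed

lemma accepted_imp_suffix_of: "q < 10 \<Longrightarrow> foldl next_state q x = 8 \<Longrightarrow> suffix_of q x"
proof (induction x arbitrary: q)
  case (Cons b x)
  then show ?case using suffix_of_step[of q b x] next_state_less[of q b] by simp
qed (simp add: suffix_of_def)

lemma foldl_enc:
  "bs \<noteq> [] \<Longrightarrow> q \<in> {2, 4} \<Longrightarrow> foldl next_state q (enc bs) = (if last bs then 4 else 2)"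
proof (induction bs arbitrary: q)
  case (Cons b bs)
  have "foldl next_state q [True, b] = (if b then 4 else 2)"
    using Cons.prems(2) by (auto simp: next_state_def)
  then show ?case using Cons.IH[of "if b then 4 else 2"] by (cases "bs = []") auto
qed simp

lemma foldl_even_numeral:
  assumes "even_numeral bs" "q \<in> {0, 6}"
  shows "foldl next_state q (enc bs @ [False]) = 6"
proof -
  obtain cs where cs: "bs = False # cs" "cs \<noteq> []" "last cs"
    using assms(1) by (cases bs) (auto simp: even_numeral_def split: if_splits)
  have "foldl next_state q [True, False] = 2" using assms(2) by (auto simp: next_state_def)
  then show ?thesis using foldl_enc[of cs 2] cs by (simp add: next_state_def)
qed

lemma foldl_numerals: "numerals bss \<Longrightarrow> foldl next_state 6 (numerals_word bss) = 8"
proof (induction bss rule: numerals.induct)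
  case (2 bs)
  then show ?case by (simp add: next_state_def)
next
  case (3 bs bs' bss)
  then show ?case using foldl_even_numeral[of bs 6] by simp
qed simp

text \<open>The separate start state \<open>0\<close> rules out the number \<open>1\<close> as first
  entry and thereby lists of length one.\<close>

lemma accepted_iff:
  "foldl next_state 0 x = 8 \<longleftrightarrow> (\<exists>bss. numerals bss \<and> 2 \<le> length bss \<and> x = numerals_word bss)"
proof
  assume "foldl next_state 0 x = 8"
  then obtain bs bss where bss: "even_numeral bs" "numerals bss" "x = numerals_word (bs # bss)"
    using accepted_imp_suffix_of[of 0 x] by (auto simp: suffix_of_def)
  then have "bss \<noteq> []" by auto
  then have "numerals (bs # bss) \<and> 2 \<le> length (bs # bss) \<and> x = numerals_word (bs # bss)"
    using bss by (cases bss) (simp_all add: numerals_Cons)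
  then show "\<exists>bss. numerals bss \<and> 2 \<le> length bss \<and> x = numerals_word bss" by blast
next
  assume "\<exists>bss. numerals bss \<and> 2 \<le> length bss \<and> x = numerals_word bss"
  then obtain bs bs' bss where "numerals (bs # bs' # bss)" "x = numerals_word (bs # bs' # bss)"
    by (metis Suc_le_length_iff numeral_2_eq_2)
  then show "foldl next_state 0 x = 8"
    using foldl_even_numeral[of bs 0] foldl_numerals[of "bs' # bss"] by simp
qed

lemma numerals_binary:
  "numerals (map binary ws) \<longleftrightarrow> ws \<noteq> [] \<and> last ws = 1 \<and> (\<forall>w\<in>set (butlast ws). 0 < w \<and> even w)"
proof (induction ws)
  case (Cons w ws)
  show ?case
  proof (cases "ws = []")
    case True
    have "binary 1 = [True]" by (subst binary_pos) simp_all
    moreover have "w = 1" if "binary w = [True]" using horner_sum_binary[of w] unfolding that by simp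
    ultimately have "binary w = [True] \<longleftrightarrow> w = 1" by blast
    then show ?thesis using True by simp
  next
    case False
    have "even_numeral (binary w) \<longleftrightarrow> 0 < w \<and> even w"
    proof (cases "w = 0")
      case False
      then show ?thesis using last_binary[of w] binary_pos[of w] by (simp add: even_numeral_def)
    qed (simp add: even_numeral_def)
    then show ?thesis using False Cons.IH by (auto simp: numerals_Cons)
  qed
qed simp

lemma SHP_instance_numerals:
  "SHP_instance ws \<longleftrightarrow> 2 \<le> length ws \<and> numerals (map binary ws)"
proof (cases "2 \<le> length ws")
  case True
  then have ne: "ws \<noteq> []" by auto
  have last: "last ws = ws ! (length ws - 1)" using ne by (rule last_conv_nth)
  have "(\<forall>w\<in>set (butlast ws). 0 < w \<and> even w) \<longleftrightarrow> (\<forall>i<length ws - 1. 0 < ws ! i \<and> even (ws ! i))"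
    by (simp add: all_set_conv_all_nth nth_butlast)
  also have "\<dots> \<longleftrightarrow> (\<forall>i\<in>{1..length ws - 1}. 0 < ws ! (i - 1) \<and> even (ws ! (i - 1)))"
  proof
    assume *: "\<forall>i\<in>{1..length ws - 1}. 0 < ws ! (i - 1) \<and> even (ws ! (i - 1))"
    show "\<forall>i<length ws - 1. 0 < ws ! i \<and> even (ws ! i)"
    proof (intro allI impI)
      fix i assume "i < length ws - 1"
      then show "0 < ws ! i \<and> even (ws ! i)" using *[rule_format, of "Suc i"] by simp
    qed
  qed auto
  finally have 1: "numerals (map binary ws) \<longleftrightarrow> ws ! (length ws - 1) = 1 \<and>
      (\<forall>i\<in>{1..length ws - 1}. 0 < ws ! (i - 1) \<and> even (ws ! (i - 1)))"
    using numerals_binary[of ws] ne last by simp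
  have "{1..length ws} = insert (length ws) {1..length ws - 1}" using True by auto
  then show ?thesis unfolding SHP_instance_def Let_def 1 using True by auto
next
  case False
  then show ?thesis by (simp add: SHP_instance_def Let_def)
qed

lemma numerals_last: "numerals bss \<Longrightarrow> bs \<in> set bss \<Longrightarrow> bs \<noteq> [] \<and> last bs"
  by (induction bss rule: numerals.induct) (auto simp: even_numeral_def)

lemma accepted_iff_instance:
  "foldl next_state 0 x = 8 \<longleftrightarrow> (\<exists>ws. SHP_instance ws \<and> x = encode ws)"
proof -
  have "(\<exists>bss. numerals bss \<and> 2 \<le> length bss \<and> x = numerals_word bss) \<longleftrightarrow>
      (\<exists>ws. 2 \<le> length ws \<and> numerals (map binary ws) \<and> x = numerals_word (map binary ws))"
  proof
    assume "\<exists>bss. numerals bss \<and> 2 \<le> length bss \<and> x = numerals_word bss"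
    then obtain bss where bss: "numerals bss" "2 \<le> length bss" "x = numerals_word bss" by blast
    have "map binary (map bits_value bss) = bss"
      using numerals_last[OF bss(1)] by (auto simp: binary_bits_value intro!: map_idI)
    then show "\<exists>ws. 2 \<le> length ws \<and> numerals (map binary ws) \<and> x = numerals_word (map binary ws)"
      using bss by (intro exI[of _ "map bits_value bss"]) simp
  next
    assume "\<exists>ws. 2 \<le> length ws \<and> numerals (map binary ws) \<and> x = numerals_word (map binary ws)"
    then show "\<exists>bss. numerals bss \<and> 2 \<le> length bss \<and> x = numerals_word bss" by (metis length_map)
  qed
  moreover have "numerals_word (map binary ws) = encode ws" for ws
    by (simp add: numerals_word_def encode_def encode_nat_enc[abs_def] comp_def)
  ultimately show ?thesis unfolding accepted_iff SHP_instance_numerals by auto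
qed

section \<open>Certificates and the comparison of two sums\<close>

definition selected :: "word \<Rightarrow> nat \<Rightarrow> bool" where
  "selected u i \<longleftrightarrow> i < length u \<and> u ! i"

text \<open>Halving drops the last weight \<open>1\<close>, so that it does not matter whether it is selected.\<close>

definition half_sum :: "nat list \<Rightarrow> (nat \<Rightarrow> bool) \<Rightarrow> nat" where
  "half_sum ws P = (\<Sum>i | i < length ws \<and> P i. ws ! i div 2)"

lemma halves_half_sum:
  assumes "SHP_instance ws"
  shows "(\<exists>I. halves ws I) \<longleftrightarrow> (\<exists>u. length u \<le> length ws \<and>
    half_sum ws (selected u) = half_sum ws (\<lambda>i. \<not> selected u i))"
proof -
  obtain n where n: "length ws = Suc n" using assms unfolding SHP_instance_def Let_def by (cases ws) auto
  have inst: "even (ws ! (i - 1))" if "i \<in> {1..n}" for i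
    using assms that n unfolding SHP_instance_def Let_def by simp
  have last: "ws ! n = 1" using assms n unfolding SHP_instance_def Let_def by simp
  define a where "a i = ws ! i div 2" for i
  have a: "ws ! i = 2 * a i" if "i < n" for i
    using inst[of "Suc i"] that by (simp add: a_def)
  have sum: "half_sum ws P = sum a {i. i < n \<and> P i}" for P
    unfolding half_sum_def a_def[symmetric] n
    by (rule sum.mono_neutral_right) (auto simp: a_def last less_Suc_eq)
  have total: "sum a {i. i < n \<and> P i} + sum a {i. i < n \<and> \<not> P i} = sum a {..<n}" for P
    by (subst sum.union_disjoint[symmetric]) (auto intro!: sum.cong)
  have halves: "halves ws (Suc ` J) \<longleftrightarrow> 2 * sum a J = sum a {..<n}" if "J \<subseteq> {..<n}" for J
  proof -
    have "(\<Sum>i\<in>Suc ` K. ws ! (i - 1)) = 2 * sum a K" if "K \<subseteq> {..<n}" for K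
      using that a by (subst sum.reindex) (auto simp: sum_distrib_left intro!: sum.cong)
    moreover have "{1..<length ws} = Suc ` {..<n}"
      by (simp add: n lessThan_atLeast0)
    ultimately show ?thesis using that unfolding halves_def by auto
  qed
  show ?thesis
  proof
    assume "\<exists>I. halves ws I"
    then obtain I where I: "halves ws I" by blast
    define J where "J = {i. i < n \<and> Suc i \<in> I}"
    have "I \<subseteq> {1..<Suc n}" using I unfolding halves_def n by blast
    then have "x \<in> I \<Longrightarrow> x \<in> Suc ` J" for x by (cases x) (auto simp: J_def)
    then have "I = Suc ` J" by (auto simp: J_def)
    then have J: "2 * sum a J = sum a {..<n}" using I halves[of J] unfolding J_def by auto
    define u where "u = map (\<lambda>i. i \<in> J) [0..<n]"
    have u: "selected u i \<longleftrightarrow> i \<in> J" for i by (auto simp: selected_def u_def J_def)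
    have "{i. i < n \<and> i \<in> J} = J" by (auto simp: J_def)
    then have "half_sum ws (selected u) = half_sum ws (\<lambda>i. \<not> selected u i)"
      using J total[of "\<lambda>i. i \<in> J"] unfolding sum u by simp
    then show "\<exists>u. length u \<le> length ws \<and> half_sum ws (selected u) = half_sum ws (\<lambda>i. \<not> selected u i)"
      using n by (intro exI[of _ u]) (simp add: u_def)
  next
    assume "\<exists>u. length u \<le> length ws \<and> half_sum ws (selected u) = half_sum ws (\<lambda>i. \<not> selected u i)"
    then obtain u where u: "half_sum ws (selected u) = half_sum ws (\<lambda>i. \<not> selected u i)" by blast
    have "halves ws (Suc ` {i. i < n \<and> selected u i})"
      by (subst halves) (use u total[of "selected u"] in \<open>auto simp: sum\<close>)
    then show "\<exists>I. halves ws I" by blast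
  qed
qed

definition verifies :: "word \<Rightarrow> word \<Rightarrow> bool" where
  "verifies x u \<longleftrightarrow> (\<exists>ws. SHP_instance ws \<and> x = encode ws \<and>
    half_sum ws (selected u) = half_sum ws (\<lambda>i. \<not> selected u i))"

lemma length_encode: "length ws \<le> length (encode ws)"
  by (induction ws) (simp_all add: encode_def encode_nat_enc)

lemma SHP_verifies: "x \<in> SHP \<longleftrightarrow> (\<exists>u. length u \<le> length x \<and> verifies x u)"
proof
  assume "x \<in> SHP"
  then obtain ws where ws: "x = encode ws" "SHP_instance ws" "SHP_question ws"
    unfolding SHP_def by blast
  then obtain u where u: "length u \<le> length ws" "half_sum ws (selected u) = half_sum ws (\<lambda>i. \<not> selected u i)"
    using SHP_question_iff halves_half_sum by blast
  have "length u \<le> length x" using u(1) length_encode[of ws] ws(1) by simp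
  then show "\<exists>u. length u \<le> length x \<and> verifies x u"
    unfolding verifies_def using ws u(2) by blast
next
  assume "\<exists>u. length u \<le> length x \<and> verifies x u"
  then obtain u ws where ws: "SHP_instance ws" "x = encode ws"
    and u: "half_sum ws (selected u) = half_sum ws (\<lambda>i. \<not> selected u i)"
    unfolding verifies_def by blast
  \<comment> \<open>A given certificate may be longer than the list of weights; it is cut or filled
    up to that length, which selects the same weights.\<close>
  define u' where "u' = map (selected u) [0..<length ws]"
  have "selected u' i \<longleftrightarrow> selected u i" if "i < length ws" for i
    using that by (simp add: u'_def selected_def)
  then have "half_sum ws (selected u') = half_sum ws (selected u)"
    "half_sum ws (\<lambda>i. \<not> selected u' i) = half_sum ws (\<lambda>i. \<not> selected u i)"
    unfolding half_sum_def by (auto intro!: sum.cong)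
  then have "\<exists>I. halves ws I"
    unfolding halves_half_sum[OF ws(1)] using u by (intro exI[of _ u']) (simp add: u'_def)
  then show "x \<in> SHP" using ws SHP_question_iff[OF ws(1)] unfolding SHP_def by blast
qed

text \<open>The carry into binary column \<open>c\<close> in closed form: what the parts of the
  summands below that column contribute to it.\<close>

definition carry :: "nat set \<Rightarrow> (nat \<Rightarrow> nat) \<Rightarrow> nat \<Rightarrow> nat" where
  "carry S a c = (\<Sum>i\<in>S. a i mod 2 ^ c) div 2 ^ c"

definition column :: "nat set \<Rightarrow> (nat \<Rightarrow> nat) \<Rightarrow> nat \<Rightarrow> nat" where
  "column S a c = card {i \<in> S. odd (a i div 2 ^ c)}"

lemma carry_0 [simp]: "carry S a 0 = 0"
  by (simp add: carry_def)

lemma carry_column: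
  assumes "finite S"
  shows "carry S a c + column S a c = (\<Sum>i\<in>S. a i mod 2 ^ Suc c) div 2 ^ c"
proof -
  have "a i mod 2 ^ Suc c = a i mod 2 ^ c + 2 ^ c * of_bool (odd (a i div 2 ^ c))" for i
    using mod_mult2_eq[of "a i" "2 ^ c" 2] by (simp add: mod2_eq_if mult.commute)
  then have "(\<Sum>i\<in>S. a i mod 2 ^ Suc c) =
      (\<Sum>i\<in>S. a i mod 2 ^ c) + 2 ^ c * (\<Sum>i\<in>S. of_bool (odd (a i div 2 ^ c)))"
    by (simp add: sum.distrib sum_distrib_left)
  also have "(\<Sum>i\<in>S. of_bool (odd (a i div 2 ^ c))) = column S a c"
    using assms by (simp add: column_def of_bool_def sum.If_cases Int_def)
  finally show ?thesis by (simp add: carry_def)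
qed

lemma carry_Suc:
  assumes "finite S"
  shows "carry S a (Suc c) = (carry S a c + column S a c) div 2"
  unfolding carry_column[OF assms] unfolding carry_def by (simp add: power_Suc2 div_mult2_eq del: power_Suc)

text \<open>Extends the low part of the sum by one bit, the parity of the incoming carry plus the
  ones of the column; so sums can be compared without being computed.\<close>

lemma sum_bit:
  assumes "finite S"
  shows "sum a S mod 2 ^ Suc c = sum a S mod 2 ^ c + 2 ^ c * ((carry S a c + column S a c) mod 2)"
proof -
  have "sum a S mod 2 ^ Suc c = (\<Sum>i\<in>S. a i mod 2 ^ Suc c) mod 2 ^ Suc c"
    by (simp add: mod_sum_eq)
  also have "\<dots> = (\<Sum>i\<in>S. a i mod 2 ^ Suc c) mod 2 ^ c +
      2 ^ c * ((\<Sum>i\<in>S. a i mod 2 ^ Suc c) div 2 ^ c mod 2)"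
    using mod_mult2_eq[of _ "2 ^ c" 2] by (simp add: mult.commute)
  also have "(\<Sum>i\<in>S. a i mod 2 ^ Suc c) mod 2 ^ c = (\<Sum>i\<in>S. a i mod 2 ^ Suc c mod 2 ^ c) mod 2 ^ c"
    by (simp add: mod_sum_eq)
  also have "\<dots> = sum a S mod 2 ^ c"
    by (simp add: mod_mod_cancel mod_sum_eq)
  finally show ?thesis by (simp add: carry_column[OF assms])
qed

text \<open>Counting the differing bits, rather than recording that there is one, needs only
  increments and a final test for zero.\<close>

definition mismatches :: "nat set \<Rightarrow> nat set \<Rightarrow> (nat \<Rightarrow> nat) \<Rightarrow> nat \<Rightarrow> nat" where
  "mismatches S T a n = card {c. c < n \<and> (carry S a c + column S a c) mod 2 \<noteq> (carry T a c + column T a c) mod 2}"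

lemma mismatches_0 [simp]: "mismatches S T a 0 = 0"
  by (simp add: mismatches_def)

lemma mismatches_Suc: "mismatches S T a (Suc n) = mismatches S T a n +
    (if (carry S a n + column S a n) mod 2 \<noteq> (carry T a n + column T a n) mod 2 then 1 else 0)"
proof -
  have "{c. c < Suc n \<and> P c} = (if P n then insert n {c. c < n \<and> P c} else {c. c < n \<and> P c})" for P
    by (auto simp: less_Suc_eq)
  then show ?thesis unfolding mismatches_def by simp
qed

lemma mismatches_eq_0_iff:
  assumes "finite S" "finite T"
  shows "mismatches S T a n = 0 \<longleftrightarrow> sum a S mod 2 ^ n = sum a T mod 2 ^ n"
proof (induction n)
  case (Suc n)
  have eq: "x + 2 ^ n * b = y + 2 ^ n * d \<longleftrightarrow> x = y \<and> b = d" if "x < 2 ^ n" "y < 2 ^ n" for x y b d :: nat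
  proof
    assume *: "x + 2 ^ n * b = y + 2 ^ n * d"
    have "b = (x + 2 ^ n * b) div 2 ^ n" "d = (y + 2 ^ n * d) div 2 ^ n"
      "x = (x + 2 ^ n * b) mod 2 ^ n" "y = (y + 2 ^ n * d) mod 2 ^ n" using that by simp_all
    then show "x = y \<and> b = d" unfolding * by simp
  qed simp
  show ?case
    unfolding mismatches_Suc sum_bit[OF assms(1)] sum_bit[OF assms(2)] using Suc.IH by (subst eq) auto
qed simp

text \<open>Each number is below \<open>2\<close> to the length of its code, and the codes are
  concatenated. So it is enough to compare as many columns as the input word has letters.\<close>

lemma half_sum_bound:
  "half_sum ws P < 2 ^ length (encode ws)"
proof -
  have "half_sum ws P \<le> (\<Sum>i<length ws. ws ! i)"
    unfolding half_sum_def by (rule order.trans[OF sum_mono sum_mono2]) auto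
  also have "\<dots> = sum_list ws" by (simp add: sum_list_sum_nth atLeast0LessThan)
  also have "\<dots> < 2 ^ length (encode ws)"
  proof (induction ws)
    case (Cons w ws)
    let ?l = "length (encode_nat w)" and ?m = "length (encode ws)"
    have "horner_sum of_bool (2 :: nat) bs < 2 ^ length bs" for bs
      by (induction bs) (auto split: bool.split)
    from this[of "binary w"] have "w < 2 ^ length (binary w)" by (simp add: horner_sum_binary)
    also have "\<dots> \<le> 2 ^ ?l" by (rule power_increasing) (simp_all add: encode_nat_enc)
    finally have w: "w + 1 \<le> 2 ^ ?l" by simp
    have s: "sum_list ws + 1 \<le> 2 ^ ?m" using Cons.IH by simp
    have "w + sum_list ws + 1 \<le> (w + 1) * (sum_list ws + 1)" by simp
    also have "\<dots> \<le> 2 ^ ?l * 2 ^ ?m" using w s by (rule mult_le_mono)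
    finally show ?case by (simp add: encode_def power_add)
  qed (simp add: encode_def)
  finally show ?thesis .
qed

section \<open>The verifier as a counter program\<close>

fun switch :: "nat \<Rightarrow> com list \<Rightarrow> com" where
  "switch k [] = Skip"
| "switch k (c # cs) = Branch k {3} c (Dec k ;; switch k cs)"

text \<open>The selecting counter is used up by the selection, so each case starts with it at
  zero.\<close>

lemma runs_switch:
  assumes "0 < k" "e k < length cs" "runs X (cs ! e k) (e(k := 0), y) t s"
  shows "runs X (switch k cs) (e, y) (3 * length cs + t) s"
  using assms(2,3)
proof (induction cs arbitrary: e)
  case (Cons c cs)
  show ?case
  proof (cases "e k")
    case 0
    then have "e(k := 0) = e" by auto
    then have "runs X (Branch k {3} c (Dec k ;; switch k cs)) (e, y) (t + 2) s"
      using Cons.prems 0 assms(1) by (intro runs_BranchTrue) simp_all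
    then show ?thesis unfolding switch.simps by (rule runs_mono) simp
  next
    case (Suc j)
    have "runs X (switch k cs) (e(k := j), y) (3 * length cs + t) s"
    proof (rule Cons.IH)
      show "runs X (cs ! (e(k := j)) k) ((e(k := j))(k := 0), y) t s"
        using Cons.prems(2) unfolding fun_upd_upd fun_upd_same Suc nth_Cons_Suc .
    qed (use Cons.prems(1) Suc in simp)
    then have "runs X (Dec k ;; switch k cs) (e, y) (1 + (3 * length cs + t)) s"
      using assms(1) Suc by (intro runs_Seq[OF runs_Dec]) simp_all
    then have "runs X (Branch k {3} c (Dec k ;; switch k cs)) (e, y) ((1 + (3 * length cs + t)) + 2) s"
      using assms(1) Suc by (intro runs_BranchFalse) simp_all
    then show ?thesis unfolding switch.simps by (rule runs_mono) simp
  qed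
qed simp

lemma runs_clear: "0 < k \<Longrightarrow> runs X (Loop k Skip) (e, y) (e k * 3 + 1) (e(k := 0), y)"
proof -
  assume k: "0 < k"
  have "runs X (Loop k Skip) ((\<lambda>i. e(k := e k - i)) 0, y) (e k * (0 + 3) + 1) ((\<lambda>i. e(k := e k - i)) (e k), y)"
    by (rule runs_Loop[OF k, where g = "\<lambda>_. y"]) (auto intro!: runs_conv[OF runs_Skip])
  then show ?thesis by simp
qed

text \<open>Besides the state of the automaton in counter \<open>3\<close>, the scan leaves the
  length of the word in counter \<open>4\<close>, which later counts the columns to be
  compared.\<close>

definition scan_input :: com where
  "scan_input = Inc 1 ;; While 1 {1, 2}
    (switch 3 (map (\<lambda>q. Branch 1 {2} (incs 3 (next_state q True)) (incs 3 (next_state q False))) [0..<10]) ;;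
     Inc 1 ;; Inc 4) ;; Loop 1 Skip"

lemma foldl_next_state_less: "q < 10 \<Longrightarrow> foldl next_state q x < 10"
  by (induction x arbitrary: q) (simp_all add: next_state_less)

lemma runs_scan_input:
  fixes X :: "nat \<Rightarrow> word"
  defines "n \<equiv> length (X 1)"
  shows "runs X scan_input (\<lambda>_. 0, y) (1 + ((n * 46 + 1) + (Suc n * 3 + 1)))
    ((\<lambda>_. 0)(3 := foldl next_state 0 (X 1), 4 := n), y)"
proof -
  let ?q = "\<lambda>i. foldl next_state 0 (take i (X 1))"
  let ?f = "\<lambda>i. (\<lambda>_ :: nat. 0 :: nat)(1 := Suc i, 3 := ?q i, 4 := i)"
  let ?b = "\<lambda>q. Branch 1 {2} (incs 3 (next_state q True)) (incs 3 (next_state q False))"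
  have 1: "runs X (Inc 1) (\<lambda>_. 0, y) 1 (?f 0, y)"
    by (rule runs_conv[OF runs_Inc]) (simp_all add: fun_eq_iff)
  have 2: "runs X (While 1 {1, 2} (switch 3 (map ?b [0..<10]) ;; Inc 1 ;; Inc 4)) (?f 0, y) (n * (44 + 2) + 1) (?f n, y)"
  proof (rule runs_While[where f = ?f and g = "\<lambda>_. y"])
    fix i assume i: "i < n"
    have sy: "symb X e 1 = (if X 1 ! i then 2 else 1)" if "e 1 = Suc i" for e
      using that i by (simp add: symb_tape word_tape_def n_def)
    show "symb X (?f i) 1 \<in> {1, 2}" by (subst sy) simp_all
    have q: "?q i < 10" by (rule foldl_next_state_less) simp
    have q': "?q (Suc i) = next_state (?q i) (X 1 ! i)"
      using i by (simp add: take_Suc_conv_app_nth n_def)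
    have le: "next_state (?q i) b \<le> 10" for b using next_state_less[OF q] by (simp add: less_imp_le)
    let ?e = "(\<lambda>_ :: nat. 0 :: nat)(1 := Suc i, 4 := i)"
    have "runs X (?b (?q i)) (?e, y) 12 (?e(3 := ?q (Suc i)), y)"
      unfolding q'
      by (rule runs_conv[OF runs_Branch[where t = 10]])
        (use sy[of ?e] le in \<open>auto intro!: runs_conv[OF runs_incs]\<close>)
    then have "runs X (switch 3 (map ?b [0..<10])) (?f i, y) (3 * length (map ?b [0..<10]) + 12) (?e(3 := ?q (Suc i)), y)"
    proof (intro runs_switch)
      assume *: "runs X (?b (?q i)) (?e, y) 12 (?e(3 := ?q (Suc i)), y)"
      have "(?f i)(3 := 0) = ?e" "map ?b [0..<10] ! ?f i 3 = ?b (?q i)" using q by (simp_all add: fun_eq_iff)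
      then show "runs X (map ?b [0..<10] ! ?f i 3) ((?f i)(3 := 0), y) 12 (?e(3 := ?q (Suc i)), y)"
        using * by (simp only:)
    qed (use q in simp_all)
    then have s: "runs X (switch 3 (map ?b [0..<10])) (?f i, y) 42 (?e(3 := ?q (Suc i)), y)" by simp
    show "runs X (switch 3 (map ?b [0..<10]) ;; Inc 1 ;; Inc 4) (?f i, y) 44 (?f (Suc i), y)"
      by (rule runs_conv[OF runs_Seq[OF s runs_Seq[OF runs_Inc runs_Inc]]]) (simp_all add: fun_eq_iff)
  next
    show "symb X (?f n) 1 \<notin> {1, 2}" by (simp add: symb_def word_tape_def n_def)
  qed simp
  have 3: "runs X (Loop 1 Skip) (?f n, y) (Suc n * 3 + 1) ((\<lambda>_. 0)(3 := foldl next_state 0 (X 1), 4 := n), y)"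
    by (rule runs_conv[OF runs_clear]) (simp_all add: fun_eq_iff n_def)
  show ?thesis unfolding scan_input_def
    by (rule runs_conv[OF runs_Seq[OF 1 runs_Seq[OF 2 3]]]) simp_all
qed

text \<open>
  Counter \<open>3\<close> counts down to the digit that is to be read. If this digit is a one, then the certificate bit under head \<open>2\<close>
  decides whether it is added to counter \<open>6\<close> or \<open>7\<close>.
\<close>

definition digits :: com where
  "digits = While 1 {2} (Inc 1 ;; Branch 3 {3} Skip
    (Dec 3 ;; Branch 3 {3} (Branch 1 {2} (Branch 2 {2} (Inc 6) (Inc 7)) Skip) Skip) ;; Inc 1)"

text \<open>Starting from \<open>Suc c\<close>, counter \<open>3\<close> reaches zero exactly at
  digit \<open>c\<close> and then causes the remaining digits to be skipped. Head \<open>2\<close>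
  does not move, so one certificate bit decides for the whole number.\<close>

lemma runs_digits:
  assumes "e 1 = Suc p" "e 3 = Suc c"
    and pair: "\<And>j. j < length bs \<Longrightarrow> word_tape (X 1) (int (p + 2 * j)) = 2"
      "\<And>j. j < length bs \<Longrightarrow> word_tape (X 1) (int (Suc (p + 2 * j))) = (if bs ! j then 2 else 1)"
    and stop: "word_tape (X 1) (int (p + 2 * length bs)) = 1"
  defines "s \<equiv> symb X e 2 = 2"
  shows "runs X digits (e, y) (length bs * 14 + 1)
    (e(1 := Suc (p + 2 * length bs), 3 := Suc c - length bs,
       6 := e 6 + of_bool (c < length bs \<and> bs ! c \<and> s), 7 := e 7 + of_bool (c < length bs \<and> bs ! c \<and> \<not> s)), y)"
proof -
  let ?f = "\<lambda>j. e(1 := Suc (p + 2 * j), 3 := Suc c - j,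
       6 := e 6 + of_bool (c < j \<and> bs ! c \<and> s), 7 := e 7 + of_bool (c < j \<and> bs ! c \<and> \<not> s))"
  let ?n = "length bs"
  have "runs X digits (?f 0, y) (?n * (12 + 2) + 1) (?f ?n, y)"
    unfolding digits_def
  proof (rule runs_While[where f = ?f and g = "\<lambda>_. y"])
    fix j assume j: "j < ?n"
    show "symb X (?f j) 1 \<in> {2}" using pair(1)[OF j] by (simp add: symb_tape)
    let ?e = "(?f j)(1 := Suc (Suc (p + 2 * j)))" and ?e' = "(?f (Suc j))(1 := Suc (Suc (p + 2 * j)))"
    let ?add = "Branch 2 {2} (Inc 6) (Inc 7)"
    have s1: "symb X e' 1 = (if bs ! j then 2 else 1)" if "e' 1 = Suc (Suc (p + 2 * j))" for e'
      using pair(2)[OF j] that by (simp add: symb_tape)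
    have s2: "symb X e' 2 = symb X e 2" if "e' 2 = e 2" for e'
      using that by (simp add: symb_def)
    have "runs X (Branch 3 {3} Skip (Dec 3 ;; Branch 3 {3} (Branch 1 {2} ?add Skip) Skip)) (?e, y) 10 (?e', y)"
    proof (cases "Suc c - j")
      case 0
      show ?thesis
      proof (rule runs_conv[OF runs_BranchTrue[OF _ _ runs_Skip]])
        show "symb X ?e 3 \<in> {3}" using 0 by simp
        show "(?e, y) = (?e', y)" using 0 by (simp add: fun_eq_iff)
      qed simp_all
    next
      case (Suc d)
      let ?d = "?e(3 := d)"
      have "runs X (Branch 3 {3} (Branch 1 {2} ?add Skip) Skip) (?d, y) 7 (?e', y)"
      proof (cases "d = 0")
        case False
        show ?thesis
        proof (rule runs_conv[OF runs_BranchFalse[OF _ _ runs_Skip]])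
          show "symb X ?d 3 \<notin> {3}" using False by simp
          have "\<not> c < j" "\<not> c < Suc j" "Suc c - Suc j = d" using Suc False by auto
          then show "(?d, y) = (?e', y)" by (simp add: fun_eq_iff)
        qed simp_all
      next
        case True
        then have cj: "c = j" using Suc by simp
        have add: "runs X ?add (?d, y) 3 (?e', y)" if "bs ! j"
        proof (rule runs_conv[OF runs_Branch])
          show "runs X (if symb X ?d 2 \<in> {2} then Inc 6 else Inc 7) (?d, y) 1 (?e', y)"
          proof (cases s)
            case s: True
            then have "symb X ?d 2 = 2" using s2[of ?d] by (simp add: s_def)
            then show ?thesis using s that True cj
              by (simp, intro runs_conv[OF runs_Inc]) (simp_all add: fun_eq_iff)
          next
            case s: False
            then have "symb X ?d 2 \<noteq> 2" using s2[of ?d] by (simp add: s_def)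
            then show ?thesis using s that True cj
              by (simp, intro runs_conv[OF runs_Inc]) (simp_all add: fun_eq_iff)
          qed
        qed simp_all
        have "runs X (Branch 1 {2} ?add Skip) (?d, y) (3 + 2) (?e', y)"
        proof (cases "bs ! j")
          case b: True
          have "symb X ?d 1 \<in> {2}" using s1[of ?d] b by simp
          from runs_BranchTrue[OF _ this add[OF b]] show ?thesis by simp
        next
          case b: False
          have "symb X ?d 1 \<notin> {2}" using s1[of ?d] b by simp
          moreover have "?d = ?e'" using b True cj by (simp add: fun_eq_iff)
          ultimately show ?thesis
            by (intro runs_BranchFalse runs_conv[OF runs_Skip]) simp_all
        qed
        from runs_BranchTrue[OF _ _ this, of 3 "{3}" Skip] True show ?thesis by simp
      qed
      then have "runs X (Dec 3 ;; Branch 3 {3} (Branch 1 {2} ?add Skip) Skip) (?e, y) (1 + 7) (?e', y)"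
        using Suc by (intro runs_Seq[OF runs_Dec]) simp_all
      from runs_BranchFalse[OF _ _ this, of 3 "{3}" Skip] Suc show ?thesis by simp
    qed
    from runs_Seq[OF this runs_Inc[of 1]]
    have r: "runs X (Branch 3 {3} Skip (Dec 3 ;; Branch 3 {3} (Branch 1 {2} ?add Skip) Skip) ;; Inc 1) (?e, y) (10 + 1) (?f (Suc j), y)"
      by (rule runs_conv) (simp_all add: fun_eq_iff)
    have "runs X (Inc 1) (?f j, y) 1 (?e, y)"
      by (rule runs_conv[OF runs_Inc]) (simp_all add: fun_eq_iff)
    from runs_Seq[OF this r]
    show "runs X (Inc 1 ;; Branch 3 {3} Skip (Dec 3 ;; Branch 3 {3} (Branch 1 {2} ?add Skip) Skip) ;; Inc 1) (?f j, y) 12 (?f (Suc j), y)"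
      by simp
  next
    show "symb X (?f ?n) 1 \<notin> {2}" using stop by (simp add: symb_tape)
  qed simp
  moreover have "?f 0 = e" using assms(1,2) by (simp add: fun_eq_iff)
  ultimately show ?thesis by simp
qed

text \<open>Counter \<open>5\<close> is copied afresh for every number. The extra
  \<open>Inc 1\<close> passes the end mark of the number, and \<open>Inc 2\<close> goes to the next
  certificate bit; clearing counter \<open>3\<close> matters for numbers too short to reach the
  column.\<close>

definition read_number :: com where
  "read_number = For 5 10 (Inc 3) ;; digits ;; Inc 1 ;; Loop 3 Skip ;; Inc 2"

lemma runs_read_number:
  assumes "e 1 = Suc p" "e 3 = 0" "e 5 = Suc c" "e 10 = 0"
    and pair: "\<And>j. j < length bs \<Longrightarrow> word_tape (X 1) (int (p + 2 * j)) = 2"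
      "\<And>j. j < length bs \<Longrightarrow> word_tape (X 1) (int (Suc (p + 2 * j))) = (if bs ! j then 2 else 1)"
    and stop: "word_tape (X 1) (int (p + 2 * length bs)) = 1"
    and le: "length bs \<le> N" "Suc c \<le> N"
  defines "s \<equiv> symb X e 2 = 2"
  shows "runs X read_number (e, y) (27 * N + 6)
    (e(1 := Suc (Suc (p + 2 * length bs)), 2 := Suc (e 2),
       6 := e 6 + of_bool (c < length bs \<and> bs ! c \<and> s), 7 := e 7 + of_bool (c < length bs \<and> bs ! c \<and> \<not> s)), y)"
proof -
  let ?e = "e(3 := Suc c)"
  let ?e' = "e(1 := Suc (p + 2 * length bs), 3 := Suc c - length bs,
       6 := e 6 + of_bool (c < length bs \<and> bs ! c \<and> s), 7 := e 7 + of_bool (c < length bs \<and> bs ! c \<and> \<not> s))"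
  have "runs X (For 5 10 (Inc 3)) ((\<lambda>i. e(3 := i)) 0, y) (Suc c * (1 + 9) + 2) ((\<lambda>i. e(3 := i)) (Suc c), y)"
  proof (rule runs_For[where g = "\<lambda>_. y"])
    fix i
    show "runs X (Inc 3) ((e(3 := i))(5 := Suc c - Suc i, 10 := Suc i), y) 1
        ((e(3 := Suc i))(5 := Suc c - Suc i, 10 := Suc i), y)"
      by (rule runs_conv[OF runs_Inc]) (simp_all add: fun_eq_iff)
  qed (use assms(3,4) in simp_all)
  then have 1: "runs X (For 5 10 (Inc 3)) (e, y) (Suc c * (1 + 9) + 2) (?e, y)"
    by (rule runs_conv') (use assms(2) in \<open>simp_all add: fun_upd_idem\<close>)
  have "symb X ?e 2 = symb X e 2" by (simp add: symb_def)
  then have 2: "runs X digits (?e, y) (length bs * 14 + 1) (?e', y)"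
    using assms(1) pair stop
    by (intro runs_conv[OF runs_digits[of ?e p c bs X y]]) (simp_all add: s_def fun_eq_iff)
  let ?e'' = "?e'(1 := Suc (Suc (p + 2 * length bs)))"
  have 3: "runs X (Inc 1) (?e', y) 1 (?e'', y)"
    by (rule runs_conv[OF runs_Inc]) (simp_all add: fun_eq_iff)
  have 4: "runs X (Loop 3 Skip) (?e'', y) (Suc c * 3 + 1) (?e''(3 := 0), y)"
    by (rule runs_conv[OF runs_clear]) simp_all
  have t: "Suc c * (1 + 9) + 2 + (length bs * 14 + 1 + (1 + (Suc c * 3 + 1 + 1))) \<le> 27 * N + 6"
    using le by simp
  show ?thesis
    unfolding read_number_def
    by (rule runs_conv[OF runs_Seq[OF 1 runs_Seq[OF 2 runs_Seq[OF 3 runs_Seq[OF 4 runs_Inc]]]] _ t])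
      (use assms(2) in \<open>simp_all add: fun_eq_iff\<close>)
qed

definition read_numbers :: com where
  "read_numbers = While 1 {1, 2} read_number"

lemma numerals_word_append [simp]: "numerals_word (as @ bs) = numerals_word as @ numerals_word bs"
  by (simp add: numerals_word_def)

lemma enc_nth: "j < length bs \<Longrightarrow> enc bs ! (2 * j) \<and> enc bs ! Suc (2 * j) = bs ! j"
proof (induction bs arbitrary: j)
  case (Cons b bs)
  then show ?case by (cases j) simp_all
qed simp

lemma numerals_word_tape:
  fixes bss :: "bool list list"
  assumes "i < length bss"
  defines "p \<equiv> length (numerals_word (take i bss))" and "x \<equiv> numerals_word bss"
  shows "j < length (bss ! i) \<Longrightarrow> word_tape x (int (p + 2 * j)) = 2"
    and "j < length (bss ! i) \<Longrightarrow> word_tape x (int (Suc (p + 2 * j))) = (if bss ! i ! j then 2 else 1)"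
    and "word_tape x (int (p + 2 * length (bss ! i))) = 1"
    and "length (numerals_word (take (Suc i) bss)) = Suc (p + 2 * length (bss ! i))"
    and "length (bss ! i) \<le> length x"
proof -
  have "bss = take i bss @ bss ! i # drop (Suc i) bss"
    using assms(1) by (rule id_take_nth_drop)
  then have x: "x = numerals_word (take i bss) @ enc (bss ! i) @ False # numerals_word (drop (Suc i) bss)"
    unfolding x_def by (metis numerals_word_append numerals_word_simps(2))
  have at: "word_tape x (int (p + k)) = (if (enc (bss ! i) @ [False]) ! k then 2 else 1)"
    if "k \<le> 2 * length (bss ! i)" for k
  proof -
    have "x ! (p + k) = (enc (bss ! i) @ False # numerals_word (drop (Suc i) bss)) ! k"
      unfolding x p_def by (rule nth_append_length_plus)
    also have "\<dots> = (enc (bss ! i) @ [False]) ! k"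
      using that by (auto simp: nth_append)
    finally have "x ! (p + k) = (enc (bss ! i) @ [False]) ! k" .
    moreover have "p + k < length x" using that by (simp add: x p_def)
    ultimately show ?thesis by (simp only: word_tape_def of_nat_0_le_iff of_nat_less_iff nat_int simp_thms if_True)
  qed
  show "word_tape x (int (p + 2 * j)) = 2" if "j < length (bss ! i)"
    using at[of "2 * j"] enc_nth[OF that] that by (simp add: nth_append)
  have "Suc (2 * j) < 2 * length (bss ! i)" if "j < length (bss ! i)" using that by linarith
  then show "word_tape x (int (Suc (p + 2 * j))) = (if bss ! i ! j then 2 else 1)" if "j < length (bss ! i)"
    using at[of "Suc (2 * j)"] enc_nth[OF that] that by (simp add: nth_append)
  show "word_tape x (int (p + 2 * length (bss ! i))) = 1"
    using at[of "2 * length (bss ! i)"] by (simp add: nth_append)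
  show "length (numerals_word (take (Suc i) bss)) = Suc (p + 2 * length (bss ! i))"
    using assms(1) by (simp add: take_Suc_conv_app_nth p_def)
  show "length (bss ! i) \<le> length x" by (simp add: x)
qed

text \<open>Column \<open>c\<close> of the halved weights is digit \<open>c + 1\<close> of the
  weights. Together with the extra unit of the countdown in \<open>digits\<close>, this is why
  counter \<open>5\<close> holds \<open>c + 2\<close>.\<close>

lemma binary_half_bit:
  "c + 1 < length (binary w) \<and> binary w ! (c + 1) \<longleftrightarrow> odd (w div 2 div 2 ^ c)"
proof -
  have "bit w (c + 1) \<longleftrightarrow> c + 1 < length (binary w) \<and> binary w ! (c + 1)"
    using bit_horner_sum_bit_iff[of "binary w" "c + 1", where 'a = nat] by (simp add: horner_sum_binary possible_bit_def)
  then show ?thesis by (simp add: bit_iff_odd div_mult2_eq)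
qed

lemma column_Suc:
  "column {i. i < Suc m \<and> P i} a c = column {i. i < m \<and> P i} a c + of_bool (odd (a m div 2 ^ c) \<and> P m)"
proof -
  have "{i \<in> {i. i < Suc m \<and> P i}. odd (a i div 2 ^ c)} =
      (if odd (a m div 2 ^ c) \<and> P m then insert m else id) {i \<in> {i. i < m \<and> P i}. odd (a i div 2 ^ c)}"
    by (auto simp: less_Suc_eq)
  then show ?thesis unfolding column_def by simp
qed

lemma runs_read_numbers:
  assumes x: "X 1 = encode ws"
    and e: "e 1 = 1" "e 2 = 1" "e 3 = 0" "e 5 = c + 2" "e 10 = 0"
    and N: "length (X 1) \<le> N" "c + 2 \<le> N"
  defines "n \<equiv> length ws" and "a \<equiv> \<lambda>i. ws ! i div 2"
  shows "runs X read_numbers (e, y) (N * (27 * N + 8) + 1)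
    (e(1 := Suc (length (X 1)), 2 := Suc n,
       6 := e 6 + column {i. i < n \<and> selected (X 2) i} a c,
       7 := e 7 + column {i. i < n \<and> \<not> selected (X 2) i} a c), y)"
proof -
  let ?bss = "map binary ws"
  let ?p = "\<lambda>i. length (numerals_word (take i ?bss))"
  let ?f = "\<lambda>m. e(1 := Suc (?p m), 2 := Suc m,
       6 := e 6 + column {i. i < m \<and> selected (X 2) i} a c,
       7 := e 7 + column {i. i < m \<and> \<not> selected (X 2) i} a c)"
  have X1: "X 1 = numerals_word ?bss"
    unfolding x by (simp add: numerals_word_def encode_def encode_nat_enc[abs_def] comp_def)
  have run: "runs X read_numbers (?f 0, y) (n * ((27 * N + 6) + 2) + 1) (?f n, y)"
    unfolding read_numbers_def
  proof (rule runs_While[where f = ?f and g = "\<lambda>_. y"])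
    fix m assume m: "m < n"
    then have m': "m < length ?bss" by (simp add: n_def)
    note tape = numerals_word_tape[OF m', folded X1]
    have bss: "?bss ! m = binary (ws ! m)" using m by (simp add: n_def)
    show "symb X (?f m) 1 \<in> {1, 2}"
    proof (cases "length (?bss ! m) = 0")
      case True
      then show ?thesis using tape(3) by (simp add: symb_tape)
    next
      case False
      then show ?thesis using tape(1)[of 0] by (simp add: symb_tape)
    qed
    have s: "symb X (?f m) 2 = 2 \<longleftrightarrow> selected (X 2) m"
      by (simp add: selected_def symb_tape word_tape_def)
    have "runs X read_number (?f m, y) (27 * N + 6)
      ((?f m)(1 := Suc (Suc (?p m + 2 * length (?bss ! m))), 2 := Suc (?f m 2),
       6 := ?f m 6 + of_bool (c + 1 < length (?bss ! m) \<and> ?bss ! m ! (c + 1) \<and> symb X (?f m) 2 = 2),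
       7 := ?f m 7 + of_bool (c + 1 < length (?bss ! m) \<and> ?bss ! m ! (c + 1) \<and> \<not> symb X (?f m) 2 = 2)), y)"
    proof (rule runs_read_number)
      show "length (?bss ! m) \<le> N" using tape(5) N(1) by (rule le_trans)
    qed (use tape(1-3) e N(2) in simp_all)
    then show "runs X read_number (?f m, y) (27 * N + 6) (?f (Suc m), y)"
    proof (rule runs_conv)
      have bit: "(c + 1 < length (?bss ! m) \<and> ?bss ! m ! (c + 1) \<and> P) \<longleftrightarrow> odd (a m div 2 ^ c) \<and> P" for P
        using binary_half_bit[of c "ws ! m"] unfolding bss a_def by blast
      show "((?f m)(1 := Suc (Suc (?p m + 2 * length (?bss ! m))), 2 := Suc (?f m 2),
         6 := ?f m 6 + of_bool (c + 1 < length (?bss ! m) \<and> ?bss ! m ! (c + 1) \<and> symb X (?f m) 2 = 2),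
         7 := ?f m 7 + of_bool (c + 1 < length (?bss ! m) \<and> ?bss ! m ! (c + 1) \<and> \<not> symb X (?f m) 2 = 2)), y) =
        (?f (Suc m), y)"
        unfolding bit s tape(4) column_Suc[of m] by (simp add: fun_eq_iff)
    qed simp
  next
    show "symb X (?f n) 1 \<notin> {1, 2}" by (simp add: symb_tape word_tape_def n_def X1[unfolded One_nat_def])
  qed simp
  have start: "?f 0 = e" using e(1,2) by (simp add: fun_eq_iff column_def)
  have "n \<le> N" using length_encode[of ws] N(1) unfolding n_def x by (rule le_trans)
  then have "n * (27 * N + 8) \<le> N * (27 * N + 8)" by (rule mult_le_mono1)
  then have time: "n * ((27 * N + 6) + 2) + 1 \<le> N * (27 * N + 8) + 1" by (simp add: add.commute)
  have stop: "?p n = length (X 1)" unfolding X1 by (simp add: n_def)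
  show ?thesis using runs_mono[OF run time] unfolding start stop .
qed

text \<open>The remainder is added to counter \<open>8\<close> rather than stored, so that halving
  \<open>6\<close> and \<open>7\<close> in turn leaves the sum of the two parities there.\<close>

definition halve :: "nat \<Rightarrow> com" where
  "halve k = While k {0, 1, 2} (Dec k ;; Branch k {3} (Inc 8) (Dec k ;; Inc 10)) ;; Loop 10 (Inc k)"

lemma runs_halve:
  assumes "0 < k" "k \<noteq> 8" "k \<noteq> 10" "e 10 = 0"
  shows "runs X (halve k) (e, y) (e k * 11 + 2) (e(k := e k div 2, 8 := e 8 + e k mod 2), y)"
proof -
  let ?c = "Dec k ;; Branch k {3} (Inc 8) (Dec k ;; Inc 10)"
  have 1: "runs X (While k {0, 1, 2} ?c) (e(k := a, 10 := h, 8 := r), y) (a * 7 + 1)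
      (e(k := 0, 10 := h + a div 2, 8 := r + a mod 2), y)" for a h r
  proof (induction a arbitrary: h rule: induct_nat_012)
    case 0
    have "symb X (e(k := 0, 10 := h, 8 := r)) k \<notin> {0, 1, 2}"
      unfolding symb_nonzero using assms(2,3) by simp
    from runs_WhileFalse[OF assms(1) this] show ?case by (rule runs_conv) (simp_all add: fun_eq_iff)
  next
    case 1
    let ?e = "e(k := 0, 10 := h, 8 := r)"
    have "runs X (Branch k {3} (Inc 8) (Dec k ;; Inc 10)) (?e, y) (1 + 2) (?e(8 := Suc r), y)"
      using assms(1-3) by (intro runs_BranchTrue runs_conv[OF runs_Inc]) (simp_all add: fun_eq_iff)
    then have c: "runs X ?c (e(k := 1, 10 := h, 8 := r), y) (1 + (1 + 2)) (?e(8 := Suc r), y)"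
      using assms(1-3) by (intro runs_Seq[OF runs_conv[OF runs_Dec]]) (simp_all add: fun_eq_iff)
    have w: "runs X (While k {0, 1, 2} ?c) (?e(8 := Suc r), y) 1 (?e(8 := Suc r), y)"
    proof (rule runs_WhileFalse[OF assms(1)])
      show "symb X (?e(8 := Suc r)) k \<notin> {0, 1, 2}" unfolding symb_nonzero using assms(2,3) by simp
    qed
    have "symb X (e(k := 1, 10 := h, 8 := r)) k \<in> {0, 1, 2}"
      unfolding symb_nonzero using assms(2,3) by simp
    from runs_WhileTrue[OF assms(1) this c w] show ?case by (rule runs_conv') (simp_all add: fun_eq_iff)
  next
    case (ge2 a)
    let ?e = "e(k := Suc a, 10 := h, 8 := r)" and ?e' = "e(k := a, 10 := Suc h, 8 := r)"
    have "runs X (Dec k ;; Inc 10) (?e, y) 2 (?e', y)"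
      using assms(1-3) by (intro runs_conv[OF runs_Seq[OF runs_Dec runs_Inc]]) (simp_all add: fun_eq_iff)
    then have "runs X (Branch k {3} (Inc 8) (Dec k ;; Inc 10)) (?e, y) (2 + 2) (?e', y)"
      using assms(1-3) by (intro runs_BranchFalse) simp_all
    then have c: "runs X ?c (e(k := Suc (Suc a), 10 := h, 8 := r), y) (1 + (2 + 2)) (?e', y)"
      using assms(1-3) by (intro runs_Seq[OF runs_conv[OF runs_Dec]]) (simp_all add: fun_eq_iff)
    have "symb X (e(k := Suc (Suc a), 10 := h, 8 := r)) k \<in> {0, 1, 2}"
      unfolding symb_nonzero using assms(2,3) by simp
    from runs_WhileTrue[OF assms(1) this c ge2(1)]
    show ?case by (rule runs_conv) (simp_all add: fun_eq_iff)
  qed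
  let ?a = "e k" and ?r = "e 8 + e k mod 2"
  let ?f = "\<lambda>i. e(k := i, 10 := ?a div 2 - i, 8 := ?r)"
  have "runs X (Loop 10 (Inc k)) (?f 0, y) (?a div 2 * (1 + 3) + 1) (?f (?a div 2), y)"
  proof (rule runs_Loop[where f = ?f and g = "\<lambda>_. y"])
    fix i
    show "runs X (Inc k) ((?f i)(10 := ?a div 2 - Suc i), y) 1 (?f (Suc i), y)"
      by (rule runs_conv[OF runs_Inc]) (use assms(1-3) in \<open>simp_all add: fun_eq_iff\<close>)
  qed simp_all
  then have 2: "runs X (Loop 10 (Inc k)) (e(k := 0, 10 := 0 + e k div 2, 8 := e 8 + e k mod 2), y) (?a div 2 * (1 + 3) + 1)
      (e(k := ?a div 2, 8 := ?r), y)"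
    by (rule runs_conv') (use assms in \<open>simp_all add: fun_eq_iff\<close>)
  have "e(k := e k, 10 := 0, 8 := e 8) = e" using assms by (simp add: fun_eq_iff)
  then show ?thesis
    unfolding halve_def using runs_conv'[OF runs_Seq[OF 1[of "e k" 0 "e 8"] 2]] by simp
qed

definition add_column :: com where
  "add_column = Inc 1 ;; Inc 2 ;; read_numbers ;; Loop 1 Skip ;; Loop 2 Skip ;; halve 6 ;; halve 7 ;;
    Branch 8 {3} Skip (Dec 8 ;; Branch 8 {3} (Inc 9) (Dec 8)) ;; Inc 5"

definition column_time :: "nat \<Rightarrow> nat" where
  "column_time N = N * (27 * N + 8) + 100 * N + 100"

text \<open>Each part below column \<open>c\<close> is less than \<open>2 ^ c\<close>. This bound
  keeps the counters small although the sums may be exponential in the input length.\<close>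

lemma carry_le:
  assumes "finite S"
  shows "carry S a c \<le> card S"
proof -
  have "(\<Sum>i\<in>S. a i mod 2 ^ c) \<le> (\<Sum>i\<in>S. 2 ^ c)" by (rule sum_mono) (simp add: less_imp_le)
  then have "(\<Sum>i\<in>S. a i mod 2 ^ c) div 2 ^ c \<le> (card S * 2 ^ c) div 2 ^ c"
    by (intro div_le_mono) simp
  then show ?thesis by (simp add: carry_def)
qed

lemma column_le: "finite S \<Longrightarrow> column S a c \<le> card S"
  unfolding column_def by (rule card_mono) auto

text \<open>Two bits differ iff their sum is \<open>1\<close>.\<close>

lemma runs_parity:
  assumes "r < 2" "r' < 2" "e 8 = r + r'"
  shows "runs X (Branch 8 {3} Skip (Dec 8 ;; Branch 8 {3} (Inc 9) (Dec 8))) (e, y) 6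
    (e(8 := 0, 9 := e 9 + (if r \<noteq> r' then 1 else 0)), y)"
proof -
  consider "e 8 = 0" "r = r'" | "e 8 = 1" "r \<noteq> r'" | "e 8 = 2" "r = r'"
    using assms by (auto simp: less_2_cases_iff)
  then show ?thesis
  proof cases
    case 1
    then show ?thesis
      by (intro runs_conv[OF runs_BranchTrue[OF _ _ runs_Skip]]) (simp_all add: fun_eq_iff)
  next
    case 2
    then show ?thesis
      by (intro runs_conv[OF runs_BranchFalse[OF _ _ runs_Seq[OF runs_Dec runs_BranchTrue[OF _ _ runs_Inc]]]])
        (simp_all add: fun_eq_iff)
  next
    case 3
    then show ?thesis
      by (intro runs_conv[OF runs_BranchFalse[OF _ _ runs_Seq[OF runs_Dec runs_BranchFalse[OF _ _ runs_Dec]]]])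
        (simp_all add: fun_eq_iff)
  qed
qed

lemma runs_add_column:
  fixes ws :: "nat list" and X :: "nat \<Rightarrow> word"
  assumes x: "X 1 = encode ws" and N: "length (X 1) \<le> N" "c + 2 \<le> N"
  defines "S \<equiv> {i. i < length ws \<and> selected (X 2) i}" and "T \<equiv> {i. i < length ws \<and> \<not> selected (X 2) i}"
    and "a \<equiv> \<lambda>i. ws ! i div 2"
  defines "\<sigma> \<equiv> \<lambda>l c. (\<lambda>_. 0)(4 := l, 5 := c + 2, 6 := carry S a c, 7 := carry T a c, 9 := mismatches S T a c)"
  shows "runs X add_column (\<sigma> l c, y) (column_time N) (\<sigma> l (Suc c), y)"
proof -
  have fin: "finite S" "finite T" by (simp_all add: S_def T_def)
  have n: "length ws \<le> N" using length_encode[of ws] N(1) unfolding x by (rule le_trans)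
  have "card S \<le> card {..<length ws}" "card T \<le> card {..<length ws}"
    unfolding S_def T_def by (rule card_mono; auto)+
  then have card: "card S \<le> N" "card T \<le> N" using n by simp_all
  let ?A = "carry S a c + column S a c" and ?B = "carry T a c + column T a c"
  have AB: "?A \<le> 2 * N" "?B \<le> 2 * N"
    using carry_le[OF fin(1), of a c] carry_le[OF fin(2), of a c]
      column_le[OF fin(1), of a c] column_le[OF fin(2), of a c] card by linarith+
  let ?n = "length ws" and ?m = "length (X 1)"
  let ?e1 = "(\<sigma> l c)(1 := 1)"
  let ?e2 = "?e1(2 := 1)"
  let ?e3 = "?e2(1 := Suc ?m, 2 := Suc ?n, 6 := ?A, 7 := ?B)"
  let ?e4 = "?e3(1 := 0)"
  let ?e5 = "?e4(2 := 0)"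
  let ?e6 = "?e5(6 := ?A div 2, 8 := ?A mod 2)"
  let ?e7 = "?e6(7 := ?B div 2, 8 := ?A mod 2 + ?B mod 2)"
  let ?e8 = "?e7(8 := 0, 9 := ?e7 9 + (if ?A mod 2 \<noteq> ?B mod 2 then 1 else 0))"
  have 1: "runs X (Inc 1) (\<sigma> l c, y) 1 (?e1, y)"
    by (rule runs_conv[OF runs_Inc]) (simp_all add: \<sigma>_def)
  have 2: "runs X (Inc 2) (?e1, y) 1 (?e2, y)"
    by (rule runs_conv[OF runs_Inc]) (simp_all add: \<sigma>_def)
  have 3: "runs X read_numbers (?e2, y) (N * (27 * N + 8) + 1) (?e3, y)"
    by (rule runs_conv[OF runs_read_numbers[where X = X, OF x _ _ _ _ _ N]])
      (simp_all add: \<sigma>_def S_def T_def a_def)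
  have 4: "runs X (Loop 1 Skip) (?e3, y) (Suc ?m * 3 + 1) (?e4, y)"
    by (rule runs_conv[OF runs_clear]) simp_all
  have 5: "runs X (Loop 2 Skip) (?e4, y) (Suc ?n * 3 + 1) (?e5, y)"
    by (rule runs_conv[OF runs_clear]) simp_all
  have 6: "runs X (halve 6) (?e5, y) (?A * 11 + 2) (?e6, y)"
    by (rule runs_conv[OF runs_halve]) (simp_all add: \<sigma>_def)
  have 7: "runs X (halve 7) (?e6, y) (?B * 11 + 2) (?e7, y)"
    by (rule runs_conv[OF runs_halve]) (simp_all add: \<sigma>_def)
  have 8: "runs X (Branch 8 {3} Skip (Dec 8 ;; Branch 8 {3} (Inc 9) (Dec 8))) (?e7, y) 6 (?e8, y)"
    by (rule runs_parity) simp_all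
  have 9: "runs X (Inc 5) (?e8, y) 1 (\<sigma> l (Suc c), y)"
    by (rule runs_conv[OF runs_Inc])
      (simp_all add: \<sigma>_def fun_eq_iff carry_Suc[OF fin(1)] carry_Suc[OF fin(2)] mismatches_Suc)
  have t: "1 + (1 + (N * (27 * N + 8) + 1 + (Suc ?m * 3 + 1 + (Suc ?n * 3 + 1 +
      (?A * 11 + 2 + (?B * 11 + 2 + (6 + 1))))))) \<le> column_time N"
  proof -
    have "1 + (1 + (P + 1 + (Suc ?m * 3 + 1 + (Suc ?n * 3 + 1 + (A * 11 + 2 + (B * 11 + 2 + (6 + 1))))))) \<le>
        P + 100 * N + 100" if "A \<le> 2 * N" "B \<le> 2 * N" for A B P
      using n N(1) that by simp
    from this[OF AB] show ?thesis unfolding column_time_def .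
  qed
  show ?thesis
    unfolding add_column_def
    by (rule runs_conv[OF runs_Seq[OF 1 runs_Seq[OF 2 runs_Seq[OF 3 runs_Seq[OF 4 runs_Seq[OF 5 runs_Seq[OF 6
      runs_Seq[OF 7 runs_Seq[OF 8 9]]]]]]]] refl t])
qed

text \<open>Counter \<open>5\<close> starts at \<open>2\<close>, which stands for column
  \<open>0\<close>. Only state \<open>8\<close> of the automaton lets the comparison begin; in every
  other state the word is rejected.\<close>

definition verifier :: com where
  "verifier = scan_input ;; switch 3 (map (\<lambda>q. if q = 8
    then incs 5 2 ;; Loop 4 add_column ;; Branch 9 {3} (Emit True) (Emit False) else Emit False) [0..<10])"

definition verifier_time :: "nat \<Rightarrow> nat" where
  "verifier_time n = (1 + ((n * 46 + 1) + ((n + 1) * 3 + 1))) + (30 + (2 + ((n * (column_time (n + 2) + 3) + 1) + 3)))"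

lemma pb_verifier_time: "pb verifier_time"
  unfolding verifier_time_def[abs_def] column_time_def by (intro pb_add pb_mult pb_const pb_id)

lemma verifier_time_mono: "m \<le> n \<Longrightarrow> verifier_time m \<le> verifier_time n"
  unfolding verifier_time_def column_time_def by (intro add_mono mult_le_mono) simp_all

lemma runs_verifier:
  "\<exists>e. runs X verifier (\<lambda>_. 0, []) (verifier_time (length (X 1))) (e, [verifies (X 1) (X 2)])"
proof -
  let ?n = "length (X 1)" and ?q = "foldl next_state 0 (X 1)"
  let ?check = "incs 5 2 ;; Loop 4 add_column ;; Branch 9 {3} (Emit True) (Emit False)"
  let ?c = "\<lambda>q. if q = 8 then ?check else Emit False"
  let ?e = "(\<lambda>_ :: nat. 0 :: nat)(4 := ?n)"
  let ?t = "2 + ((?n * (column_time (?n + 2) + 3) + 1) + 3)"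
  have "\<exists>e. runs X (?c ?q) (?e, []) ?t (e, [verifies (X 1) (X 2)])"
  proof (cases "?q = 8")
    case False
    then have "\<not> verifies (X 1) (X 2)"
      using accepted_iff_instance[of "X 1"] unfolding verifies_def by blast
    moreover have "runs X (Emit False) (?e, []) ?t (?e, [False])"
      by (rule runs_conv[OF runs_Emit]) simp_all
    ultimately show ?thesis using False by auto
  next
    case True
    then obtain ws where ws: "SHP_instance ws" "X 1 = encode ws" using accepted_iff_instance by blast
    define a where "a i = ws ! i div 2" for i
    define S where "S = {i. i < length ws \<and> selected (X 2) i}"
    define T where "T = {i. i < length ws \<and> \<not> selected (X 2) i}"
    define \<sigma> where "\<sigma> l c = (\<lambda>_ :: nat. 0 :: nat)(4 := l, 5 := c + 2, 6 := carry S a c, 7 := carry T a c,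
      9 := mismatches S T a c)" for l c
    have fin: "finite S" "finite T" by (simp_all add: S_def T_def)
    have sums: "half_sum ws (selected (X 2)) = sum a S" "half_sum ws (\<lambda>i. \<not> selected (X 2) i) = sum a T"
      by (simp_all add: half_sum_def S_def T_def a_def)
    have "verifies (X 1) (X 2) \<longleftrightarrow> sum a S = sum a T"
      unfolding verifies_def sums[symmetric] ws(2) using ws(1) inj_encode by (auto dest: injD)
    \<comment> \<open>Both sums are below the modulus, because they have no more bits than the word
      has letters.\<close>
    also have "\<dots> \<longleftrightarrow> sum a S mod 2 ^ ?n = sum a T mod 2 ^ ?n"
      using half_sum_bound[of ws] unfolding sums[symmetric] ws(2) by simp
    also have "\<dots> \<longleftrightarrow> mismatches S T a ?n = 0"
      using mismatches_eq_0_iff[OF fin] by simp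
    finally have V: "verifies (X 1) (X 2) \<longleftrightarrow> mismatches S T a ?n = 0" .
    have 1: "runs X (incs 5 2) (?e, []) 2 (\<sigma> (?n - 0) 0, [])"
      by (rule runs_conv[OF runs_incs]) (simp_all add: \<sigma>_def fun_eq_iff)
    have 2: "runs X (Loop 4 add_column) ((\<lambda>i. \<sigma> (?n - i) i) 0, []) (?n * (column_time (?n + 2) + 3) + 1)
      ((\<lambda>i. \<sigma> (?n - i) i) ?n, [])"
    proof (rule runs_Loop[where g = "\<lambda>_. []" and f = "\<lambda>i. \<sigma> (?n - i) i"])
      fix i assume "i < ?n"
      then have "runs X add_column (\<sigma> (?n - Suc i) i, []) (column_time (?n + 2)) (\<sigma> (?n - Suc i) (Suc i), [])"
        using runs_add_column[where X = X, OF ws(2), of "?n + 2" i "?n - Suc i" "[]"]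
        unfolding \<sigma>_def S_def T_def a_def[abs_def] by simp
      moreover have "(\<sigma> (?n - i) i)(4 := ?n - Suc i) = \<sigma> (?n - Suc i) i"
        by (simp add: \<sigma>_def fun_eq_iff)
      ultimately show "runs X add_column ((\<sigma> (?n - i) i)(4 := ?n - Suc i), []) (column_time (?n + 2)) (\<sigma> (?n - Suc i) (Suc i), [])"
        by (simp only:)
    qed (simp_all add: \<sigma>_def)
    have 3: "runs X (Branch 9 {3} (Emit True) (Emit False)) (\<sigma> (?n - ?n) ?n, []) (1 + 2) (\<sigma> (?n - ?n) ?n, [verifies (X 1) (X 2)])"
    proof (rule runs_Branch)
      have "symb X (\<sigma> (?n - ?n) ?n) 9 \<in> {3} \<longleftrightarrow> verifies (X 1) (X 2)" unfolding V by (simp add: \<sigma>_def)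
      then show "runs X (if symb X (\<sigma> (?n - ?n) ?n) 9 \<in> {3} then Emit True else Emit False)
        (\<sigma> (?n - ?n) ?n, []) 1 (\<sigma> (?n - ?n) ?n, [verifies (X 1) (X 2)])"
        using runs_Emit[of X "verifies (X 1) (X 2)" "\<sigma> (?n - ?n) ?n" "[]"]
        by (cases "verifies (X 1) (X 2)") simp_all
    qed simp
    have "runs X ?check (?e, []) ?t (\<sigma> (?n - ?n) ?n, [verifies (X 1) (X 2)])"
      by (rule runs_conv[OF runs_Seq[OF 1 runs_Seq[OF 2 3]]]) simp_all
    then show ?thesis using True by auto
  qed
  then obtain e where e: "runs X (?c ?q) (?e, []) ?t (e, [verifies (X 1) (X 2)])" by blast
  let ?e' = "(\<lambda>_ :: nat. 0 :: nat)(3 := ?q, 4 := ?n)"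
  have q: "?q < 10" by (rule foldl_next_state_less) simp
  have "runs X (switch 3 (map ?c [0..<10])) (?e', []) (3 * length (map ?c [0..<10]) + ?t) (e, [verifies (X 1) (X 2)])"
  proof (rule runs_switch)
    have "map ?c [0..<10] ! ?e' 3 = ?c ?q" using q by simp
    moreover have "?e'(3 := 0) = ?e" by (simp add: fun_eq_iff)
    ultimately show "runs X (map ?c [0..<10] ! ?e' 3) (?e'(3 := 0), []) ?t (e, [verifies (X 1) (X 2)])"
      using e by (simp only:)
  qed (use q in simp_all)
  from runs_Seq[OF runs_scan_input this]
  have "runs X verifier (\<lambda>_. 0, []) (verifier_time ?n) (e, [verifies (X 1) (X 2)])"
    unfolding verifier_def by (rule runs_conv) (simp_all add: verifier_time_def)
  then show ?thesis by blast
qed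

theorem SHP_in_NP: "SHP \<in> NP"
proof -
  have "polytime 2 (\<lambda>xs. [verifies (xs ! 0) (xs ! 1)])"
  proof (rule polytimeI[OF pb_verifier_time])
    fix xs :: "word list" assume xs: "length xs = 2"
    then have X: "inputs xs 1 = xs ! 0" "inputs xs 2 = xs ! 1" by (simp_all add: inputs_def)
    have "length (xs ! 0) \<le> (\<Sum>x\<leftarrow>xs. length x)"
      using xs by (cases xs) auto
    from verifier_time_mono[OF this]
    show "\<exists>e. runs (inputs xs) verifier (\<lambda>_. 0, []) (verifier_time (\<Sum>x\<leftarrow>xs. length x))
      (e, [verifies (xs ! 0) (xs ! 1)])"
      using runs_verifier[of "inputs xs"] runs_mono unfolding X by blast
  qed
  moreover have "x \<in> SHP \<longleftrightarrow> (\<exists>u. length u \<le> poly [:0, 1:] (length x) \<and> verifies x u)" for x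
    using SHP_verifies by simp
  ultimately show ?thesis unfolding NP_def by blast
qed

theorem theorem3p3: "NP_complete SHP"
  unfolding NP_complete_def using SHP_in_NP NP_hard_SHP ..

end
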